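(* Let $k=k(r)$ and $n=n(r)$ be sequences of integers with $k(r)\ge2$ and $n=kr$, and suppose that for some $0<\alpha<1$ we have $k=o(n^{1-\alpha})$ as $r\to\infty$. Let $\lambda=k-1$, $\mu_n=\frac12\log^2(\sqrt{n/\lambda})$ and $\sigma_n^2=\frac13\log^3(\sqrt{n/\lambda})$ (with $\sigma_n>0$). For $r\ge1$ let $X_n=(\log\mathbf{T}-\mu_n)/\sigma_n$, a random variable on the space of $\{0,k\}$-mappings on $n$ nodes with the uniform distribution. Then $X_n$ converges in distribution to a standard normal distribution as $r\to\infty$. Furthermore, $$\mathbb{P}_n^{\{0,k\}}\left(\log\mathbf{T}\le \mu_n+x\sigma_n\right)=\phi(x)+O\left(\frac{|x|+\log^{1/2}(\sqrt{n/\lambda})}{\log^{3/4}(\sqrt{n/\lambda})}\right),$$ where $\phi(x)=\frac{1}{\sqrt{2\pi}}\int_{-\infty}^x e^{-t^2/2}\,dt$.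
   Context: A $\{0,k\}$-mapping on $n$ nodes is a function $f:\{1,\dots,n\}\to\{1,\dots,n\}$ with $|f^{-1}(y)|\in\{0,k\}$ for every $y$. $\mathbf{T}(f)$ is the least common multiple of the lengths of the cycles of $f$. $\mathbb{P}_n^{\{0,k\}}$ denotes probability under the uniform distribution on $\{0,k\}$-mappings on $\{1,\dots,n\}$. Asymptotics are as $r\to\infty$. *)

theory Defs
  imports
    "HOL-Probability.Probability"
    "HOL-Combinatorics.Orbits"
    "HOL-Library.Landau_Symbols"
begin

text \<open>Mappings of \<open>{1..n}\<close> are represented extensionally (\<open>undefined\<close> outside \<open>{1..n}\<close>), so that
  they are in bijection with the mathematical ones and form a finite set.\<close>

definition zero_k_mappings :: "nat \<Rightarrow> nat \<Rightarrow> (nat \<Rightarrow> nat) set" where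
  "zero_k_mappings k n =
     {f \<in> {1..n} \<rightarrow>\<^sub>E {1..n}. \<forall>y\<in>{1..n}. card {x \<in> {1..n}. f x = y} \<in> {0, k}}"

text \<open>The library's \<open>orbit f x\<close> is \<open>{f x, f (f x), \<dots>}\<close>; it contains \<open>x\<close> iff \<open>x\<close> lies on a cycle
  of \<open>f\<close>, and is then the node set of that cycle.\<close>

definition cycles_of :: "nat \<Rightarrow> (nat \<Rightarrow> nat) \<Rightarrow> nat set set" where
  "cycles_of n f = {orbit f x | x. x \<in> {1..n} \<and> x \<in> orbit f x}"

definition T :: "nat \<Rightarrow> (nat \<Rightarrow> nat) \<Rightarrow> nat" where
  "T n f = Lcm (card ` cycles_of n f)"

text \<open>\<open>pmf_of_set\<close> is meaningful only for nonempty finite sets; \<open>zero_k_mappings k n\<close> is nonempty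
  whenever \<open>k\<close> divides \<open>n\<close> and \<open>k > 0\<close>.\<close>

definition unif_zero_k :: "nat \<Rightarrow> nat \<Rightarrow> (nat \<Rightarrow> nat) pmf" where
  "unif_zero_k k n = pmf_of_set (zero_k_mappings k n)"

definition log_sqrt :: "nat \<Rightarrow> nat \<Rightarrow> real" where
  "log_sqrt k n = ln (sqrt (real n / (real k - 1)))"

definition mu_n :: "nat \<Rightarrow> nat \<Rightarrow> real" where
  "mu_n k n = 1 / 2 * log_sqrt k n ^ 2"

definition sigma_n :: "nat \<Rightarrow> nat \<Rightarrow> real" where
  "sigma_n k n = sqrt (1 / 3 * log_sqrt k n ^ 3)"

definition X_n :: "nat \<Rightarrow> nat \<Rightarrow> (nat \<Rightarrow> nat) \<Rightarrow> real" where
  "X_n k n f = (ln (real (T n f)) - mu_n k n) / sigma_n k n"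

definition phi :: "real \<Rightarrow> real" where
  "phi x = 1 / sqrt (2 * pi) * (LINT t:{..x}|lborel. exp (- (t ^ 2) / 2))"

end

theory Submission
  imports Defs "HOL-Number_Theory.Prime_Powers" "HOL-Real_Asymp.Real_Asymp"
begin

text \<open>Given its set of cyclic nodes, a uniform \<open>{0,k}\<close>-mapping acts on that set as a uniform
  permutation, and the number \<open>Z\<close> of cyclic nodes satisfies
  \<open>P(Z \<ge> m) = (\<Prod>i<m. (n - k i) / (n - i))\<close>. Hence \<open>ln Z\<close> stays within \<open>L\<^sup>1\<^sup>/\<^sup>4\<close> of
  \<open>L = ln (sqrt (n / (k - 1)))\<close> outside an event of negligible probability.

  The cycle lengths of a uniform permutation of \<open>m\<close> points are the spacings between the successes of
  independent trials with success probabilities \<open>1 / i\<close>, \<open>i \<le> m\<close> (Feller). Replacing each spacing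
  by the position of the success changes the sum of the logarithms by \<open>O(ln m)\<close> on average and turns it
  into a sum of independent variables with mean about \<open>(ln m)\<^sup>2 / 2\<close> and variance about
  \<open>(ln m)\<^sup>3 / 3\<close>. The least common multiple differs from the product of the cycle lengths only
  through prime powers dividing two or more lengths, which is controlled by a first moment for large prime powers
  and by a second moment for small ones.

  The normalised independent summands are bounded by \<open>\<beta> = O(L\<^sup>-\<^sup>1\<^sup>/\<^sup>2)\<close>. Stein's method with
  a test function of slope \<open>1 / e\<close> has error \<open>O(\<beta> / e + e)\<close>, and \<open>e = sqrt \<beta>\<close> gives the rate
  \<open>L\<^sup>-\<^sup>1\<^sup>/\<^sup>4\<close>.\<close>

section \<open>The cycle lengths of a random permutation\<close>

text \<open>With \<open>D\<close> the fourth root of \<open>L\<close>, the standard deviation is of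
  order \<open>D^6\<close> and the admissible error is \<open>1 / D + |x| / D^3\<close>. So every
  replacement may move the logarithm by \<open>O(D^5)\<close> outside an event of probability
  \<open>O(1 / D)\<close>, and this budget fixes the constants. A window of width \<open>D\<close>
  for \<open>ln Z\<close> moves the mean \<open>(ln Z)^2 / 2\<close> by \<open>O(D^5)\<close> and
  the standard deviation by \<open>O(D^3)\<close>; the latter is the origin of
  \<open>|x| / D^3\<close>. The distortion of Feller's spacings has mean \<open>O(D^4)\<close>, so
  Markov's inequality suffices for it. For repeated prime powers it does not: the plain count up to
  \<open>y\<close> has mean of order \<open>D^4 ln y\<close>, and Markov's inequality would leave a
  logarithm in the rate, hence the second moment there. Beyond \<open>y\<close> the pairs have mean
  \<open>O(D^8 ln y / y)\<close>. As a shift by \<open>D^5\<close> costs \<open>1 / D\<close>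
  anyway, the loss from \<open>\<beta>\<close> to \<open>sqrt \<beta>\<close> in Stein's method does
  no harm. Expectations over permutations are finite averages defined by recursion, so that an
  identity in law becomes an identity between two recursions.\<close>

text \<open>Expectation over Feller's construction of a random cycle structure on \<open>m\<close> points. A list entry
  \<open>(l, J)\<close> is a cycle of length \<open>l\<close> together with the position \<open>J\<close> of the corresponding success: it closes when
  \<open>J - 1\<close> points are left, so the lengths are the spacings of the positions, starting from \<open>m + 1\<close>.\<close>

fun feller_exp :: "nat \<Rightarrow> ((nat \<times> nat) list \<Rightarrow> real) \<Rightarrow> real" where
  "feller_exp 0 F = F []"
| "feller_exp (Suc m) F = (\<Sum>j\<in>{..m}. feller_exp j (\<lambda>M. F ((Suc m - j, Suc j) # M))) / real (Suc m)"

text \<open>Every list averaged by \<open>feller_exp m\<close> has this property, so inequalities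
  need only be checked under it: logarithms of lengths and positions are nonnegative, and divisors
  of lengths are at most \<open>m\<close>.\<close>

definition valid :: "nat \<Rightarrow> (nat \<times> nat) list \<Rightarrow> bool" where
  "valid m M \<longleftrightarrow> (\<forall>x\<in>set M. 1 \<le> fst x \<and> fst x \<le> m \<and> 1 \<le> snd x \<and> snd x \<le> m)"

lemma valid_Nil [simp]: "valid m []" by (simp add: valid_def)

lemma valid_Cons: "j \<le> m \<Longrightarrow> valid j M \<Longrightarrow> valid (Suc m) ((Suc m - j, Suc j) # M)"
  by (fastforce simp: valid_def)

lemma feller_exp_mono: "(\<And>M. valid m M \<Longrightarrow> F M \<le> G M) \<Longrightarrow> feller_exp m F \<le> feller_exp m G"
proof (induction m F arbitrary: G rule: feller_exp.induct)
  case (2 m F)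
  show ?case unfolding feller_exp.simps
    by (intro divide_right_mono sum_mono "2.IH") (auto intro!: "2.prems" valid_Cons)
qed simp

lemma feller_exp_cong: "(\<And>M. valid m M \<Longrightarrow> F M = G M) \<Longrightarrow> feller_exp m F = feller_exp m G"
  by (intro antisym feller_exp_mono) auto

lemma feller_exp_add: "feller_exp m (\<lambda>M. F M + G M) = feller_exp m F + feller_exp m G"
  by (induction m F arbitrary: G rule: feller_exp.induct) (simp_all add: sum.distrib add_divide_distrib)

lemma feller_exp_cmult: "feller_exp m (\<lambda>M. c * F M) = c * feller_exp m F"
  by (induction m F rule: feller_exp.induct) (simp_all add: sum_distrib_left)

lemma feller_exp_const: "feller_exp m (\<lambda>M. c) = c"
  by (induction m "\<lambda>M::(nat\<times>nat) list. c" rule: feller_exp.induct) simp_all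

lemma feller_exp_sum: "finite S \<Longrightarrow> feller_exp m (\<lambda>M. \<Sum>s\<in>S. F s M) = (\<Sum>s\<in>S. feller_exp m (F s))"
  by (induction S rule: finite_induct) (simp_all add: feller_exp_add feller_exp_const)

lemma feller_exp_nonneg: "(\<And>M. valid m M \<Longrightarrow> 0 \<le> F M) \<Longrightarrow> 0 \<le> feller_exp m F"
  using feller_exp_mono[of m "\<lambda>_. 0" F] by (simp add: feller_exp_const)

text \<open>This is the independence of the successes. The choice \<open>j = m\<close>, of
  probability \<open>1 / (m + 1)\<close>, puts a success at \<open>m + 1\<close>; otherwise
  \<open>j\<close> is uniform on \<open>{..<m}\<close>, exactly as in the construction on
  \<open>m\<close> points. The lengths do not split in this way, since they remember the starting
  point \<open>m + 1\<close>.\<close>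

lemma feller_exp_snd_step:
  "feller_exp (Suc m) (\<lambda>M. F (map snd M)) =
     1 / real (Suc m) * feller_exp m (\<lambda>M. F (Suc m # map snd M)) +
     (1 - 1 / real (Suc m)) * feller_exp m (\<lambda>M. F (map snd M))"
proof (cases m)
  case (Suc k)
  have "real (Suc k) * feller_exp (Suc k) (\<lambda>M. F (map snd M)) = (\<Sum>j\<le>k. feller_exp j (\<lambda>M. F (Suc j # map snd M)))"
    by simp
  then have "feller_exp (Suc m) (\<lambda>M. F (map snd M)) =
    (real m * feller_exp m (\<lambda>M. F (map snd M)) + feller_exp m (\<lambda>M. F (Suc m # map snd M))) / real (Suc m)"
    unfolding Suc by (subst feller_exp.simps(2)) (simp del: feller_exp.simps)
  moreover have "1 - 1 / real (Suc m) = real m / real (Suc m)" by (simp add: field_simps)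
  ultimately show ?thesis by (simp add: add_divide_distrib del: feller_exp.simps of_nat_Suc)
qed simp


section \<open>Averages of sums over the cycles, bounded by harmonic numbers\<close>

lemma harm_sum: "(\<Sum>j\<le>m. harm j :: real) = real (Suc m) * harm (Suc m) - real (Suc m)"
proof (induction m)
  case (Suc m)
  have "real (Suc (Suc m)) * harm (Suc (Suc m)) = real (Suc (Suc m)) * harm (Suc m) + (1::real)"
    by (subst harm_Suc) (simp add: distrib_left del: of_nat_Suc)
  then show ?case using Suc by (simp add: algebra_simps)
qed (simp add: harm_Suc)

lemma harm_mean: "(\<Sum>j\<le>m. c + c * harm j :: real) = real (Suc m) * (c * harm (Suc m))"
  by (simp only: sum.distrib sum_distrib_left[symmetric] harm_sum) (simp add: algebra_simps)

text \<open>A contribution of at most \<open>c\<close> per cycle adds up to \<open>c\<close> times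
  the expected number of cycles, which is \<open>harm m\<close>; by \<open>harm_mean\<close> this
  bound solves the recursion with equality. The hypothesis is summed over \<open>j\<close> because
  the contribution of a cycle is small only on average.\<close>

lemma feller_exp_le_harm:
  assumes "\<And>m. (\<Sum>j\<le>m. feller_exp j (\<lambda>M. F ((Suc m - j, Suc j) # M))) \<le> (\<Sum>j\<le>m. c + feller_exp j F)"
    and "F [] \<le> 0" "c \<ge> 0"
  shows "feller_exp m F \<le> c * harm m"
proof (induction m rule: less_induct)
  case (less m)
  show ?case
  proof (cases m)
    case (Suc k)
    have "(\<Sum>j\<le>k. feller_exp j (\<lambda>M. F ((Suc k - j, Suc j) # M))) \<le> (\<Sum>j\<le>k. c + feller_exp j F)" by (rule assms(1))
    also have "\<dots> \<le> (\<Sum>j\<le>k. c + c * harm j)" using less Suc by (intro sum_mono add_left_mono) auto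
    also have "\<dots> = real (Suc k) * (c * harm (Suc k))" by (rule harm_mean)
    finally show ?thesis unfolding Suc feller_exp.simps by (subst pos_divide_le_eq) (simp_all add: mult.commute)
  qed (use assms in \<open>simp add: harm_def\<close>)
qed

lemma ln_sum_lower: "n \<ge> 1 \<Longrightarrow> (\<Sum>i=1..n. ln (real i)) \<ge> real n * ln (real n) - real n"
proof (induction n rule: nat_induct_at_least)
  case (Suc n)
  have "ln (real (Suc n)) - ln (real n) \<le> 1 / real n"
    using ln_diff_le[of "real (Suc n)" "real n"] Suc by simp
  then have "real n * (ln (real (Suc n)) - ln (real n)) \<le> 1" using Suc by (simp add: field_simps)
  then have "real (Suc n) * ln (real (Suc n)) - real (Suc n) \<le> real n * ln (real n) - real n + ln (real (Suc n))"
    by (simp add: algebra_simps)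
  also have "\<dots> \<le> (\<Sum>i=1..n. ln (real i)) + ln (real (Suc n))" using Suc by simp
  finally show ?case by simp
qed simp

definition log_lens :: "(nat \<times> nat) list \<Rightarrow> real" where
  "log_lens M = (\<Sum>x\<leftarrow>M. ln (real (fst x)))"

definition log_pos :: "(nat \<times> nat) list \<Rightarrow> real" where
  "log_pos M = (\<Sum>x\<leftarrow>M. ln (real (snd x)))"

definition log_gap :: "(nat \<times> nat) list \<Rightarrow> real" where
  "log_gap M = (\<Sum>x\<leftarrow>M. \<bar>ln (real (fst x)) - ln (real (snd x))\<bar>)"

lemma log_lens_pos_gap: "\<bar>log_lens M - log_pos M\<bar> \<le> log_gap M"
  by (induction M) (auto simp: log_lens_def log_pos_def log_gap_def)

lemma log_gap_Cons: "log_gap (x # M) = \<bar>ln (real (fst x)) - ln (real (snd x))\<bar> + log_gap M"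
  by (simp add: log_gap_def)

text \<open>The length \<open>Suc m - j\<close> and the position \<open>Suc j\<close> are both
  uniform on \<open>{1..Suc m}\<close>, and by Stirling's lower bound the logarithm of a uniform
  element is on average within 1 of \<open>ln (Suc m)\<close>. Comparing both logarithms with that
  maximum costs 2 per cycle.\<close>

lemma feller_exp_log_gap: "feller_exp m log_gap \<le> 2 * harm m"
proof (rule feller_exp_le_harm)
  fix m
  have "(\<Sum>j\<le>m. \<bar>ln (real (Suc m - j)) - ln (real (Suc j))\<bar>) \<le> 
     (\<Sum>j\<le>m. (ln (real (Suc m)) - ln (real (Suc m - j))) + (ln (real (Suc m)) - ln (real (Suc j))))"
  proof (rule sum_mono)
    fix j assume "j \<in> {..m}"
    then have "ln (real (Suc m - j)) \<le> ln (real (Suc m))" "ln (real (Suc j)) \<le> ln (real (Suc m))"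
      by (auto simp del: of_nat_Suc)
    then show "\<bar>ln (real (Suc m - j)) - ln (real (Suc j))\<bar> \<le> 
      (ln (real (Suc m)) - ln (real (Suc m - j))) + (ln (real (Suc m)) - ln (real (Suc j)))" by linarith
  qed
  also have "\<dots> = 2 * (real (Suc m) * ln (real (Suc m))) - (\<Sum>j\<le>m. ln (real (Suc m - j))) - (\<Sum>j\<le>m. ln (real (Suc j)))"
    by (simp only: sum.distrib sum_subtractf sum_constant) simp
  also have "(\<Sum>j\<le>m. ln (real (Suc m - j))) = (\<Sum>j\<le>m. ln (real (Suc j)))"
    by (rule sum.reindex_bij_witness[of _ "\<lambda>j. m - j" "\<lambda>j. m - j"]) (auto simp: Suc_diff_le)
  also have "(\<Sum>j\<le>m. ln (real (Suc j))) = (\<Sum>i=1..Suc m. ln (real i))"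
    by (rule sum.reindex_bij_witness[of _ "\<lambda>j. j - 1" Suc]) auto
  finally have "(\<Sum>j\<le>m. \<bar>ln (real (Suc m - j)) - ln (real (Suc j))\<bar>) \<le> 2 * real (Suc m)"
    using ln_sum_lower[of "Suc m"] by simp
  then show "(\<Sum>j\<le>m. feller_exp j (\<lambda>M. log_gap ((Suc m - j, Suc j) # M))) \<le> (\<Sum>j\<le>m. 2 + feller_exp j log_gap)"
    by (simp only: log_gap_Cons fst_conv snd_conv feller_exp_add feller_exp_const sum.distrib sum_constant) simp
qed (auto simp: log_gap_def)

definition ndiv :: "nat \<Rightarrow> (nat \<times> nat) list \<Rightarrow> real" where
  "ndiv q M = (\<Sum>x\<leftarrow>M. of_bool (q dvd fst x))"

lemma ndiv_Cons: "ndiv q (x # M) = of_bool (q dvd fst x) + ndiv q M"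
  by (simp add: ndiv_def)

lemma count_multiples:
  assumes "q \<ge> 1" shows "(\<Sum>j\<le>m. of_bool (q dvd (Suc m - j)) :: real) \<le> real (Suc m) / real q"
proof -
  have "(\<Sum>j\<le>m. of_bool (q dvd (Suc m - j)) :: real) = (\<Sum>i\<in>{1..Suc m}. of_bool (q dvd i))"
    by (rule sum.reindex_bij_witness[of _ "\<lambda>i. Suc m - i" "\<lambda>j. Suc m - j"]) auto
  also have "\<dots> = real (card {i\<in>{1..Suc m}. q dvd i})"
    by (subst sum_of_bool_eq) (simp_all only: Int_def mem_Collect_eq finite_atLeastAtMost)
  finally have eq: "(\<Sum>j\<le>m. of_bool (q dvd (Suc m - j)) :: real) = real (card {i\<in>{1..Suc m}. q dvd i})" .
  have "{i\<in>{1..Suc m}. q dvd i} \<subseteq> (\<lambda>t. q * t) ` {1..Suc m div q}"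
  proof
    fix i assume "i \<in> {i\<in>{1..Suc m}. q dvd i}"
    then obtain t where t: "i = q * t" "1 \<le> i" "i \<le> Suc m" by auto
    then have "1 \<le> t" "t \<le> Suc m div q" using assms by (auto simp: less_eq_div_iff_mult_less_eq mult.commute Suc_le_eq)
    then show "i \<in> (\<lambda>t. q * t) ` {1..Suc m div q}" using t by auto
  qed
  then have "card {i\<in>{1..Suc m}. q dvd i} \<le> Suc m div q"
    using surj_card_le[of "{1..Suc m div q}" "{i\<in>{1..Suc m}. q dvd i}" "\<lambda>t. q * t"] by simp
  moreover have "real (Suc m div q) \<le> real (Suc m) / real q" by (rule of_nat_div_le_of_nat)
  ultimately show ?thesis unfolding eq by linarith
qed

lemma feller_exp_ndiv: assumes "q \<ge> 1" shows "feller_exp m (ndiv q) \<le> 1 / real q * harm m"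
proof (rule feller_exp_le_harm)
  fix m
  show "(\<Sum>j\<le>m. feller_exp j (\<lambda>M. ndiv q ((Suc m - j, Suc j) # M))) \<le> (\<Sum>j\<le>m. 1 / real q + feller_exp j (ndiv q))"
    using count_multiples[OF assms, of m]
    by (simp only: ndiv_Cons fst_conv feller_exp_add feller_exp_const sum.distrib sum_constant) simp
qed (auto simp: ndiv_def)

text \<open>A new length divisible by \<open>q\<close> raises \<open>N (N - 1)\<close> by
  \<open>2 N\<close>. The factorial moment is used because, unlike the second moment, it is of order
  \<open>1 / q^2\<close> and therefore summable against \<open>mangoldt q\<close>.\<close>

lemma feller_exp_ndiv_fact2:
  assumes "q \<ge> 1" shows "feller_exp m (\<lambda>M. ndiv q M * (ndiv q M - 1)) \<le> 2 * (harm m / real q)\<^sup>2"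
proof (induction m rule: less_induct)
  case (less m)
  show ?case
  proof (cases m)
    case 0 then show ?thesis by (simp add: ndiv_def)
  next
    case (Suc k)
    let ?H = "harm (Suc k) :: real" and ?G = "\<lambda>M. ndiv q M * (ndiv q M - 1)"
    have H: "harm j \<le> ?H" "0 \<le> (harm j :: real)" if "j \<le> Suc k" for j
      using that harm_nonneg harm_mono by auto
    have "(\<Sum>j\<le>k. feller_exp j (\<lambda>M. ?G ((Suc k - j, Suc j) # M)))
       = (\<Sum>j\<le>k. 2 * of_bool (q dvd (Suc k - j)) * feller_exp j (ndiv q) + feller_exp j ?G)"
    proof (rule sum.cong)
      fix j
      have "feller_exp j (\<lambda>M. ?G ((Suc k - j, Suc j) # M)) = feller_exp j (\<lambda>M. 2 * of_bool (q dvd (Suc k - j)) * ndiv q M + ?G M)"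
        by (intro feller_exp_cong) (auto simp: ndiv_def algebra_simps)
      then show "feller_exp j (\<lambda>M. ?G ((Suc k - j, Suc j) # M)) = 2 * of_bool (q dvd (Suc k - j)) * feller_exp j (ndiv q) + feller_exp j ?G"
        by (simp only: feller_exp_add feller_exp_cmult)
    qed simp
    \<comment> \<open>Only one of the two factors \<open>harm j\<close> is enlarged to
      \<open>?H\<close>, so that \<open>harm_sum\<close> applies to the other. Its term
      \<open>- Suc k\<close> then cancels the contribution of the new cycle exactly, and the bound
      reproduces itself.\<close>
    also have "\<dots> \<le> (\<Sum>j\<le>k. 2 * of_bool (q dvd (Suc k - j)) * (1 / real q * ?H) + 2 * ((?H / (real q)\<^sup>2) * harm j))"
    proof (intro sum_mono add_mono mult_left_mono)
      fix j assume j: "j \<in> {..k}"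
      show "feller_exp j (ndiv q) \<le> 1 / real q * ?H"
        using feller_exp_ndiv[OF assms, of j] H(1)[of j] j assms
        by (elim order_trans) (auto intro!: divide_right_mono)
      have "feller_exp j ?G \<le> 2 * (harm j / real q)\<^sup>2" using less j Suc by simp
      also have "\<dots> = 2 * ((harm j / (real q)\<^sup>2) * harm j)" by (simp add: power2_eq_square)
      also have "\<dots> \<le> 2 * ((?H / (real q)\<^sup>2) * harm j)"
        using H[of j] j by (intro mult_left_mono mult_right_mono divide_right_mono) auto
      finally show "feller_exp j ?G \<le> 2 * ((?H / (real q)\<^sup>2) * harm j)" .
    qed auto
    also have "\<dots> = 2 * (1 / real q * ?H) * (\<Sum>j\<le>k. of_bool (q dvd (Suc k - j))) + 2 * (?H / (real q)\<^sup>2) * (\<Sum>j\<le>k. harm j)"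
      unfolding sum_distrib_left sum.distrib[symmetric] by (intro sum.cong) (simp_all add: algebra_simps)
    also have "\<dots> \<le> 2 * (1 / real q * ?H) * (real (Suc k) / real q) + 2 * (?H / (real q)\<^sup>2) * (\<Sum>j\<le>k. harm j)"
      using count_multiples[OF assms, of k] H[of "Suc k"] by (intro add_mono mult_left_mono) auto
    also have "\<dots> = real (Suc k) * (2 * (?H / real q)\<^sup>2)"
      unfolding harm_sum
      by (simp add: power2_eq_square algebra_simps diff_divide_distrib add_divide_distrib)
    finally show ?thesis unfolding Suc feller_exp.simps by (subst pos_divide_le_eq) (simp_all add: mult.commute)
  qed
qed

lemma feller_exp_ndiv_sq:
  assumes "q \<ge> 1" shows "feller_exp m (\<lambda>M. (ndiv q M)\<^sup>2) \<le> 2 * (harm m / real q)\<^sup>2 + harm m / real q"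
proof -
  have "feller_exp m (\<lambda>M. (ndiv q M)\<^sup>2) = feller_exp m (\<lambda>M. ndiv q M * (ndiv q M - 1) + ndiv q M)"
    by (intro feller_exp_cong) (simp add: power2_eq_square algebra_simps)
  then show ?thesis using feller_exp_ndiv[OF assms, of m] feller_exp_ndiv_fact2[OF assms, of m] by (simp add: feller_exp_add)
qed

section \<open>The least common multiple against the product of the cycle lengths\<close>

definition lens_lcm :: "(nat \<times> nat) list \<Rightarrow> nat" where
  "lens_lcm M = Lcm (fst ` set M)"

lemma lens_lcm_dvd: "lens_lcm M dvd prod_list (map fst M)"
  unfolding lens_lcm_def
proof (rule Lcm_least)
  fix a assume "a \<in> fst ` set M"
  then show "a dvd prod_list (map fst M)" by (induction M) (auto intro: dvd_mult)
qed

lemma ln_lcm_le: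
  assumes "valid m M" shows "ln (real (lens_lcm M)) \<le> log_lens M" "lens_lcm M > 0"
proof -
  have pos: "prod_list (map fst M) > 0" using assms
    by (induction M) (auto simp: valid_def Suc_le_eq)
  have "log_lens M = ln (real (prod_list (map fst M)))"
    using assms by (induction M) (auto simp: valid_def log_lens_def ln_mult Suc_le_eq prod_list_zero_iff)
  moreover have "lens_lcm M \<le> prod_list (map fst M)" "lens_lcm M > 0"
    using pos lens_lcm_dvd[of M] by (auto intro: dvd_imp_le dvd_pos_nat)
  ultimately show "ln (real (lens_lcm M)) \<le> log_lens M" "lens_lcm M > 0" by auto
qed

text \<open>Each \<open>ln l\<close> is the sum of \<open>mangoldt d\<close> over the divisors
  \<open>d\<close> of \<open>l\<close>; exchanging the summations counts every prime power with
  multiplicity \<open>ndiv d M\<close>.\<close>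

lemma log_lens_mangoldt:
  assumes "valid m M" shows "log_lens M = (\<Sum>d=1..m. mangoldt d * ndiv d M)"
  using assms
proof (induction M)
  case (Cons x M)
  have x: "1 \<le> fst x" "fst x \<le> m" and "valid m M" using Cons.prems by (auto simp: valid_def)
  have "ln (real (fst x)) = (\<Sum>d | d dvd fst x. mangoldt d)" using x by (subst mangoldt_sum) auto
  also have "\<dots> = (\<Sum>d=1..m. mangoldt d * of_bool (d dvd fst x))"
  proof (rule sum.mono_neutral_cong_left)
    show "{d. d dvd fst x} \<subseteq> {1..m}"
    proof
      fix d assume "d \<in> {d. d dvd fst x}"
      then have "d \<le> fst x" "d > 0" using x dvd_imp_le[of d "fst x"] dvd_pos_nat[of "fst x" d] by auto
      then show "d \<in> {1..m}" using x by simp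
    qed
  qed auto
  finally show ?case using Cons.IH[OF \<open>valid m M\<close>]
    by (simp add: log_lens_def ndiv_def distrib_left sum.distrib)
qed (simp add: log_lens_def ndiv_def)

text \<open>A prime power that divides some length divides the least common multiple, and so
  contributes there once, however many lengths it divides.\<close>

lemma ln_lcm_mangoldt:
  assumes "valid m M" shows "ln (real (lens_lcm M)) \<ge> (\<Sum>d=1..m. mangoldt d * of_bool (ndiv d M \<noteq> 0))"
proof -
  let ?L = "lens_lcm M"
  have L: "?L > 0" using ln_lcm_le[OF assms] by simp
  have nd: "d dvd ?L" if "ndiv d M \<noteq> 0" for d
  proof -
    have "ndiv d M = 0" if "\<forall>x\<in>set M. \<not> d dvd fst x"
      using that by (induction M) (auto simp: ndiv_def)
    with that have "\<exists>x\<in>set M. d dvd fst x" by blast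
    then obtain x where "x \<in> set M" "d dvd fst x" by blast
    moreover from this have "fst x dvd ?L" unfolding lens_lcm_def by (intro dvd_Lcm) auto
    ultimately show ?thesis using dvd_trans by blast
  qed
  have "(\<Sum>d=1..m. mangoldt d * of_bool (ndiv d M \<noteq> 0)) = (\<Sum>d\<in>{d\<in>{1..m}. ndiv d M \<noteq> 0}. mangoldt d :: real)"
    by (intro sum.mono_neutral_cong_right) auto
  also have "\<dots> \<le> (\<Sum>d | d dvd ?L. mangoldt d)"
    using L nd by (intro sum_mono2) (auto simp: mangoldt_nonneg)
  also have "\<dots> = ln (real ?L)" using L by (subst mangoldt_sum) auto
  finally show ?thesis .
qed

text \<open>The excess of the logarithm of the product over that of the least common multiple is the sum over
  \<open>d\<close> of \<open>mangoldt d\<close> times the number of lengths divisible by \<open>d\<close> beyond the first one. For \<open>d \<le> y\<close> this number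
  is estimated by the number itself, for \<open>d > y\<close> by the number of ordered pairs.\<close>

definition small_part :: "nat \<Rightarrow> (nat \<times> nat) list \<Rightarrow> real" where
  "small_part y M = (\<Sum>d=1..y. mangoldt d * ndiv d M)"

definition large_part :: "nat \<Rightarrow> nat \<Rightarrow> (nat \<times> nat) list \<Rightarrow> real" where
  "large_part y m M = (\<Sum>d=Suc y..m. mangoldt d * (ndiv d M * (ndiv d M - 1)))"

text \<open>Integrality excludes values strictly between 0 and 1: a nonzero count is at least 1, and
  \<open>N (N - 1)\<close> is never negative.\<close>

lemma ndiv_int: "\<exists>k::nat. ndiv q M = real k"
proof (induction M)
  case (Cons x M)
  then obtain k where "ndiv q M = real k" by blast
  then have "ndiv q (x # M) = real (k + of_bool (q dvd fst x))" by (simp add: ndiv_def)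
  then show ?case by blast
qed (auto simp: ndiv_def)

lemma ndiv_fact2: "ndiv q M - of_bool (ndiv q M \<noteq> 0) \<le> ndiv q M * (ndiv q M - 1)"
    "0 \<le> ndiv q M * (ndiv q M - 1)"
proof -
  obtain k where k: "ndiv q M = real k" using ndiv_int by blast
  have "k = 0 \<or> k = 1 \<or> (\<exists>j. k = Suc (Suc j))" by (metis not0_implies_Suc One_nat_def)
  then show "ndiv q M - of_bool (ndiv q M \<noteq> 0) \<le> ndiv q M * (ndiv q M - 1)"
    "0 \<le> ndiv q M * (ndiv q M - 1)" unfolding k by (auto simp: algebra_simps)
qed

lemma log_lens_minus_lcm:
  assumes "valid m M"
  shows "log_lens M - ln (real (lens_lcm M)) \<le> small_part y M + large_part y m M"
proof -
  let ?f = "\<lambda>d. mangoldt d * (ndiv d M - of_bool (ndiv d M \<noteq> 0)) :: real"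
  have "log_lens M - ln (real (lens_lcm M)) \<le> (\<Sum>d=1..m. ?f d)"
    using log_lens_mangoldt[OF assms] ln_lcm_mangoldt[OF assms] by (simp add: right_diff_distrib sum_subtractf)
  \<comment> \<open>The union is larger than \<open>{1..m}\<close> when \<open>y > m\<close>;
    nonnegative terms allow both cases to be treated together.\<close>
  also have "\<dots> \<le> (\<Sum>d\<in>{1..y} \<union> {Suc y..m}. ?f d)"
  proof (rule sum_mono2)
    fix d
    have "0 \<le> ndiv d M - of_bool (ndiv d M \<noteq> 0)"
      using ndiv_int[of d M] by (auto simp: Suc_le_eq)
    then show "0 \<le> ?f d" by (simp add: mangoldt_nonneg)
  qed auto
  also have "\<dots> = (\<Sum>d=1..y. ?f d) + (\<Sum>d=Suc y..m. ?f d)"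
    by (rule sum.union_disjoint) auto
  also have "\<dots> \<le> small_part y M + large_part y m M"
    unfolding small_part_def large_part_def
    by (intro add_mono sum_mono mult_left_mono ndiv_fact2 mangoldt_nonneg) (auto)
  finally show ?thesis .
qed

text \<open>Telescoping with \<open>G d = (ln d + 2) / d\<close>. The antiderivative of
  \<open>ln x / x^2\<close> is \<open>- (ln x + 1) / x\<close>; the constant 2 in place of 1 absorbs
  the difference between sum and integral.\<close>

lemma sum_ln_over_sq:
  assumes "y \<ge> 1"
  shows "(\<Sum>d=Suc y..m. ln (real d) / (real d)\<^sup>2) \<le> (ln (real y) + 2) / real y"
proof -
  define G where "G d = (ln (real d) + 2) / real d" for d :: nat
  have step: "ln (real (Suc d)) / (real (Suc d))\<^sup>2 \<le> G d - G (Suc d)" if "d \<ge> 1" for d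
  proof -
    define a b x where "a = ln (real d)" and "b = ln (real (Suc d))" and "x = real d"
    have x: "x \<ge> 1" using that by (simp add: x_def)
    have ab: "b - a \<le> 1 / x" using ln_diff_le[of "real (Suc d)" "real d"] that by (simp add: a_def b_def x_def)
    have b: "b \<ge> 0" by (simp add: b_def)
    have "b / (x + 1)\<^sup>2 \<le> b / (x * (x + 1))"
      using x b by (intro divide_left_mono) (auto simp: power2_eq_square)
    also have "\<dots> = b / x - b / (x + 1)" using x by (simp add: field_simps)
    also have "b / x \<le> (a + 1 / x) / x" using ab x by (intro divide_right_mono) auto
    also have "(a + 1 / x) / x = a / x + 1 / x\<^sup>2" using x by (simp add: field_simps power2_eq_square)
    also have "1 / x\<^sup>2 \<le> 2 / x - 2 / (x + 1)"
    proof -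
      have "2 / (x * (x + x)) \<le> 2 / (x * (x + 1))"
        using x by (intro divide_left_mono mult_left_mono add_left_mono) auto
      then show ?thesis using x by (simp add: field_simps power2_eq_square)
    qed
    finally have "b / (x + 1)\<^sup>2 \<le> (a + 2) / x - (b + 2) / (x + 1)" by (simp add: add_divide_distrib)
    then show ?thesis by (simp add: G_def a_def b_def x_def add.commute)
  qed
  have "(\<Sum>d=Suc y..m. ln (real d) / (real d)\<^sup>2) \<le> G y - G m" if "y \<le> m"
    using that
  proof (induction m rule: dec_induct)
    case (step m)
    then show ?case using step(3) assms \<open>\<And>d. d \<ge> 1 \<Longrightarrow> _ d\<close>[of m]
      by simp
  qed simp
  moreover have "G m \<ge> 0" by (cases "m = 0") (auto simp: G_def)
  moreover have "G y \<ge> 0" using assms by (auto simp: G_def)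
  ultimately show ?thesis unfolding G_def by (cases "y \<le> m") auto
qed

lemma feller_exp_large_part:
  assumes "y \<ge> 1"
  shows "feller_exp m (large_part y m) \<le> 2 * (harm m)\<^sup>2 * ((ln (real y) + 2) / real y)"
proof -
  have "feller_exp m (large_part y m) = (\<Sum>d=Suc y..m. mangoldt d * feller_exp m (\<lambda>M. ndiv d M * (ndiv d M - 1)))"
    unfolding large_part_def[abs_def] by (simp add: feller_exp_sum feller_exp_cmult)
  also have "\<dots> \<le> (\<Sum>d=Suc y..m. ln (real d) * (2 * (harm m / real d)\<^sup>2))"
    by (intro sum_mono mult_mono feller_exp_ndiv_fact2 mangoldt_le feller_exp_nonneg ndiv_fact2) (auto)
  also have "\<dots> = 2 * (harm m)\<^sup>2 * (\<Sum>d=Suc y..m. ln (real d) / (real d)\<^sup>2)"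
    by (simp add: sum_distrib_left power_divide mult_ac)
  also have "\<dots> \<le> 2 * (harm m)\<^sup>2 * ((ln (real y) + 2) / real y)"
    using sum_ln_over_sq[OF assms] by (intro mult_left_mono) auto
  finally show ?thesis .
qed

text \<open>Cauchy-Schwarz with the weights \<open>1 / d\<close>, whose sum is
  \<open>harm y\<close>, reduces the square of the sum to the second moments of the single counts,
  so that no joint moment for two different divisors occurs. The price is a power of
  \<open>ln y\<close>, which the choice of \<open>y\<close> can afford.\<close>

lemma feller_exp_small_part_sq:
  assumes "y \<ge> 1"
  shows "feller_exp m (\<lambda>M. (small_part y M)\<^sup>2) \<le> harm y * ((ln (real y))\<^sup>2 * (2 * (harm m)\<^sup>2 * harm y + harm m * real y))"
proof -
  have CS: "(small_part y M)\<^sup>2 \<le> harm y * (\<Sum>d=1..y. real d * (mangoldt d)\<^sup>2 * (ndiv d M)\<^sup>2)" for M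
  proof -
    have "small_part y M = (\<Sum>d=1..y. (1 / sqrt (real d)) * (sqrt (real d) * mangoldt d * ndiv d M))"
      unfolding small_part_def by (intro sum.cong) auto
    also have "\<dots>\<^sup>2 \<le> (\<Sum>d=1..y. (1 / sqrt (real d))\<^sup>2) * (\<Sum>d=1..y. (sqrt (real d) * mangoldt d * ndiv d M)\<^sup>2)"
      by (rule Cauchy_Schwarz_ineq_sum)
    also have "(\<Sum>d=1..y. (1 / sqrt (real d))\<^sup>2) = harm y"
      unfolding harm_def by (intro sum.cong) (auto simp: power_divide divide_inverse power_inverse)
    also have "(\<Sum>d=1..y. (sqrt (real d) * mangoldt d * ndiv d M)\<^sup>2) = (\<Sum>d=1..y. real d * (mangoldt d)\<^sup>2 * (ndiv d M)\<^sup>2)"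
      by (simp add: power_mult_distrib)
    finally show ?thesis .
  qed
  have "feller_exp m (\<lambda>M. (small_part y M)\<^sup>2) \<le> feller_exp m (\<lambda>M. harm y * (\<Sum>d=1..y. real d * (mangoldt d)\<^sup>2 * (ndiv d M)\<^sup>2))"
    by (intro feller_exp_mono CS)
  also have "\<dots> = harm y * (\<Sum>d=1..y. real d * (mangoldt d)\<^sup>2 * feller_exp m (\<lambda>M. (ndiv d M)\<^sup>2))"
    by (simp only: feller_exp_cmult feller_exp_sum[OF finite_atLeastAtMost])
  also have "\<dots> \<le> harm y * (\<Sum>d=1..y. real d * (ln (real y))\<^sup>2 * (2 * (harm m / real d)\<^sup>2 + harm m / real d))"
  proof (intro mult_left_mono[OF _ harm_nonneg] sum_mono mult_mono feller_exp_ndiv_sq)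
    fix d assume d: "d \<in> {1..y}"
    have "mangoldt d \<le> ln (real d)" using d by (intro mangoldt_le) auto
    also have "\<dots> \<le> ln (real y)" using d by auto
    finally show "(mangoldt d)\<^sup>2 \<le> (ln (real y))\<^sup>2" by (intro power_mono) (auto simp: mangoldt_nonneg)
  qed (auto intro!: feller_exp_nonneg)
  also have "(\<Sum>d=1..y. real d * (ln (real y))\<^sup>2 * (2 * (harm m / real d)\<^sup>2 + harm m / real d))
     = (\<Sum>d=1..y. (ln (real y))\<^sup>2 * (2 * (harm m)\<^sup>2 * inverse (real d) + harm m))"
    by (intro sum.cong) (auto simp: field_simps power2_eq_square)
  also have "\<dots> = (ln (real y))\<^sup>2 * (2 * (harm m)\<^sup>2 * harm y + harm m * real y)"
    by (simp add: sum.distrib harm_def[of y] mult.commute flip: sum_distrib_left sum_distrib_right)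
  finally show ?thesis .
qed

section \<open>Cycle types of uniform permutations\<close>

definition cycle_type_exp :: "nat \<Rightarrow> (nat multiset \<Rightarrow> real) \<Rightarrow> real" where
  "cycle_type_exp m F = feller_exp m (\<lambda>M. F (mset (map fst M)))"

lemma cycle_type_exp_Suc: "real (Suc m) * cycle_type_exp (Suc m) F = (\<Sum>j\<le>m. cycle_type_exp j (\<lambda>M. F (add_mset (Suc m - j) M)))"
  unfolding cycle_type_exp_def by simp

lemma cycle_type_exp_add: "cycle_type_exp m (\<lambda>M. F M + G M) = cycle_type_exp m F + cycle_type_exp m G"
  by (simp add: cycle_type_exp_def feller_exp_add)

lemma cycle_type_exp_cmult: "cycle_type_exp m (\<lambda>M. c * F M) = c * cycle_type_exp m F"
  by (simp add: cycle_type_exp_def feller_exp_cmult)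

text \<open>A new point either forms a cycle of its own or is inserted at one of the \<open>c\<close> places of a cycle of
  length \<open>c\<close>. This recursion, unlike the one defining \<open>feller_exp\<close>, matches
  \<open>permutes_insert\<close>.\<close>

lemma cycle_type_exp_chinese_restaurant:
  "real (Suc m) * cycle_type_exp (Suc m) F =
     cycle_type_exp m (\<lambda>M. F (add_mset 1 M) + (\<Sum>c\<in>#M. real c * F (add_mset (Suc c) (M - {#c#}))))"
proof (induction m arbitrary: F rule: less_induct)
  case (less m)
  show ?case
  proof (cases m)
    case 0 then show ?thesis by (simp add: cycle_type_exp_def)
  next
    case (Suc k)
    define h where "h i = cycle_type_exp i (\<lambda>M. F (add_mset (Suc m - i) M))" for i
    let ?R = "\<lambda>M. F (add_mset 1 M) + (\<Sum>c\<in>#M. real c * F (add_mset (Suc c) (M - {#c#})))"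
    have "real m * cycle_type_exp m ?R = (\<Sum>j\<le>k. cycle_type_exp j (\<lambda>M. ?R (add_mset (m - j) M)))"
      unfolding Suc by (rule cycle_type_exp_Suc)
    \<comment> \<open>Condition on the first cycle, of length \<open>m - j\<close>. Either the new
      point enters it, with weight \<open>m - j\<close>, or it enters the other \<open>j\<close>
      points, where the induction hypothesis applies to \<open>F\<close> with that cycle added. The
      total weight of each \<open>h i\<close> becomes \<open>i + (m - i) = m\<close>.\<close>
    also have "\<dots> = (\<Sum>j\<le>k. real (Suc j) * h (Suc j) + real (m - j) * h j)"
    proof (rule sum.cong)
      fix j assume j: "j \<in> {..k}"
      let ?G = "\<lambda>M. F (add_mset (m - j) M)"
      have "cycle_type_exp j (\<lambda>M. ?R (add_mset (m - j) M)) = 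
         cycle_type_exp j (\<lambda>M. (?G (add_mset 1 M) + (\<Sum>c\<in>#M. real c * ?G (add_mset (Suc c) (M - {#c#})))) + real (m - j) * F (add_mset (Suc m - j) M))"
      proof -
        have "?R (add_mset (m - j) M) = (?G (add_mset 1 M) + (\<Sum>c\<in>#M. real c * ?G (add_mset (Suc c) (M - {#c#})))) + real (m - j) * F (add_mset (Suc m - j) M)" for M
        proof -
          have "(\<Sum>c\<in>#M. real c * F (add_mset (Suc c) (add_mset (m - j) M - {#c#}))) = 
             (\<Sum>c\<in>#M. real c * ?G (add_mset (Suc c) (M - {#c#})))"
            by (intro arg_cong[where f = sum_mset] image_mset_cong)
               (auto simp: add_mset_commute diff_union_swap2 dest!: multi_member_split)
          then show ?thesis using j Suc by (simp add: add_mset_commute Suc_diff_le)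
        qed
        then show ?thesis by simp
      qed
      also have "\<dots> = real (Suc j) * cycle_type_exp (Suc j) ?G + real (m - j) * h j"
      proof -
        have "real (Suc j) * cycle_type_exp (Suc j) ?G = cycle_type_exp j (\<lambda>M. ?G (add_mset 1 M) + (\<Sum>c\<in>#M. real c * ?G (add_mset (Suc c) (M - {#c#}))))"
          by (rule less) (use j Suc in simp)
        then show ?thesis by (simp only: cycle_type_exp_add cycle_type_exp_cmult h_def)
      qed
      finally show "cycle_type_exp j (\<lambda>M. ?R (add_mset (m - j) M)) = real (Suc j) * h (Suc j) + real (m - j) * h j"
        by (simp add: h_def)
    qed simp
    also have "\<dots> = (\<Sum>j\<le>k. real (Suc j) * h (Suc j)) + (\<Sum>j\<le>k. real (m - j) * h j)"
      by (rule sum.distrib)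
    also have "(\<Sum>j\<le>k. real (Suc j) * h (Suc j)) = (\<Sum>i\<le>m. real i * h i)"
      unfolding Suc by (subst sum.atMost_Suc_shift) simp
    also have "(\<Sum>j\<le>k. real (m - j) * h j) = (\<Sum>i\<le>m. real (m - i) * h i)"
      unfolding Suc by simp
    also have "(\<Sum>i\<le>m. real i * h i) + (\<Sum>i\<le>m. real (m - i) * h i) = (\<Sum>i\<le>m. real m * h i)"
      by (subst sum.distrib[symmetric]) (auto intro!: sum.cong simp: algebra_simps of_nat_diff)
    also have "\<dots> = real m * (real (Suc m) * cycle_type_exp (Suc m) F)"
      by (simp only: sum_distrib_left[symmetric] cycle_type_exp_Suc h_def)
    finally show ?thesis using Suc by simp
  qed
qed

definition cycle_type :: "('a \<Rightarrow> 'a) \<Rightarrow> 'a set \<Rightarrow> nat multiset" where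
  "cycle_type f A = image_mset card (mset_set (orbit f ` A))"

context
  fixes q :: "'a \<Rightarrow> 'a" and S :: "'a set"
  assumes q: "q permutes S" and S: "finite S"
begin

lemma q_permutation: "permutation q"
  using q S permutation_permutes by blast

lemma q_self: "x \<in> orbit q x"
  by (rule permutation_self_in_orbit[OF q_permutation])

lemma q_orbit_sub: "x \<in> S \<Longrightarrow> orbit q x \<subseteq> S"
  using permutes_orbit_subset[OF q] .

lemma q_orbit_eq: "y \<in> orbit q x \<Longrightarrow> orbit q y = orbit q x"
  by (meson orbit_swap orbit_trans q_self subsetI subset_antisym)

lemma q_orbit_class: "x \<in> S \<Longrightarrow> {y \<in> S. orbit q y = orbit q x} = orbit q x"
  using q_orbit_sub[of x] q_orbit_eq q_self by blast

text \<open>A cycle of length \<open>c\<close> contains \<open>c\<close> points. This turns the sum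
  over the places where a point can be inserted into the weights \<open>c\<close> of
  \<open>cycle_type_exp_chinese_restaurant\<close>.\<close>

lemma sum_over_cycles:
  "(\<Sum>b\<in>S. g (card (orbit q b)) :: real) = (\<Sum>c\<in>#cycle_type q S. real c * g c)"
proof -
  have "(\<Sum>b\<in>S. g (card (orbit q b))) = (\<Sum>B\<in>orbit q ` S. \<Sum>b\<in>{x\<in>S. orbit q x = B}. g (card (orbit q b)))"
    by (rule sum.image_gen[OF S])
  also have "\<dots> = (\<Sum>B\<in>orbit q ` S. real (card B) * g (card B))"
  proof (rule sum.cong)
    fix B assume "B \<in> orbit q ` S"
    then have "{x\<in>S. orbit q x = B} = B" using q_orbit_class by blast
    moreover have "(\<Sum>b\<in>{x\<in>S. orbit q x = B}. g (card (orbit q b))) = (\<Sum>b\<in>{x\<in>S. orbit q x = B}. g (card B))"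
      by (rule sum.cong) auto
    ultimately show "(\<Sum>b\<in>{x\<in>S. orbit q x = B}. g (card (orbit q b))) = real (card B) * g (card B)" by simp
  qed simp
  also have "\<dots> = (\<Sum>c\<in>#cycle_type q S. real c * g c)"
    unfolding cycle_type_def by (simp add: sum_unfold_sum_mset multiset.map_comp o_def)
  finally show ?thesis .
qed

context
  fixes a :: 'a assumes a: "a \<notin> S"
begin

lemma q_a: "q a = a" using q a by (rule permutes_not_in)

lemma orbit_q_a: "orbit q a = {a}" using q_a by (simp add: orbit_eq_singleton_iff)

lemma cycle_type_insert_fixpoint:
  "cycle_type q (insert a S) = add_mset 1 (cycle_type q S)"
proof -
  have "{a} \<notin> orbit q ` S" using q_orbit_sub a by blast
  then show ?thesis unfolding cycle_type_def by (simp add: orbit_q_a S)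
qed

context
  fixes b :: 'a assumes b: "b \<in> S"
begin

text \<open>Composition with the transposition inserts \<open>a\<close> into the cycle of
  \<open>b\<close> immediately before \<open>b\<close>: \<open>a\<close> is sent to
  \<open>b\<close>, and the former predecessor of \<open>b\<close> to \<open>a\<close>.\<close>

abbreviation (input) "splice_cycle \<equiv> Transposition.transpose a b \<circ> q"

lemma splice_cycle_a: "splice_cycle a = b" by (simp add: q_a)

lemma splice_cycle_S: assumes "x \<in> S" shows "splice_cycle x = (if q x = b then a else q x)"
proof -
  have "q x \<in> S" using q assms by (simp add: permutes_in_image)
  then show ?thesis using a by (auto simp: Transposition.transpose_def)
qed

lemma splice_cycle_permutation: "permutation splice_cycle"
proof -
  have "splice_cycle permutes insert a S"
    using permutes_insert[of a S] q b by auto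
  then show ?thesis using S permutation_permutes by blast
qed

lemma orbit_splice_other:
  assumes "x \<in> S" "b \<notin> orbit q x" shows "orbit splice_cycle x = orbit q x"
proof (rule sym, rule orbit_cong0[of _ "orbit q x"])
  show "x \<in> orbit q x" by (rule q_self)
  show "q \<in> orbit q x \<rightarrow> orbit q x" by (auto intro: orbit.step)
  fix y assume y: "y \<in> orbit q x"
  then have "q y \<noteq> b" using assms by (auto intro: orbit.step)
  then show "q y = splice_cycle y" using splice_cycle_S q_orbit_sub[OF assms(1)] y by auto
qed

lemma orbit_splice_same:
  assumes x: "x \<in> S" and bx: "b \<in> orbit q x" shows "orbit splice_cycle x = insert a (orbit q x)"
proof
  show "orbit splice_cycle x \<subseteq> insert a (orbit q x)"
  proof
    have cl: "splice_cycle y \<in> insert a (orbit q x)" if "y \<in> insert a (orbit q x)" for y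
    proof (cases "y = a")
      case False
      then have "y \<in> orbit q x" "y \<in> S" using that q_orbit_sub[OF x] by auto
      then show ?thesis using splice_cycle_S[of y] orbit.step[of y q x] by auto
    qed (use splice_cycle_a bx in simp)
    fix y assume "y \<in> orbit splice_cycle x"
    then show "y \<in> insert a (orbit q x)"
      by induction (use cl q_self[of x] in blast)+
  qed
  have px: "x \<in> orbit splice_cycle x" by (rule permutation_self_in_orbit[OF splice_cycle_permutation])
  have step: "q y \<in> orbit splice_cycle x" if "y \<in> orbit splice_cycle x" "y \<in> S" for y
  proof (cases "q y = b")
    case True
    then have "a \<in> orbit splice_cycle x" using orbit.step[OF that(1)] splice_cycle_S[OF that(2)] by simp
    then show ?thesis using orbit.step[of a splice_cycle x] splice_cycle_a True by simp
  next
    case False then show ?thesis using orbit.step[OF that(1)] splice_cycle_S[OF that(2)] by simp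
  qed
  have sub: "orbit q x \<subseteq> orbit splice_cycle x"
  proof
    fix y assume "y \<in> orbit q x"
    then show "y \<in> orbit splice_cycle x"
      by induction (use step px x q_orbit_sub[OF x] in blast)+
  qed
  obtain y where "y \<in> orbit q x" "q y = b"
    using bx by cases (use q_self[of x] in auto)
  then have "a \<in> orbit splice_cycle x"
    using orbit.step[of y splice_cycle x] sub splice_cycle_S[of y] q_orbit_sub[OF x] by auto
  then show "insert a (orbit q x) \<subseteq> orbit splice_cycle x" using sub by auto
qed

lemma orbit_splice_cycle_a: "orbit splice_cycle a = insert a (orbit q b)"
proof -
  have "orbit splice_cycle a = orbit splice_cycle (splice_cycle a)" by (rule permutation_orbit_step[OF splice_cycle_permutation, symmetric])
  also have "\<dots> = insert a (orbit q b)" unfolding splice_cycle_a by (rule orbit_splice_same[OF b q_self])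
  finally show ?thesis .
qed

lemma cycle_type_insert:
  "cycle_type splice_cycle (insert a S) = add_mset (Suc (card (orbit q b))) (cycle_type q S - {#card (orbit q b)#})"
proof -
  let ?B = "orbit q b" and ?O = "orbit q ` S"
  have fin: "finite ?O" using S by simp
  have B: "?B \<in> ?O" using b by auto
  have "orbit splice_cycle ` (insert a S) = insert (insert a ?B) (?O - {?B})"
  proof -
    have "orbit splice_cycle x = (if orbit q x = ?B then insert a ?B else orbit q x)" if "x \<in> S" for x
    proof (cases "b \<in> orbit q x")
      case True
      then show ?thesis using orbit_splice_same[OF that True] q_orbit_eq[OF True] by simp
    next
      case False
      then have "orbit q x \<noteq> ?B" using q_self[of b] by blast
      then show ?thesis using orbit_splice_other[OF that False] by simp
    qed
    then have "orbit splice_cycle ` S = (\<lambda>x. if orbit q x = ?B then insert a ?B else orbit q x) ` S"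
      by (rule image_cong[OF refl])
    moreover have "insert C ((\<lambda>x. if g x = B then C else g x) ` S) = insert C (g ` S - {B})"
      for C B :: "'a set" and g by auto
    ultimately show ?thesis by (simp only: image_insert orbit_splice_cycle_a)
  qed
  moreover have "insert a ?B \<notin> ?O - {?B}" using q_orbit_sub a by blast
  moreover have "card (insert a ?B) = Suc (card ?B)"
    using q_orbit_sub[OF b] a S by (subst card_insert_disjoint) (auto intro: finite_subset)
  moreover have "image_mset card (mset_set (?O - {?B})) = cycle_type q S - {#card ?B#}"
    unfolding cycle_type_def using fin B by (simp add: mset_set_Diff image_mset_Diff)
  ultimately show ?thesis unfolding cycle_type_def using fin by simp
qed

end
end
end

text \<open>Every permutation of \<open>insert a S\<close> arises once as a transposition of
  \<open>a\<close> and \<open>b\<close> after a permutation of \<open>S\<close>: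
  \<open>b = a\<close> makes \<open>a\<close> a fixed point, \<open>b\<close> in \<open>S\<close>
  splices it into a cycle. This is the recursion satisfied by \<open>cycle_type_exp\<close>.\<close>

theorem sum_cycle_type:
  assumes "finite S"
  shows "(\<Sum>p | p permutes S. F (cycle_type p S)) = fact (card S) * cycle_type_exp (card S) F"
  using assms
proof (induction S arbitrary: F rule: finite_induct)
  case empty
  then show ?case by (simp add: cycle_type_exp_def cycle_type_def)
next
  case (insert a S)
  let ?R = "\<lambda>M. F (add_mset 1 M) + (\<Sum>c\<in>#M. real c * F (add_mset (Suc c) (M - {#c#})))"
  have "(\<Sum>p | p permutes insert a S. F (cycle_type p (insert a S))) =
    (\<Sum>b\<in>insert a S. \<Sum>q | q permutes S. F (cycle_type (Transposition.transpose a b \<circ> q) (insert a S)))"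
    using insert.hyps by (rule sum_over_permutations_insert)
  also have "\<dots> = (\<Sum>q | q permutes S. \<Sum>b\<in>insert a S. F (cycle_type (Transposition.transpose a b \<circ> q) (insert a S)))"
    by (rule sum.swap)
  also have "\<dots> = (\<Sum>q | q permutes S. ?R (cycle_type q S))"
  proof (rule sum.cong)
    fix q assume "q \<in> {q. q permutes S}"
    then have q: "q permutes S" by simp
    have "(\<Sum>b\<in>S. F (cycle_type (Transposition.transpose a b \<circ> q) (insert a S))) =
      (\<Sum>b\<in>S. (\<lambda>c. F (add_mset (Suc c) (cycle_type q S - {#c#}))) (card (orbit q b)))"
      using cycle_type_insert[OF q insert.hyps] by (intro sum.cong) auto
    also have "\<dots> = (\<Sum>c\<in>#cycle_type q S. real c * F (add_mset (Suc c) (cycle_type q S - {#c#})))"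
      by (rule sum_over_cycles[OF q insert.hyps(1)])
    finally show "(\<Sum>b\<in>insert a S. F (cycle_type (Transposition.transpose a b \<circ> q) (insert a S))) = ?R (cycle_type q S)"
      using insert.hyps cycle_type_insert_fixpoint[OF q insert.hyps] by simp
  qed simp
  also have "\<dots> = fact (card S) * cycle_type_exp (card S) ?R" by (rule insert.IH)
  also have "\<dots> = fact (card (insert a S)) * cycle_type_exp (card (insert a S)) F"
    using insert.hyps unfolding cycle_type_exp_chinese_restaurant[symmetric] by simp
  finally show ?case .
qed

section \<open>The number of cyclic nodes\<close>

definition cyclic_nodes :: "nat \<Rightarrow> (nat \<Rightarrow> nat) \<Rightarrow> nat set" where
  "cyclic_nodes n f = {x \<in> {1..n}. x \<in> orbit f x}"

lemma finite_cyclic_nodes [simp]: "finite (cyclic_nodes n f)"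
  by (simp add: cyclic_nodes_def)

lemma cyclic_nodes_subset: "cyclic_nodes n f \<subseteq> {1..n}"
  by (auto simp: cyclic_nodes_def)

lemma finite_zero_k_mappings [simp]: "finite (zero_k_mappings k n)"
  unfolding zero_k_mappings_def by (rule finite_subset[of _ "{1..n} \<rightarrow>\<^sub>E {1..n}"]) (auto intro: finite_PiE)

lemma zero_k_mappings_funcset: "f \<in> zero_k_mappings k n \<Longrightarrow> f \<in> {1..n} \<rightarrow>\<^sub>E {1..n}"
  by (simp add: zero_k_mappings_def)

lemma zero_k_mappings_Pi: "f \<in> zero_k_mappings k n \<Longrightarrow> f \<in> {1..n} \<rightarrow> {1..n}"
  by (simp add: zero_k_mappings_def PiE_def)

lemma orbit_in_funcset:
  assumes "f \<in> N \<rightarrow> N" "x \<in> N" "y \<in> orbit f x" shows "y \<in> N"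
  using assms(3) by induction (use assms in auto)

text \<open>On a finite set surjectivity suffices. The last step of the orbit by which
  \<open>x\<close> returns to itself provides a preimage of \<open>x\<close> on the same
  cycle.\<close>

lemma bij_betw_cyclic_nodes:
  assumes f: "f \<in> {1..n} \<rightarrow> {1..n}"
  shows "bij_betw f (cyclic_nodes n f) (cyclic_nodes n f)"
proof -
  let ?C = "cyclic_nodes n f"
  have "?C \<subseteq> f ` ?C"
  proof
    fix x assume x: "x \<in> ?C"
    then have xx: "x \<in> orbit f x" "x \<in> {1..n}" by (auto simp: cyclic_nodes_def)
    have *: "y \<in> ?C" if "y \<in> orbit f x" for y
      using self_in_orbit_trans[OF xx(1) that] orbit_in_funcset[OF f xx(2) that]
      by (auto simp: cyclic_nodes_def)
    from xx(1) show "x \<in> f ` ?C"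
      by cases (use * x in auto)
  qed
  moreover have "f ` ?C \<subseteq> ?C"
  proof
    fix y assume "y \<in> f ` ?C"
    then obtain x where x: "x \<in> orbit f x" "x \<in> {1..n}" "y = f x" by (auto simp: cyclic_nodes_def)
    then show "y \<in> ?C"
      using self_in_orbit_trans[OF x(1) orbit.base] f unfolding cyclic_nodes_def by blast
  qed
  ultimately have "f ` ?C = ?C" by blast
  then show ?thesis unfolding bij_betw_def by (simp add: eq_card_imp_inj_on)
qed

lemma restrict_id_permutes:
  assumes "bij_betw f C C" shows "restrict_id f C permutes C"
proof (rule bij_imp_permutes)
  have "bij_betw (restrict_id f C) C C \<longleftrightarrow> bij_betw f C C"
    by (rule bij_betw_cong) (simp add: restrict_id_def)
  then show "bij_betw (restrict_id f C) C C" using assms by simp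
qed (simp add: restrict_id_def)

lemma cyclic_nodes_permutes:
  "f \<in> zero_k_mappings k n \<Longrightarrow> restrict_id f (cyclic_nodes n f) permutes cyclic_nodes n f"
  by (intro restrict_id_permutes bij_betw_cyclic_nodes zero_k_mappings_Pi)

lemma card_fibre_bij:
  assumes "bij_betw h C C" shows "card {x \<in> C. h x = y} = of_bool (y \<in> C)"
proof (cases "y \<in> C")
  case True
  then obtain x where "x \<in> C" "h x = y" using assms unfolding bij_betw_def by (metis imageE)
  then have "{x \<in> C. h x = y} = {x}" using assms by (auto simp: bij_betw_def inj_on_def)
  then show ?thesis using True by simp
next
  case False
  then have "{x \<in> C. h x = y} = {}" using assms by (auto simp: bij_betw_def)
  then show ?thesis using False by (simp only: card.empty of_bool_eq)
qed

text \<open>Under \<open>f\<close> and under \<open>p\<close> each node of \<open>C\<close> has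
  exactly one preimage in \<open>C\<close>, and outside \<open>C\<close> nothing changes, so all
  in-degrees are kept. No further node becomes cyclic: an orbit that enters \<open>C\<close> stays
  there and cannot return to a node outside, and an orbit that avoids \<open>C\<close> is an orbit
  of \<open>f\<close>.\<close>

lemma replace_permutation:
  assumes f: "f \<in> zero_k_mappings k n" and C: "cyclic_nodes n f = C" and p: "p permutes C"
  defines "g \<equiv> \<lambda>x. if x \<in> C then p x else f x"
  shows "g \<in> zero_k_mappings k n" "cyclic_nodes n g = C" "restrict_id g C = p"
proof -
  let ?N = "{1..n}"
  have CN: "C \<subseteq> ?N" using C cyclic_nodes_subset by blast
  have fN: "f \<in> ?N \<rightarrow>\<^sub>E ?N" by (rule zero_k_mappings_funcset[OF f])
  have pC: "p x \<in> C \<longleftrightarrow> x \<in> C" for x by (rule permutes_in_image[OF p])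
  have gN: "g \<in> ?N \<rightarrow>\<^sub>E ?N"
  proof (rule PiE_I)
    fix x assume "x \<in> ?N"
    then have "f x \<in> ?N" by (rule PiE_mem[OF fN])
    moreover have "x \<in> C \<Longrightarrow> p x \<in> ?N" using pC CN by blast
    ultimately show "g x \<in> ?N" unfolding g_def by simp
  next
    fix x assume "x \<notin> ?N"
    then show "g x = undefined" using PiE_arb[OF fN] CN unfolding g_def by auto
  qed
  have bij: "bij_betw f C C" using bij_betw_cyclic_nodes[OF zero_k_mappings_Pi[OF f]] C by simp
  have card_split: "card {x \<in> ?N. h x = y} = card {x \<in> C. h x = y} + card {x \<in> ?N - C. h x = y}" for h :: "nat \<Rightarrow> nat" and y
  proof -
    have "{x \<in> ?N. h x = y} = {x \<in> C. h x = y} \<union> {x \<in> ?N - C. h x = y}" using CN by auto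
    then show ?thesis using CN by (simp only:) (subst card_Un_disjoint, auto intro: finite_subset)
  qed
  have "card {x \<in> ?N. g x = y} = card {x \<in> ?N. f x = y}" for y
  proof -
    have "{x \<in> C. g x = y} = {x \<in> C. p x = y}" "{x \<in> ?N - C. g x = y} = {x \<in> ?N - C. f x = y}"
      by (auto simp: g_def)
    then show ?thesis unfolding card_split[of g] card_split[of f]
      by (simp add: card_fibre_bij[OF bij] card_fibre_bij[OF permutes_imp_bij[OF p]])
  qed
  then show "g \<in> zero_k_mappings k n" using f gN by (simp only: zero_k_mappings_def mem_Collect_eq) simp
  show "restrict_id g C = p"
    using permutes_not_in[OF p] by (auto simp: fun_eq_iff restrict_id_def g_def)
  have gC: "y \<in> orbit g x \<Longrightarrow> x \<in> C \<Longrightarrow> y \<in> C" for x y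
    by (rule orbit_in_funcset[of g C x]) (auto simp: g_def pC)
  show "cyclic_nodes n g = C"
  proof
    show "C \<subseteq> cyclic_nodes n g"
    proof
      fix x assume x: "x \<in> C"
      have "finite C" using CN finite_subset by blast
      then have "x \<in> orbit p x" using p permutation_permutes by (intro permutation_self_in_orbit) blast
      also have "orbit p x = orbit g x"
        by (rule orbit_cong0[of x C]) (use x pC in \<open>auto simp: g_def\<close>)
      finally show "x \<in> cyclic_nodes n g" using x CN by (auto simp: cyclic_nodes_def)
    qed
    show "cyclic_nodes n g \<subseteq> C"
    proof
      fix x assume "x \<in> cyclic_nodes n g"
      then have x: "x \<in> ?N" "x \<in> orbit g x" by (auto simp: cyclic_nodes_def)
      show "x \<in> C"
      proof (rule ccontr)
        assume xC: "x \<notin> C"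
        have "y \<notin> C" if "y \<in> orbit g x" for y
          using gC[OF orbit_swap[OF x(2) that]] xC by blast
        then have "orbit g x = orbit f x"
          by (intro orbit_cong0[of x "orbit g x"]) (use x(2) in \<open>auto intro: orbit.step simp: g_def\<close>)
        then have "x \<in> C" using x C by (auto simp: cyclic_nodes_def)
        with xC show False by simp
      qed
    qed
  qed
qed

text \<open>Replacing the permutation on the cyclic nodes by another one preserves all in-degrees, so every
  permutation of \<open>C\<close> is induced by the same number \<open>w\<close> of mappings.\<close>

lemma sum_given_cyclic_nodes:
  "\<exists>w::real. \<forall>\<phi>. (\<Sum>f | f \<in> zero_k_mappings k n \<and> cyclic_nodes n f = C. \<phi> (restrict_id f C)) = w * (\<Sum>p | p permutes C. \<phi> p)"
proof (cases "C \<subseteq> {1..n}")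
  case False
  then have "{f. f \<in> zero_k_mappings k n \<and> cyclic_nodes n f = C} = {}" using cyclic_nodes_subset by blast
  then show ?thesis by (intro exI[of _ 0]) (simp only: sum.empty, simp)
next
  case True
  then have finC: "finite C" using finite_subset by blast
  let ?S = "{f. f \<in> zero_k_mappings k n \<and> cyclic_nodes n f = C}"
  define Fib where "Fib p = {f \<in> ?S. restrict_id f C = p}" for p
  let ?r = "\<lambda>p f x. if x \<in> C then p x else f x"
  have bij: "bij_betw (?r p') (Fib p) (Fib p')" if "p permutes C" "p' permutes C" for p p'
  proof (rule bij_betw_byWitness[where f' = "?r p"])
    have *: "f x = p x" if "restrict_id f C = p" "x \<in> C" for f p and x :: nat
      unfolding that(1)[symmetric] using that(2) by (simp add: restrict_id_def)
    have inv: "?r p1 (?r p2 f) = f" if "f \<in> Fib p1" for f p1 p2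
    proof -
      have "restrict_id f C = p1" using that by (simp add: Fib_def)
      from *[OF this] show ?thesis by auto
    qed
    show "\<forall>f\<in>Fib p. ?r p (?r p' f) = f" "\<forall>f\<in>Fib p'. ?r p' (?r p f) = f"
      by (rule ballI, erule inv)+
    have "?r p2 f \<in> Fib p2" if "p2 permutes C" "f \<in> Fib p1" for f p1 p2
      using replace_permutation[of f k n C p2] that unfolding Fib_def by simp
    then show "?r p' ` Fib p \<subseteq> Fib p'" "?r p ` Fib p' \<subseteq> Fib p"
      using that by (meson image_subsetI)+
  qed
  have perm: "restrict_id f C permutes C" if "f \<in> ?S" for f
    using cyclic_nodes_permutes[of f k n] that by auto
  show ?thesis
  proof (intro exI allI)
    fix \<phi> :: "(nat \<Rightarrow> nat) \<Rightarrow> real"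
    have "(\<Sum>f\<in>?S. \<phi> (restrict_id f C)) = (\<Sum>p | p permutes C. \<Sum>f\<in>Fib p. \<phi> (restrict_id f C))"
      unfolding Fib_def using perm
      by (intro sum.group[symmetric]) (auto simp: finite_permutations[OF finC])
    also have "\<dots> = (\<Sum>p | p permutes C. real (card (Fib id)) * \<phi> p)"
    proof (rule sum.cong)
      fix p assume "p \<in> {p. p permutes C}"
      then have "card (Fib p) = card (Fib id)" using bij_betw_same_card[OF bij] permutes_id by blast
      moreover have "(\<Sum>f\<in>Fib p. \<phi> (restrict_id f C)) = (\<Sum>f\<in>Fib p. \<phi> p)"
        by (rule sum.cong) (auto simp: Fib_def)
      ultimately show "(\<Sum>f\<in>Fib p. \<phi> (restrict_id f C)) = real (card (Fib id)) * \<phi> p" by simp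
    qed simp
    finally show "(\<Sum>f\<in>?S. \<phi> (restrict_id f C)) = real (card (Fib id)) * (\<Sum>p | p permutes C. \<phi> p)"
      by (simp only: sum_distrib_left)
  qed
qed

lemma sum_by_cyclic_nodes:
  "(\<Sum>f\<in>zero_k_mappings k n. h f) = (\<Sum>C\<in>Pow {1..n}. \<Sum>f | f \<in> zero_k_mappings k n \<and> cyclic_nodes n f = C. h f)"
  using sum.group[of "zero_k_mappings k n" "Pow {1..n}" "cyclic_nodes n" h, symmetric] cyclic_nodes_subset
  by auto

lemma cycle_type_restrict_id:
  assumes "bij_betw f C C" shows "cycle_type (restrict_id f C) C = cycle_type f C"
proof -
  have "orbit (restrict_id f C) x = orbit f x" if "x \<in> C" for x
    by (rule orbit_cong0[of x C]) (use assms that in \<open>auto simp: restrict_id_def bij_betw_def\<close>)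
  then have "orbit (restrict_id f C) ` C = orbit f ` C" by (rule image_cong[OF refl])
  then show ?thesis by (simp add: cycle_type_def)
qed

text \<open>For a fixed set \<open>C\<close> of cyclic nodes the weight \<open>w\<close> of
  \<open>sum_given_cyclic_nodes\<close> cancels: a constant test function identifies
  \<open>w * fact (card C)\<close> as the number of mappings with this set, and
  \<open>sum_cycle_type\<close> evaluates the sum over the permutations of \<open>C\<close>. Only
  the size of \<open>C\<close> remains.\<close>

theorem sum_mappings_cycle_type:
  "(\<Sum>f\<in>zero_k_mappings k n. F (cycle_type f (cyclic_nodes n f))) =
   (\<Sum>f\<in>zero_k_mappings k n. cycle_type_exp (card (cyclic_nodes n f)) F)"
proof -
  have "(\<Sum>f | f \<in> zero_k_mappings k n \<and> cyclic_nodes n f = C. F (cycle_type f (cyclic_nodes n f))) =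
     (\<Sum>f | f \<in> zero_k_mappings k n \<and> cyclic_nodes n f = C. cycle_type_exp (card (cyclic_nodes n f)) F)"
    if "C \<in> Pow {1..n}" for C
  proof -
    let ?S = "{f. f \<in> zero_k_mappings k n \<and> cyclic_nodes n f = C}"
    have finC: "finite C" using that finite_subset by auto
    obtain w :: real where w: "(\<Sum>f\<in>?S. \<phi> (restrict_id f C)) = w * (\<Sum>p | p permutes C. \<phi> p)" for \<phi>
      using sum_given_cyclic_nodes by blast
    have "(\<Sum>f\<in>?S. F (cycle_type f (cyclic_nodes n f))) = (\<Sum>f\<in>?S. F (cycle_type (restrict_id f C) C))"
      by (intro sum.cong refl arg_cong[of _ _ F])
         (auto intro!: cycle_type_restrict_id[symmetric] bij_betw_cyclic_nodes simp del: One_nat_def dest: zero_k_mappings_Pi)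
    also have "\<dots> = w * (fact (card C) * cycle_type_exp (card C) F)"
      by (simp only: w[of "\<lambda>p. F (cycle_type p C)"] sum_cycle_type[OF finC])
    also have "w * fact (card C) = real (card ?S)"
      using w[of "\<lambda>_. 1"] by (simp add: card_permutations[OF refl finC])
    then have "w * (fact (card C) * cycle_type_exp (card C) F) = (\<Sum>f\<in>?S. cycle_type_exp (card (cyclic_nodes n f)) F)"
      by (simp flip: mult.assoc)
    finally show ?thesis .
  qed
  then show ?thesis unfolding sum_by_cyclic_nodes by (rule sum.cong[OF refl])
qed

lemma T_eq_Lcm_cycle_type: "T n f = Lcm (set_mset (cycle_type f (cyclic_nodes n f)))"
proof -
  have "cycles_of n f = orbit f ` cyclic_nodes n f" by (auto simp: cycles_of_def cyclic_nodes_def)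
  then show ?thesis by (simp add: T_def cycle_type_def)
qed

section \<open>Symmetry, and the number of mappings with prescribed values\<close>

lemma zero_k_mappings_conj:
  assumes f: "f \<in> zero_k_mappings k n" and \<sigma>: "\<sigma> permutes {1..n}" and \<tau>: "\<tau> permutes {1..n}"
  shows "restrict (\<sigma> \<circ> f \<circ> \<tau>) {1..n} \<in> zero_k_mappings k n"
proof -
  let ?N = "{1..n}" and ?g = "restrict (\<sigma> \<circ> f \<circ> \<tau>) {1..n}"
  have fN: "f \<in> ?N \<rightarrow>\<^sub>E ?N" by (rule zero_k_mappings_funcset[OF f])
  have "?g \<in> ?N \<rightarrow>\<^sub>E ?N"
    using fN permutes_in_image[OF \<sigma>] permutes_in_image[OF \<tau>] by auto
  moreover have "card {x \<in> ?N. ?g x = y} \<in> {0, k}" if "y \<in> ?N" for y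
  proof -
    have "bij_betw \<tau> {x \<in> ?N. ?g x = y} {x \<in> ?N. f x = inv \<sigma> y}"
    proof (rule bij_betw_byWitness[where f' = "inv \<tau>"])
      show "\<forall>x\<in>{x \<in> ?N. ?g x = y}. inv \<tau> (\<tau> x) = x" "\<forall>x\<in>{x \<in> ?N. f x = inv \<sigma> y}. \<tau> (inv \<tau> x) = x"
        using permutes_inverses[OF \<tau>] by auto
      show "\<tau> ` {x \<in> ?N. ?g x = y} \<subseteq> {x \<in> ?N. f x = inv \<sigma> y}"
      proof (rule image_subsetI)
        fix x assume x: "x \<in> {x \<in> ?N. ?g x = y}"
        then have "y = \<sigma> (f (\<tau> x))" by auto
        then show "\<tau> x \<in> {x \<in> ?N. f x = inv \<sigma> y}"
          using permutes_inverses(2)[OF \<sigma>] permutes_in_image[OF \<tau>, of x] x by simp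
      qed
      show "inv \<tau> ` {x \<in> ?N. f x = inv \<sigma> y} \<subseteq> {x \<in> ?N. ?g x = y}"
        using permutes_in_image[OF permutes_inv[OF \<tau>]] permutes_inverses[OF \<sigma>] permutes_inverses[OF \<tau>] by auto
    qed
    then have "card {x \<in> ?N. ?g x = y} = card {x \<in> ?N. f x = inv \<sigma> y}" by (rule bij_betw_same_card)
    moreover have "inv \<sigma> y \<in> ?N" using that permutes_in_image[OF permutes_inv[OF \<sigma>]] by auto
    ultimately show ?thesis using f unfolding zero_k_mappings_def by auto
  qed
  ultimately show ?thesis unfolding zero_k_mappings_def by auto
qed

definition extensions :: "nat \<Rightarrow> nat \<Rightarrow> nat set \<Rightarrow> (nat \<Rightarrow> nat) \<Rightarrow> (nat \<Rightarrow> nat) set" where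
  "extensions k n A g = {f \<in> zero_k_mappings k n. \<forall>a\<in>A. f a = g a}"

lemma finite_extensions [simp]: "finite (extensions k n A g)"
  by (simp add: extensions_def)

text \<open>Arguments and values can be relabelled independently of each other, a larger symmetry
  than conjugation. Exchanging \<open>a\<close> with \<open>a'\<close> among the arguments and
  \<open>b\<close> with \<open>b'\<close> among the values leaves the constraints on
  \<open>A\<close> alone. Used in both directions, the inequality becomes an equality.\<close>

lemma extensions_swap:
  assumes A: "A \<subseteq> {1..n}" "g ` A \<subseteq> {1..n}"
    and a: "a \<in> {1..n} - A" "a' \<in> {1..n} - A" and b: "b \<in> {1..n} - g ` A" "b' \<in> {1..n} - g ` A"
  shows "card (extensions k n (insert a A) (g(a := b))) \<le> card (extensions k n (insert a' A) (g(a' := b')))"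
proof -
  let ?\<tau> = "Transposition.transpose a a'" and ?\<sigma> = "Transposition.transpose b b'" and ?N = "{1..n}"
  let ?c = "\<lambda>f. restrict (?\<sigma> \<circ> f \<circ> ?\<tau>) ?N"
  have p: "?\<tau> permutes ?N" "?\<sigma> permutes ?N" using a b by (auto intro: permutes_swap_id)
  show ?thesis
  proof (rule card_inj_on_le[of ?c])
    show "inj_on ?c (extensions k n (insert a A) (g(a := b)))"
    proof (rule inj_on_inverseI[where g = ?c])
      fix f assume "f \<in> extensions k n (insert a A) (g(a := b))"
      then have "f \<in> ?N \<rightarrow>\<^sub>E ?N" unfolding extensions_def using zero_k_mappings_funcset by auto
      then show "?c (?c f) = f"
        using permutes_in_image[OF p(1)] by (auto simp: fun_eq_iff restrict_def PiE_def extensional_def)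
    qed
    show "?c ` extensions k n (insert a A) (g(a := b)) \<subseteq> extensions k n (insert a' A) (g(a' := b'))"
    proof
      fix h assume "h \<in> ?c ` extensions k n (insert a A) (g(a := b))"
      then obtain f where f: "f \<in> zero_k_mappings k n" "f a = b" "\<And>x. x \<in> A \<Longrightarrow> f x = g x" "h = ?c f"
        using a by (auto simp: extensions_def split: if_splits)
      have "h a' = b'" using a f by simp
      moreover have "h x = g x" if "x \<in> A" for x
      proof -
        have "x \<noteq> a" "x \<noteq> a'" "g x \<noteq> b" "g x \<noteq> b'" "x \<in> ?N" using that a b A by auto
        then show ?thesis using that f by simp
      qed
      ultimately show "h \<in> extensions k n (insert a' A) (g(a' := b'))"
        using zero_k_mappings_conj[OF f(1) p(2) p(1)] a unfolding extensions_def f(4) by auto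
    qed
  qed simp
qed

lemma extensions_free_points:
  assumes A: "A \<subseteq> {1..n}" "inj_on g A" "g ` A \<subseteq> {1..n}" and f: "f \<in> extensions k n A g"
  shows "real (card {a \<in> {1..n} - A. f a \<notin> g ` A}) = real n - real k * real (card A)"
proof -
  let ?N = "{1..n}"
  have fin: "finite A" using A finite_subset by blast
  have fib: "card {x \<in> ?N. f x = y} = k" if y: "y \<in> g ` A" for y
  proof -
    obtain x where x: "x \<in> A" "y = g x" using y by auto
    then have "x \<in> {x \<in> ?N. f x = y}" using f A by (auto simp: extensions_def)
    then have "card {x \<in> ?N. f x = y} \<noteq> 0" by (subst card_0_eq) auto
    moreover have "y \<in> ?N" using y A by auto
    moreover have "\<forall>y\<in>?N. card {x \<in> ?N. f x = y} \<in> {0, k}"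
      using f unfolding extensions_def zero_k_mappings_def mem_Collect_eq by blast
    ultimately have "card {x \<in> ?N. f x = y} \<noteq> 0" "card {x \<in> ?N. f x = y} \<in> {0, k}" by - (assumption, erule bspec)
    then show ?thesis by (metis insertE singletonD)
  qed
  have "card {x \<in> ?N. f x \<in> g ` A} = card (\<Union>y\<in>g ` A. {x \<in> ?N. f x = y})"
    by (rule arg_cong[of _ _ card]) auto
  also have "\<dots> = (\<Sum>y\<in>g ` A. card {x \<in> ?N. f x = y})"
    by (rule card_UN_disjoint) (use fin in auto)
  also have "\<dots> = k * card A" using fib A(2) by (simp add: card_image)
  finally have 1: "card {x \<in> ?N. f x \<in> g ` A} = k * card A" .
  have "{a \<in> ?N - A. f a \<notin> g ` A} = ?N - {x \<in> ?N. f x \<in> g ` A}"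
    using f by (auto simp: extensions_def)
  then have "card {a \<in> ?N - A. f a \<notin> g ` A} = n - k * card A"
  proof -
    have "finite {x \<in> ?N. f x \<in> g ` A}" "{x \<in> ?N. f x \<in> g ` A} \<subseteq> ?N" by auto
    then have "card (?N - {x \<in> ?N. f x \<in> g ` A}) = card ?N - k * card A"
      unfolding 1[symmetric] by (rule card_Diff_subset)
    with \<open>{a \<in> ?N - A. f a \<notin> g ` A} = _\<close> show ?thesis by (simp only: card_atLeastAtMost diff_Suc_1)
  qed
  moreover have "k * card A \<le> card ?N" unfolding 1[symmetric] by (rule card_mono) auto
  then have "k * card A \<le> n" by simp
  ultimately show ?thesis by (simp add: of_nat_diff)
qed

text \<open>Counting pairs \<open>(f, (x, y))\<close> with \<open>f x = y\<close>, where \<open>x\<close> and \<open>y\<close> are not used by \<open>g\<close>: by symmetry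
  all \<open>(n - card A)\<^sup>2\<close> choices of \<open>(x, y)\<close> contribute equally, and each \<open>f\<close> contributes
  \<open>n - k * card A\<close>.\<close>

lemma extensions_step:
  assumes A: "A \<subseteq> {1..n}" "inj_on g A" "g ` A \<subseteq> {1..n}"
    and a: "a \<in> {1..n} - A" and b: "b \<in> {1..n} - g ` A"
  shows "(real n - real (card A))\<^sup>2 * real (card (extensions k n (insert a A) (g(a := b)))) =
         (real n - real k * real (card A)) * real (card (extensions k n A g))"
proof -
  let ?N = "{1..n}"
  have fin: "finite A" using A finite_subset by blast
  have le: "card A \<le> n" using card_mono[OF _ A(1)] by simp
  have cards: "real (card (?N - A)) = real n - real (card A)" "real (card (?N - g ` A)) = real n - real (card A)"
    using A fin le by (simp_all add: card_Diff_subset card_image of_nat_diff)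
  let ?X = "\<lambda>x y. extensions k n (insert x A) (g(x := y))"
  have "(real n - real (card A))\<^sup>2 * real (card (?X a b)) = (\<Sum>x\<in>?N - A. \<Sum>y\<in>?N - g ` A. real (card (?X a b)))"
    using cards by (simp add: power2_eq_square)
  also have "\<dots> = (\<Sum>x\<in>?N - A. \<Sum>y\<in>?N - g ` A. real (card (?X x y)))"
    using extensions_swap[OF A(1,3)] a b by (intro sum.cong refl arg_cong[of _ _ real] antisym) auto
  also have "\<dots> = (\<Sum>x\<in>?N - A. \<Sum>y\<in>?N - g ` A. \<Sum>f\<in>extensions k n A g. of_bool (f x = y))"
  proof (intro sum.cong refl)
    fix x y assume xy: "x \<in> ?N - A" "y \<in> ?N - g ` A"
    have "?X x y = {f \<in> extensions k n A g. f x = y}" using xy by (auto simp: extensions_def)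
    then show "real (card (?X x y)) = (\<Sum>f\<in>extensions k n A g. of_bool (f x = y))"
      by (subst sum_of_bool_eq) (simp_all add: Int_def)
  qed
  also have "\<dots> = (\<Sum>x\<in>?N - A. \<Sum>f\<in>extensions k n A g. \<Sum>y\<in>?N - g ` A. of_bool (f x = y))"
    by (intro sum.cong refl sum.swap)
  also have "\<dots> = (\<Sum>f\<in>extensions k n A g. \<Sum>x\<in>?N - A. \<Sum>y\<in>?N - g ` A. of_bool (f x = y))"
    by (rule sum.swap)
  also have "\<dots> = (\<Sum>f\<in>extensions k n A g. real n - real k * real (card A))"
  proof (rule sum.cong)
    fix f assume f: "f \<in> extensions k n A g"
    then have fN: "f x \<in> ?N" if "x \<in> ?N" for x
      using that zero_k_mappings_funcset[of f k n] by (auto simp: extensions_def)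
    have "(\<Sum>x\<in>?N - A. \<Sum>y\<in>?N - g ` A. of_bool (f x = y) :: real) = (\<Sum>x\<in>?N - A. of_bool (f x \<notin> g ` A))"
    proof (intro sum.cong refl)
      fix x assume "x \<in> ?N - A"
      then have "(?N - g ` A) \<inter> {y. f x = y} = (if f x \<notin> g ` A then {f x} else {})" using fN by auto
      then show "(\<Sum>y\<in>?N - g ` A. of_bool (f x = y) :: real) = of_bool (f x \<notin> g ` A)"
        by (subst sum_of_bool_eq) auto
    qed
    also have "\<dots> = real (card {a \<in> ?N - A. f a \<notin> g ` A})"
      by (subst sum_of_bool_eq) (simp_all add: Int_def)
    also have "\<dots> = real n - real k * real (card A)" by (rule extensions_free_points[OF A f])
    finally show "(\<Sum>x\<in>?N - A. \<Sum>y\<in>?N - g ` A. of_bool (f x = y) :: real) = real n - real k * real (card A)" .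
  qed simp
  finally show ?thesis by simp
qed

lemma card_extensions:
  assumes "finite A" "A \<subseteq> {1..n}" "inj_on g A" "g ` A \<subseteq> {1..n}"
  shows "real (card (extensions k n A g)) =
     real (card (zero_k_mappings k n)) * (\<Prod>i<card A. (real n - real k * real i) / (real n - real i)\<^sup>2)"
  using assms
proof (induction A rule: finite_induct)
  case empty
  then show ?case by (simp add: extensions_def)
next
  case (insert a A)
  have 1: "A \<subseteq> {1..n}" "inj_on g A" "g ` A \<subseteq> {1..n}" "a \<in> {1..n} - A" "g a \<in> {1..n} - g ` A"
    using insert.prems insert.hyps by (auto simp: inj_on_def)
  have "card (insert a A) \<le> n" using card_mono[OF _ insert.prems(1)] by simp
  then have "real n - real (card A) \<noteq> 0" using insert.hyps by simp
  then show ?case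
    using extensions_step[OF 1, of k] insert.IH[OF 1(1-3)] insert.hyps by (simp add: field_simps)
qed

text \<open>Both sides are \<open>m!\<close> times the number of pairs of a mapping and a set of \<open>m\<close> of its fixed points:
  a uniform permutation of at least \<open>m\<close> points has on average \<open>1 / m!\<close> such sets.\<close>

theorem card_cyclic_nodes_ge:
  assumes "m \<le> n"
  shows "real (card {f \<in> zero_k_mappings k n. m \<le> card (cyclic_nodes n f)}) =
    real (card (zero_k_mappings k n)) * (\<Prod>i<m. (real n - real k * real i) / (real n - real i))"
proof -
  let ?M = "zero_k_mappings k n" and ?N = "{1..n}"
  let ?\<A> = "\<lambda>C f. {A. A \<subseteq> C \<and> card A = m \<and> (\<forall>a\<in>A. f a = a)}"
  \<comment> \<open>Fixed points are cyclic, so the sets to be counted are determined by the induced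
    permutation alone; this is what allows \<open>sum_given_cyclic_nodes\<close> to be applied
    below.\<close>
  have fixed: "?\<A> ?N f = ?\<A> (cyclic_nodes n f) (restrict_id f (cyclic_nodes n f))" for f :: "nat \<Rightarrow> nat"
  proof -
    have "A \<subseteq> cyclic_nodes n f" if "A \<subseteq> ?N" "\<forall>a\<in>A. f a = a" for A
    proof
      fix x assume "x \<in> A"
      then have "orbit f x = {x}" "x \<in> ?N" using that by (auto simp: orbit_eq_singleton_iff)
      then show "x \<in> cyclic_nodes n f" by (simp add: cyclic_nodes_def)
    qed
    moreover have "f a = restrict_id f (cyclic_nodes n f) a" if "a \<in> cyclic_nodes n f" for a
      using that by (simp add: restrict_id_def)
    ultimately show ?thesis using cyclic_nodes_subset[of n f]
      by (intro Collect_cong) (metis subset_eq)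
  qed
  have "(\<Sum>f\<in>?M. real (card (?\<A> ?N f))) = (\<Sum>f\<in>?M. \<Sum>A | A \<subseteq> ?N \<and> card A = m. of_bool (\<forall>a\<in>A. f a = a))"
    by (intro sum.cong refl, subst sum_of_bool_eq) (auto intro!: arg_cong[of _ _ card])
  also have "\<dots> = (\<Sum>A | A \<subseteq> ?N \<and> card A = m. \<Sum>f\<in>?M. of_bool (\<forall>a\<in>A. f a = a))"
    by (rule sum.swap)
  also have "\<dots> = (\<Sum>A | A \<subseteq> ?N \<and> card A = m. real (card ?M) * (\<Prod>i<m. (real n - real k * real i) / (real n - real i)\<^sup>2))"
  proof (rule sum.cong)
    fix A assume A: "A \<in> {A. A \<subseteq> ?N \<and> card A = m}"
    have "(\<Sum>f\<in>?M. of_bool (\<forall>a\<in>A. f a = a) :: real) = real (card (extensions k n A id))"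
      by (subst sum_of_bool_eq) (auto simp: extensions_def Int_def)
    also have "\<dots> = real (card ?M) * (\<Prod>i<card A. (real n - real k * real i) / (real n - real i)\<^sup>2)"
      using A by (intro card_extensions) (auto intro: finite_subset)
    finally show "(\<Sum>f\<in>?M. of_bool (\<forall>a\<in>A. f a = a) :: real) =
      real (card ?M) * (\<Prod>i<m. (real n - real k * real i) / (real n - real i)\<^sup>2)" using A by simp
  qed simp
  also have "\<dots> = real (n choose m) * (real (card ?M) * (\<Prod>i<m. (real n - real k * real i) / (real n - real i)\<^sup>2))"
    using n_subsets[of ?N m] by simp
  finally have L: "fact m * (\<Sum>f\<in>?M. real (card (?\<A> ?N f))) = 
    (fact m * real (n choose m)) * (real (card ?M) * (\<Prod>i<m. (real n - real k * real i) / (real n - real i)\<^sup>2))"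
    by simp
  have ff: "fact m * real (n choose m) = (\<Prod>i<m. real n - real i)"
    by (simp add: binomial_gbinomial gbinomial_prod_rev atLeast0LessThan)
  have "(\<Prod>i<m. real n - real i) * (\<Prod>i<m. (real n - real k * real i) / (real n - real i)\<^sup>2) =
    (\<Prod>i<m. (real n - real k * real i) / (real n - real i))"
    unfolding prod.distrib[symmetric] using assms
    by (intro prod.cong) (auto simp: power2_eq_square)
  then have L': "fact m * (\<Sum>f\<in>?M. real (card (?\<A> ?N f))) = 
    real (card ?M) * (\<Prod>i<m. (real n - real k * real i) / (real n - real i))"
    unfolding L ff by (simp add: mult_ac)
  have R: "(\<Sum>f\<in>?M. fact m * real (card (?\<A> ?N f))) = (\<Sum>f\<in>?M. of_bool (m \<le> card (cyclic_nodes n f)))"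
    unfolding sum_by_cyclic_nodes
  proof (rule sum.cong)
    fix C assume "C \<in> Pow ?N"
    then have finC: "finite C" using finite_subset by auto
    let ?S = "{f. f \<in> ?M \<and> cyclic_nodes n f = C}"
    obtain w :: real where w: "(\<Sum>f\<in>?S. \<phi> (restrict_id f C)) = w * (\<Sum>p | p permutes C. \<phi> p)" for \<phi>
      using sum_given_cyclic_nodes by blast
    have "(\<Sum>p | p permutes C. real (card (?\<A> C p))) = (\<Sum>p | p permutes C. \<Sum>A | A \<subseteq> C \<and> card A = m. of_bool (\<forall>a\<in>A. p a = a))"
      using finC by (intro sum.cong refl, subst sum_of_bool_eq) (auto intro!: arg_cong[of _ _ card])
    also have "\<dots> = (\<Sum>A | A \<subseteq> C \<and> card A = m. \<Sum>p | p permutes C. of_bool (\<forall>a\<in>A. p a = a))"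
      by (rule sum.swap)
    also have "\<dots> = (\<Sum>A | A \<subseteq> C \<and> card A = m. fact (card C - m))"
    proof (rule sum.cong)
      fix A assume A: "A \<in> {A. A \<subseteq> C \<and> card A = m}"
      have "{p. p permutes C} \<inter> {p. \<forall>a\<in>A. p a = a} = {p. p permutes (C - A)}"
      proof (intro set_eqI iffI)
        fix p assume "p \<in> {p. p permutes C} \<inter> {p. \<forall>a\<in>A. p a = a}"
        then show "p \<in> {p. p permutes (C - A)}" using permutes_superset[of p C "C - A"] by auto
      next
        fix p assume "p \<in> {p. p permutes (C - A)}"
        then show "p \<in> {p. p permutes C} \<inter> {p. \<forall>a\<in>A. p a = a}"
          using permutes_subset[of p "C - A" C] permutes_not_in[of p "C - A"] by auto
      qed
      moreover have "card (C - A) = card C - m" using A finC by (auto simp: card_Diff_subset finite_subset)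
      ultimately show "(\<Sum>p | p permutes C. of_bool (\<forall>a\<in>A. p a = a) :: real) = fact (card C - m)"
        using finC by (subst sum_of_bool_eq) (auto simp: finite_permutations card_permutations[OF refl])
    qed simp
    also have "\<dots> = real (card C choose m) * fact (card C - m)"
      using n_subsets[OF finC, of m] by simp
    finally have P: "(\<Sum>p | p permutes C. real (card (?\<A> C p))) = real (card C choose m) * fact (card C - m)" .
    have "(\<Sum>f\<in>?S. fact m * real (card (?\<A> ?N f))) = fact m * (\<Sum>f\<in>?S. real (card (?\<A> C (restrict_id f C))))"
      unfolding sum_distrib_left by (intro sum.cong refl) (subst fixed, auto)
    also have "\<dots> = w * (fact m * (real (card C choose m) * fact (card C - m)))"
      unfolding w[of "\<lambda>p. real (card (?\<A> C p))"] P by simp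
    also have "fact m * (real (card C choose m) * fact (card C - m)) = of_bool (m \<le> card C) * fact (card C)"
    proof (cases "m \<le> card C")
      case True
      have "fact (card C) = fact m * fact (card C - m) * (card C choose m)"
        using binomial_fact_lemma[OF True] by simp
      then have "(fact (card C) :: real) = fact m * fact (card C - m) * real (card C choose m)"
        by (metis of_nat_fact of_nat_mult)
      then show ?thesis using True by simp
    qed (simp add: binomial_eq_0)
    also have "w * (of_bool (m \<le> card C) * fact (card C)) = of_bool (m \<le> card C) * real (card ?S)"
      using w[of "\<lambda>_. 1"] finC by (simp add: card_permutations[OF refl finC])
    also have "\<dots> = (\<Sum>f\<in>?S. of_bool (m \<le> card (cyclic_nodes n f)))" by simp
    finally show "(\<Sum>f\<in>?S. fact m * real (card (?\<A> ?N f))) = (\<Sum>f\<in>?S. of_bool (m \<le> card (cyclic_nodes n f)))" .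
  qed simp
  have "real (card {f \<in> ?M. m \<le> card (cyclic_nodes n f)}) = (\<Sum>f\<in>?M. of_bool (m \<le> card (cyclic_nodes n f)))"
    by (subst sum_of_bool_eq) (simp_all add: Int_def)
  then show ?thesis using L' R by (simp add: sum_distrib_left)
qed

lemma zero_k_mappings_nonempty:
  assumes "k \<ge> 1" "n = k * r" shows "zero_k_mappings k n \<noteq> {}"
proof -
  let ?N = "{1..n}"
  \<comment> \<open>The blocks of \<open>k\<close> consecutive nodes are collapsed to the nodes
    \<open>1, ..., r\<close>; the shifts by 1 are due to numbering nodes from 1.\<close>
  define f where "f = restrict (\<lambda>x. (x - 1) div k + 1) ?N"
  have le: "(x - 1) div k + 1 \<le> r" if "x \<in> ?N" for x
  proof -
    have "x - 1 < r * k" using that assms by (auto simp: mult.commute)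
    then have "(x - 1) div k < r" by (rule less_mult_imp_div_less)
    then show ?thesis by simp
  qed
  have rn: "r \<le> n" using assms by simp
  have "f \<in> ?N \<rightarrow>\<^sub>E ?N"
  proof (rule PiE_I)
    fix x assume "x \<in> ?N"
    then show "f x \<in> ?N" using le[of x] rn unfolding f_def by simp
  qed (simp only: f_def restrict_apply if_False)
  moreover have "card {x \<in> ?N. f x = y} \<in> {0, k}" if "y \<in> ?N" for y
  proof (cases "y \<le> r")
    case True
    have "{x \<in> ?N. f x = y} = {k * (y - 1) + 1..<k * (y - 1) + 1 + k}"
    proof (intro set_eqI iffI)
      fix x assume "x \<in> {x \<in> ?N. f x = y}"
      then have x: "x \<in> ?N" "(x - 1) div k = y - 1" by (auto simp: f_def)
      have "k * ((x - 1) div k) \<le> x - 1" "x - 1 < k * ((x - 1) div k) + k"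
        using assms dividend_less_times_div[of k "x - 1"] by (simp_all add: add.commute times_div_less_eq_dividend)
      then have "k * (y - 1) \<le> x - 1" "x - 1 < k * (y - 1) + k" by (simp_all only: x(2))
      then show "x \<in> {k * (y - 1) + 1..<k * (y - 1) + 1 + k}" using x by auto
    next
      fix x assume x: "x \<in> {k * (y - 1) + 1..<k * (y - 1) + 1 + k}"
      then have "(x - 1) div k = y - 1"
        by (intro div_nat_eqI) (auto simp: mult.commute)
      moreover have "k * (y - 1) + k \<le> n"
      proof -
        have "k * (y - 1) + k = k * y" using that by (cases y) auto
        then show ?thesis using True assms by simp
      qed
      then have "x \<in> ?N" using x by auto
      ultimately show "x \<in> {x \<in> ?N. f x = y}" using that by (auto simp: f_def)
    qed
    then show ?thesis by simp
  next
    case False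
    then have "{x \<in> ?N. f x = y} = {}" using le by (auto simp: f_def)
    then show ?thesis by simp
  qed
  ultimately have "f \<in> zero_k_mappings k n" unfolding zero_k_mappings_def by blast
  then show ?thesis by blast
qed

section \<open>Tails of the number of cyclic nodes\<close>

lemma card_cyclic_nodes_le: "card (cyclic_nodes n f) \<le> n"
  using card_mono[OF _ cyclic_nodes_subset[of n f]] by simp

context
  fixes k n r :: nat and N2 :: real
  assumes k: "k \<ge> 2" and r: "r \<ge> 1" and n: "n = k * r"
  defines "N2 \<equiv> real n / (real k - 1)"
begin

lemma num_nodes_bounds: "2 * r \<le> n" "real n = real k * real r" "real n > 0"
  using k r n by auto

text \<open>For \<open>m \<le> r\<close> each factor is at most \<open>exp (- i / N2)\<close>, so
  the product is at most \<open>exp (- m (m - 1) / (2 N2))\<close>, and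
  \<open>exp (- x) \<le> 1 / x\<close> gives a polynomial bound. For \<open>m > r\<close> the factor
  with \<open>i = r\<close> vanishes because \<open>n = k * r\<close>.\<close>

lemma cyclic_prod_upper:
  assumes "2 \<le> m" "m \<le> n"
  shows "(\<Prod>i<m. (real n - real k * real i) / (real n - real i)) \<le> 2 * N2 / (real m * (real m - 1))"
proof (cases "m \<le> r")
  case True
  define c where "c = (real k - 1) / real n"
  have c: "c > 0" using k num_nodes_bounds by (simp add: c_def)
  have "(\<Prod>i<m. (real n - real k * real i) / (real n - real i)) \<le> (\<Prod>i<m. exp (- (c * real i)))"
  proof (intro prod_mono conjI)
    fix i assume "i \<in> {..<m}"
    then have i: "i < r" using True by simp
    then have pos: "real n - real i > 0" using num_nodes_bounds(1) by simp
    have ki: "real k * real i \<le> real n" unfolding num_nodes_bounds(2) using i by (intro mult_left_mono) auto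
    show "0 \<le> (real n - real k * real i) / (real n - real i)" using pos ki by simp
    have "(real n - real k * real i) / (real n - real i) = 1 - (real k - 1) * real i / (real n - real i)"
      using pos by (simp add: field_simps)
    also have "(real k - 1) * real i / (real n - real i) \<ge> (real k - 1) * real i / real n"
      using k pos by (intro divide_left_mono mult_nonneg_nonneg) auto
    then have "1 - (real k - 1) * real i / (real n - real i) \<le> 1 + (- (c * real i))"
      by (simp add: c_def)
    also have "\<dots> \<le> exp (- (c * real i))" by (rule exp_ge_add_one_self)
    finally show "(real n - real k * real i) / (real n - real i) \<le> exp (- (c * real i))" .
  qed
  also have "\<dots> = exp (- (c * (\<Sum>i<m. real i)))"
    by (simp add: exp_sum[symmetric] sum_negf sum_distrib_left)
  also have "(\<Sum>i<m. real i) = real m * (real m - 1) / 2"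
    by (induction m) (auto simp: field_simps)
  also have "exp (- (c * (real m * (real m - 1) / 2))) \<le> inverse (c * (real m * (real m - 1) / 2))"
  proof -
    have "exp (- x) \<le> inverse x" if "x > 0" for x :: real
      unfolding exp_minus using that exp_ge_add_one_self[of x] by (intro le_imp_inverse_le) linarith+
    moreover have "0 < c * (real m * (real m - 1) / 2)" using c assms by simp
    ultimately show ?thesis by blast
  qed
  also have "\<dots> = 2 * N2 / (real m * (real m - 1))"
    by (simp add: c_def N2_def field_simps)
  finally show ?thesis .
next
  case False
  then have "(\<Prod>i<m. (real n - real k * real i) / (real n - real i)) = 0"
    using num_nodes_bounds(2) by (intro prod_zero) (auto intro!: bexI[of _ r])
  also have "0 \<le> 2 * N2 / (real m * (real m - 1))"
    using k assms by (simp add: N2_def)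
  finally show ?thesis .
qed

lemma cyclic_nodes_upper_tail:
  assumes u: "u \<ge> 2"
  shows "real (card {f \<in> zero_k_mappings k n. u < real (card (cyclic_nodes n f))}) \<le>
     real (card (zero_k_mappings k n)) * (4 * N2 / u\<^sup>2)"
proof -
  define m where "m = nat \<lfloor>u\<rfloor> + 1"
  have m: "u < real m" "2 \<le> m" using u unfolding m_def by linarith+
  have eq: "u < real c \<longleftrightarrow> m \<le> c" for c :: nat using u unfolding m_def by linarith
  have N2: "N2 \<ge> 0" using k by (simp add: N2_def)
  show ?thesis
  proof (cases "m \<le> n")
    case True
    \<comment> \<open>Here \<open>m - 1 > u - 1 \<ge> u / 2\<close>, the second step by
      \<open>u \<ge> 2\<close>.\<close>
    have "u * (u / 2) \<le> real m * (real m - 1)" using u m by (intro mult_mono) auto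
    then have "2 * N2 / (real m * (real m - 1)) \<le> 2 * N2 / (u * (u / 2))"
      using u N2 m by (intro divide_left_mono mult_pos_pos) auto
    also have "\<dots> = 4 * N2 / u\<^sup>2" using u by (simp add: power2_eq_square)
    finally show ?thesis unfolding eq card_cyclic_nodes_ge[OF True]
      using cyclic_prod_upper[OF m(2) True] by (intro mult_left_mono) auto
  next
    case False
    then have empty: "{f \<in> zero_k_mappings k n. u < real (card (cyclic_nodes n f))} = {}"
      unfolding eq using card_cyclic_nodes_le order_trans by blast
    show ?thesis unfolding empty using N2 by simp
  qed
qed

text \<open>With factors \<open>1 - a i\<close> the Weierstrass inequality bounds the complementary
  probability by the sum of the \<open>a i\<close>. The condition \<open>u \<le> r\<close> ensures
  \<open>a i \<le> 1\<close> and \<open>n - i \<ge> n / 2\<close>; the latter gives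
  \<open>a i \<le> 2 m / N2\<close>, and rounding up costs at most \<open>m \<le> 2 u\<close>,
  whence the factor 8.\<close>

lemma cyclic_nodes_lower_tail:
  assumes u: "1 \<le> u" "u \<le> real r"
  shows "real (card {f \<in> zero_k_mappings k n. real (card (cyclic_nodes n f)) < u}) \<le>
     real (card (zero_k_mappings k n)) * (8 * u\<^sup>2 / N2)"
proof -
  let ?M = "zero_k_mappings k n"
  define m where "m = nat \<lceil>u\<rceil>"
  have m: "real m \<le> 2 * u" "m \<le> r" using u unfolding m_def by linarith+
  have eq: "real c < u \<longleftrightarrow> \<not> m \<le> c" for c :: nat using u unfolding m_def by linarith
  have mn: "m \<le> n" using m num_nodes_bounds by simp
  define a where "a i = (real k - 1) * real i / (real n - real i)" for i :: nat
  have a: "0 \<le> a i" "a i \<le> 1" "a i \<le> 2 * real m / N2" "(real n - real k * real i) / (real n - real i) = 1 - a i" if "i < m" for i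
  proof -
    have i: "i < r" using that m by simp
    then have pos: "real n - real i > 0" and half: "real n / 2 \<le> real n - real i" using num_nodes_bounds(1) by linarith+
    have ki: "real k * real i \<le> real n" unfolding num_nodes_bounds(2) using i by (intro mult_left_mono) auto
    show "0 \<le> a i" using k pos by (simp add: a_def)
    show "a i \<le> 1" using pos ki by (simp add: a_def algebra_simps)
    show "(real n - real k * real i) / (real n - real i) = 1 - a i" using pos by (simp add: a_def field_simps)
    have "a i \<le> (real k - 1) * real m / (real n / 2)"
      unfolding a_def using k pos half that num_nodes_bounds(3) by (intro frac_le mult_left_mono mult_nonneg_nonneg) auto
    also have "\<dots> = 2 * real m / N2" by (simp add: N2_def)
    finally show "a i \<le> 2 * real m / N2" .
  qed
  have "1 - (\<Sum>i<m. a i) \<le> (\<Prod>i<m. 1 - a i)"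
    using a by (intro Weierstrass_prod_ineq) auto
  moreover have "(\<Sum>i<m. a i) \<le> (\<Sum>i<m. 2 * real m / N2)" using a by (intro sum_mono) auto
  moreover have "(\<Sum>i<m. 2 * real m / N2) = 2 * (real m)\<^sup>2 / N2"
    by (simp only: sum_constant card_lessThan power2_eq_square) simp
  moreover have "2 * (real m)\<^sup>2 / N2 \<le> 2 * (2 * u)\<^sup>2 / N2"
    using k m by (intro divide_right_mono mult_left_mono power_mono) (auto simp: N2_def)
  moreover have "(\<Prod>i<m. 1 - a i) = (\<Prod>i<m. (real n - real k * real i) / (real n - real i))"
    using a by (intro prod.cong) auto
  moreover have "2 * (2 * u)\<^sup>2 / N2 = 8 * u\<^sup>2 / N2" by (simp add: power_mult_distrib)
  ultimately have P: "1 - (\<Prod>i<m. (real n - real k * real i) / (real n - real i)) \<le> 8 * u\<^sup>2 / N2"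
    by linarith
  have "{f \<in> ?M. real (card (cyclic_nodes n f)) < u} = ?M - {f \<in> ?M. m \<le> card (cyclic_nodes n f)}"
    unfolding eq by auto
  then have "real (card {f \<in> ?M. real (card (cyclic_nodes n f)) < u}) = real (card ?M) - real (card {f \<in> ?M. m \<le> card (cyclic_nodes n f)})"
    by (simp add: card_Diff_subset card_mono of_nat_diff)
  also have "\<dots> = real (card ?M) * (1 - (\<Prod>i<m. (real n - real k * real i) / (real n - real i)))"
    unfolding card_cyclic_nodes_ge[OF mn] by (simp add: algebra_simps)
  also have "\<dots> \<le> real (card ?M) * (8 * u\<^sup>2 / N2)" using P by (intro mult_left_mono) auto
  finally show ?thesis .
qed

end

section \<open>Stein's method for sums of independent Bernoulli variables\<close>

lemma std_normal_density_le_1: "std_normal_density x \<le> 1"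
proof -
  have "1 \<le> sqrt (2 * pi)" using pi_gt3 by simp
  moreover have "exp (- x\<^sup>2 / 2) \<le> 1" by simp
  ultimately have "exp (- x\<^sup>2 / 2) \<le> sqrt (2 * pi)" by (rule order_trans[rotated])
  then show ?thesis unfolding std_normal_density_def by simp
qed

lemma phi_eq: "phi x = (LINT t:{..x}|lborel. std_normal_density t)"
  unfolding phi_def std_normal_density_def by simp

lemma set_integrable_std_normal:
  "A \<in> sets lborel \<Longrightarrow> set_integrable lborel A std_normal_density"
  unfolding set_integrable_def by (rule integrable_mult_indicator) auto

lemma phi_eq_measure: "phi x = measure std_normal_distribution {..x}"
proof -
  have "phi x = enn2real (\<integral>\<^sup>+t. ennreal (indicat_real {..x} t *\<^sub>R std_normal_density t) \<partial>lborel)"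
    unfolding phi_eq set_lebesgue_integral_def by (subst integral_eq_nn_integral) auto
  also have "\<dots> = enn2real (\<integral>\<^sup>+t. ennreal (std_normal_density t) * indicator {..x} t \<partial>lborel)"
    by (intro arg_cong[where f = enn2real] nn_integral_cong) (auto split: split_indicator)
  finally show ?thesis by (simp add: measure_def emeasure_density)
qed

lemma phi_diff: assumes "x \<le> y" shows "phi x \<le> phi y" "phi y \<le> phi x + (y - x)"
proof -
  have eq: "phi y = phi x + (LINT t:{x<..y}|lborel. std_normal_density t)"
    unfolding phi_eq using assms
    by (subst set_integral_Un[symmetric]) (auto intro!: set_integrable_std_normal arg_cong2[where f="set_lebesgue_integral lborel"])
  have "(LINT t:{x<..y}|lborel. std_normal_density t) \<le> (LINT t:{x<..y}|lborel. 1)"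
    by (intro set_integral_mono set_integrable_std_normal std_normal_density_le_1)       (use assms in \<open>auto simp: set_integrable_def intro!: integrable_real_indicator\<close>)
  also have "\<dots> = y - x" using assms by (simp add: set_lebesgue_integral_def)
  finally show "phi y \<le> phi x + (y - x)" using eq by simp
  have "(LINT t:{x<..y}|lborel. std_normal_density t) \<ge> 0"
    unfolding set_lebesgue_integral_def by (intro integral_nonneg_AE) auto
  then show "phi x \<le> phi y" using eq by simp
qed

lemma phi_lipschitz: "\<bar>phi x - phi y\<bar> \<le> \<bar>x - y\<bar>"
  using phi_diff[of x y] phi_diff[of y x] by (cases "x \<le> y") auto

lemma phi_0_1: "0 \<le> phi x" "phi x \<le> 1"
proof -
  interpret prob_space std_normal_distribution by (rule prob_space_normal_density) simp
  show "0 \<le> phi x" "phi x \<le> 1" unfolding phi_eq_measure by auto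
qed

lemma deriv_std_normal_density:
  "(std_normal_density has_real_derivative - x * std_normal_density x) (at x)"
proof -
  define c where "c = 1 / sqrt (2 * pi)"
  show ?thesis unfolding std_normal_density_def c_def[symmetric]
    by (auto intro!: derivative_eq_intros)
qed

definition normal_tail :: "real \<Rightarrow> real" where
  "normal_tail w = (LINT t:{w..}|lborel. std_normal_density t)"

text \<open>On the range of integration \<open>w\<close> is at most the variable \<open>x\<close>,
  and \<open>x\<close> times the density is the derivative of minus the density.\<close>

lemma normal_tail_mills:
  assumes "w \<ge> 0" shows "w * normal_tail w \<le> std_normal_density w"
proof -
  have lim: "((\<lambda>x. - std_normal_density x) \<longlongrightarrow> 0) at_top"
    unfolding std_normal_density_def by real_asymp
  have nn: "(\<integral>\<^sup>+x. ennreal (x * std_normal_density x) * indicator {w..} x \<partial>lborel) = ennreal (0 - (- std_normal_density w))"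
    by (rule nn_integral_FTC_atLeast[OF _ _ _ lim])
       (use assms in \<open>auto intro!: derivative_eq_intros deriv_std_normal_density\<close>)
  have "ennreal (w * normal_tail w) = (\<integral>\<^sup>+x. ennreal (w * std_normal_density x) * indicator {w..} x \<partial>lborel)"
  proof -
    have "w * normal_tail w = (LINT x|lborel. w * std_normal_density x * indicator {w..} x)"
      unfolding normal_tail_def set_lebesgue_integral_def by (simp flip: integral_mult_right_zero add: mult_ac)
    moreover have "integrable lborel (\<lambda>x. w * std_normal_density x * indicator {w..} x)"
      by (intro integrable_real_mult_indicator) auto
    ultimately have "ennreal (w * normal_tail w) = (\<integral>\<^sup>+x. ennreal (w * std_normal_density x * indicator {w..} x) \<partial>lborel)"
      using assms by (subst nn_integral_eq_integral) auto
    also have "\<dots> = (\<integral>\<^sup>+x. ennreal (w * std_normal_density x) * indicator {w..} x \<partial>lborel)"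
      by (intro nn_integral_cong) (auto split: split_indicator)
    finally show ?thesis .
  qed
  also have "\<dots> \<le> (\<integral>\<^sup>+x. ennreal (x * std_normal_density x) * indicator {w..} x \<partial>lborel)"
    by (intro nn_integral_mono) (auto split: split_indicator intro!: ennreal_leI mult_right_mono)
  finally show ?thesis using nn by (simp add: ennreal_le_iff)
qed

text \<open>For \<open>t \<ge> w \<ge> 0\<close> one has \<open>t^2 \<ge> w^2 + (t - w)^2\<close>,
  so the density at \<open>t\<close> is at most \<open>sqrt (2 * pi)\<close> times the product of
  the densities at \<open>w\<close> and at \<open>t - w\<close>; the last factor integrates to 1
  over the line. This covers small \<open>w\<close>, where \<open>normal_tail_mills\<close> says
  nothing.\<close>

lemma normal_tail_le:
  assumes "w \<ge> 0" shows "normal_tail w \<le> 3 * std_normal_density w"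
proof -
  have sq: "sqrt (2*pi) \<le> 3" using pi_less_4 by (intro real_le_lsqrt) (auto)
  have int: "integrable lborel (\<lambda>t. std_normal_density (-w + t))"
    using lborel_integrable_real_affine[of std_normal_density 1 "-w"] by auto
  have "normal_tail w \<le> (LINT t|lborel. 3 * std_normal_density w * std_normal_density (-w + t))"
    unfolding normal_tail_def set_lebesgue_integral_def
  proof (rule integral_mono)
    show "integrable lborel (\<lambda>x. indicat_real {w..} x *\<^sub>R std_normal_density x)"
      using set_integrable_std_normal[of "{w..}"] by (simp add: set_integrable_def)
    show "integrable lborel (\<lambda>t. 3 * std_normal_density w * std_normal_density (-w + t))"
      using int by simp
    fix t :: real
    show "indicat_real {w..} t *\<^sub>R std_normal_density t \<le> 3 * std_normal_density w * std_normal_density (-w + t)"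
    proof (cases "t \<ge> w")
      case True
      have "0 \<le> w * (t - w)" using True assms by simp
      then have "- t\<^sup>2 / 2 \<le> - w\<^sup>2 / 2 + - (-w + t)\<^sup>2 / 2"
        by (simp add: power2_eq_square algebra_simps)
      then have "exp (- t\<^sup>2 / 2) \<le> exp (- w\<^sup>2 / 2) * exp (- (-w + t)\<^sup>2 / 2)"
        by (simp only: exp_add[symmetric] exp_le_cancel_iff)
      moreover have "1 / sqrt (2*pi) \<le> 3 * (1 / sqrt (2*pi)) * (1 / sqrt (2*pi))"
      proof -
        have "1 / s \<le> 3 * (1 / s) * (1 / s)" if "0 < s" "s \<le> 3" for s :: real
          using that by (simp add: field_simps)
        from this[of "sqrt (2 * pi)"] show ?thesis using sq by simp
      qed
      ultimately have "1 / sqrt (2*pi) * exp (- t\<^sup>2 / 2) \<le> (3 * (1 / sqrt (2*pi)) * (1 / sqrt (2*pi))) * (exp (- w\<^sup>2 / 2) * exp (- (-w + t)\<^sup>2 / 2))"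
        by (intro mult_mono) auto
      then show ?thesis using True unfolding std_normal_density_def by (simp add: mult_ac)
    qed auto
  qed
  also have "\<dots> = 3 * std_normal_density w"
    using lborel_integral_real_affine[of 1 std_normal_density "-w"] by simp
  finally show ?thesis .
qed

lemma set_integral_std_normal_le:
  assumes "g \<in> borel_measurable borel" "\<And>x. \<bar>g x\<bar> \<le> 1" "A \<in> sets borel"
  shows "\<bar>LINT t:A|lborel. std_normal_density t * g t\<bar> \<le> (LINT t:A|lborel. std_normal_density t)"
proof -
  have "set_integrable lborel A (\<lambda>t. std_normal_density t * g t)"
    unfolding set_integrable_def using assms
    by (intro Bochner_Integration.integrable_bound[OF set_integrable_std_normal[of A, unfolded set_integrable_def]])
       (auto split: split_indicator simp: abs_mult mult_left_le)
  then have "norm (LINT t:A|lborel. std_normal_density t * g t) \<le> (LINT t:A|lborel. norm (std_normal_density t * g t))"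
    by (rule set_integral_norm_bound)
  also have "\<dots> \<le> (LINT t:A|lborel. std_normal_density t)"
    using assms by (intro set_integral_mono set_integrable_std_normal set_integrable_norm
       \<open>set_integrable lborel A (\<lambda>t. std_normal_density t * g t)\<close>) (auto simp: abs_mult mult_left_le)
  finally show ?thesis by simp
qed

lemma lower_tail_eq: "(LINT t:{..w}|lborel. std_normal_density t) = normal_tail (-w)"
proof -
  have "(LINT t:{..w}|lborel. std_normal_density t)
      = (LINT t|lborel. indicat_real {..w} (0 + - 1 * t) *\<^sub>R std_normal_density (0 + - 1 * t))"
    unfolding set_lebesgue_integral_def
    using lborel_integral_real_affine[of "-1" "\<lambda>t. indicat_real {..w} t *\<^sub>R std_normal_density t" 0]
    by (simp only:) simp
  also have "\<dots> = normal_tail (-w)"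
    unfolding normal_tail_def set_lebesgue_integral_def
    by (rule Bochner_Integration.integral_cong) (simp_all add: std_normal_density_def indicator_def)
  finally show ?thesis .
qed

section \<open>The solution of Stein's equation\<close>

definition normal_mean :: "(real \<Rightarrow> real) \<Rightarrow> real" where
  "normal_mean h = (LINT t|lborel. std_normal_density t * h t)"

text \<open>This solves \<open>f' w - w * f w = h w - normal_mean h\<close>; the normal density is
  the integrating factor, and integration from minus infinity selects a bounded solution.\<close>

definition stein_sol :: "(real \<Rightarrow> real) \<Rightarrow> real \<Rightarrow> real" where
  "stein_sol h w = (LINT t:{..w}|lborel. std_normal_density t * (h t - normal_mean h)) / std_normal_density w"

lemma borel_measurable_continuous_UNIV: "continuous_on UNIV (h::real\<Rightarrow>real) \<Longrightarrow> h \<in> borel_measurable borel"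
  by (rule borel_measurable_continuous_onI)

lemma integrable_std_normal_mult:
  assumes "g \<in> borel_measurable borel" "\<And>x. \<bar>g x\<bar> \<le> 1"
  shows "integrable lborel (\<lambda>t. std_normal_density t * g t)"
  by (rule Bochner_Integration.integrable_bound[of lborel std_normal_density])
     (use assms in \<open>auto simp: abs_mult mult_left_le\<close>)

context
  fixes h :: "real \<Rightarrow> real"
  assumes h_cont: "continuous_on UNIV h" and h_01: "\<And>x. 0 \<le> h x" "\<And>x. h x \<le> 1"
begin

lemma h_measurable: "h \<in> borel_measurable borel" by (rule borel_measurable_continuous_UNIV[OF h_cont])

lemma normal_mean_0_1: "0 \<le> normal_mean h" "normal_mean h \<le> 1"
proof -
  show "0 \<le> normal_mean h" unfolding normal_mean_def using h_01 by (intro integral_nonneg_AE) auto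
  have "normal_mean h \<le> (LINT t|lborel. std_normal_density t)"
    unfolding normal_mean_def using h_01 h_measurable
    by (intro integral_mono integrable_std_normal_mult) (auto intro: mult_left_le)
  then show "normal_mean h \<le> 1" by simp
qed

lemma abs_centred_le_1: "\<bar>h t - normal_mean h\<bar> \<le> 1"
  using h_01[of t] normal_mean_0_1 by linarith

abbreviation (input) "stein_term t \<equiv> std_normal_density t * (h t - normal_mean h)"

lemma stein_term_integrable: "integrable lborel (\<lambda>t. stein_term t)"
  using h_measurable abs_centred_le_1 by (intro integrable_std_normal_mult) auto

lemma stein_term_set_integrable: "S \<in> sets lborel \<Longrightarrow> set_integrable lborel S (\<lambda>t. stein_term t)"
  unfolding set_integrable_def by (rule integrable_mult_indicator[OF _ stein_term_integrable])

lemma stein_term_integral_0: "(LINT t|lborel. stein_term t) = 0"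
proof -
  have "(LINT t|lborel. stein_term t) = (LINT t|lborel. std_normal_density t * h t - std_normal_density t * normal_mean h)"
    by (simp add: algebra_simps)
  also have "\<dots> = normal_mean h - (LINT t|lborel. std_normal_density t * normal_mean h)"
    unfolding normal_mean_def[symmetric]
    using h_01 h_measurable by (subst Bochner_Integration.integral_diff) (auto intro!: integrable_std_normal_mult simp: normal_mean_def)
  finally show ?thesis by simp
qed

lemma stein_lower_le:
  "\<bar>LINT t:{..w}|lborel. stein_term t\<bar> \<le> normal_tail (-w)"
  using set_integral_std_normal_le[of "\<lambda>t. h t - normal_mean h" "{..w}"] h_measurable abs_centred_le_1 
  by (auto simp: lower_tail_eq)

text \<open>The integrand has integral zero over the line, so its integral up to \<open>w\<close> is
  minus the one beyond \<open>w\<close>. For positive \<open>w\<close> the tail beyond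
  \<open>w\<close> is the small one, for negative \<open>w\<close> the tail of
  \<open>stein_lower_le\<close>.\<close>

lemma stein_upper_le:
  "\<bar>LINT t:{..w}|lborel. stein_term t\<bar> \<le> normal_tail w"
proof -
  have "(LINT t:{..w}|lborel. stein_term t) + (LINT t:{w<..}|lborel. stein_term t) = (LINT t:({..w} \<union> {w<..})|lborel. stein_term t)"
    by (subst set_integral_Un) (auto intro!: stein_term_set_integrable)
  also have "{..w} \<union> {w<..} = UNIV" by auto
  also have "(LINT t:UNIV|lborel. stein_term t) = 0"
    using stein_term_integral_0 by (simp add: set_lebesgue_integral_def)
  finally have "\<bar>LINT t:{..w}|lborel. stein_term t\<bar> = \<bar>LINT t:{w<..}|lborel. stein_term t\<bar>" by linarith
  also have "\<dots> \<le> (LINT t:{w<..}|lborel. std_normal_density t)"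
    using h_measurable abs_centred_le_1 by (intro set_integral_std_normal_le) auto
  also have "\<dots> \<le> normal_tail w"
    unfolding normal_tail_def set_lebesgue_integral_def
    using set_integrable_std_normal[of "{w<..}"] set_integrable_std_normal[of "{w..}"]
    by (intro integral_mono) (auto simp: set_integrable_def split: split_indicator)
  finally show ?thesis .
qed

lemma stein_num_le: "\<bar>LINT t:{..w}|lborel. stein_term t\<bar> \<le> normal_tail \<bar>w\<bar>"
  using stein_lower_le[of w] stein_upper_le[of w] by (auto simp: abs_if)

lemma stein_sol_bound: "\<bar>stein_sol h w\<bar> \<le> 3"
proof -
  have "std_normal_density \<bar>w\<bar> = std_normal_density w" by (simp add: std_normal_density_def)
  then show ?thesis unfolding stein_sol_def
    using stein_num_le[of w] normal_tail_le[of "\<bar>w\<bar>"] by (simp add: field_simps normal_density_pos)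
qed

lemma stein_sol_mult_bound: "\<bar>w * stein_sol h w\<bar> \<le> 1"
proof -
  have e: "std_normal_density \<bar>w\<bar> = std_normal_density w" by (simp add: std_normal_density_def)
  have "\<bar>w\<bar> * \<bar>LINT t:{..w}|lborel. stein_term t\<bar> \<le> \<bar>w\<bar> * normal_tail \<bar>w\<bar>"
    by (intro mult_left_mono stein_num_le) auto
  also have "\<dots> \<le> std_normal_density w" using normal_tail_mills[of "\<bar>w\<bar>"] e by simp
  finally show ?thesis unfolding stein_sol_def by (simp add: abs_mult divide_le_eq normal_density_pos)
qed

lemma stein_num_deriv:
  "((\<lambda>w. LINT t:{..w}|lborel. stein_term t) has_real_derivative stein_term w) (at w)"
proof -
  have cont: "continuous_on UNIV (\<lambda>t. stein_term t)"
    unfolding std_normal_density_def by (intro continuous_intros h_cont) auto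
  \<comment> \<open>An auxiliary base point below \<open>w\<close> splits the improper integral into
    a constant and an integral over a compact interval, to which the fundamental theorem of calculus
    applies.\<close>
  define c d where "c = w - 1" and "d = w + 1"
  have "((\<lambda>u. integral {c..u} (\<lambda>t. stein_term t)) has_real_derivative stein_term w) (at w within {c..d})"
    by (rule integral_has_real_derivative) (auto intro: continuous_on_subset[OF cont] simp: c_def d_def)
  then have "((\<lambda>u. integral {c..u} (\<lambda>t. stein_term t)) has_real_derivative stein_term w) (at w within {c<..<d})"
    by (rule DERIV_subset) auto
  then have D: "((\<lambda>u. (LINT t:{..c}|lborel. stein_term t) + integral {c..u} (\<lambda>t. stein_term t)) has_real_derivative stein_term w) (at w)"
    by (subst (asm) at_within_open) (auto simp: c_def d_def intro!: derivative_eq_intros)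
  have eq: "(LINT t:{..u}|lborel. stein_term t) = (LINT t:{..c}|lborel. stein_term t) + integral {c..u} (\<lambda>t. stein_term t)" if "u > c" for u
  proof -
    have "(LINT t:{..u}|lborel. stein_term t) = (LINT t:{..c} \<union> {c<..u}|lborel. stein_term t)"
      using that by (intro arg_cong2[where f="set_lebesgue_integral lborel"]) auto
    also have "\<dots> = (LINT t:{..c}|lborel. stein_term t) + (LINT t:{c<..u}|lborel. stein_term t)"
      by (rule set_integral_Un) (auto intro!: stein_term_set_integrable)
    also have "(LINT t:{c<..u}|lborel. stein_term t) = (LINT t:{c..u}|lborel. stein_term t)"
      unfolding set_lebesgue_integral_def
      by (rule integral_cong_AE) (use h_measurable AE_lborel_singleton[of c] in \<open>auto elim!: eventually_mono split: split_indicator\<close>)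
    also have "\<dots> = integral {c..u} (\<lambda>t. stein_term t)"
      by (rule set_borel_integral_eq_integral(2)) (auto intro!: stein_term_set_integrable)
    finally show ?thesis .
  qed
  show ?thesis
    by (rule has_field_derivative_transform_within_open[OF D, of "{c<..}"])
       (use eq in \<open>auto simp: c_def\<close>)
qed

lemma stein_sol_deriv:
  "(stein_sol h has_real_derivative (w * stein_sol h w + h w - normal_mean h)) (at w)"
proof -
  have nz: "std_normal_density w \<noteq> 0" by (metis less_irrefl normal_density_pos zero_less_one)
  show ?thesis unfolding stein_sol_def[abs_def]
    by (rule derivative_eq_intros stein_num_deriv deriv_std_normal_density)+
       (use nz in \<open>auto simp: field_simps power2_eq_square\<close>)
qed

end

section \<open>Lipschitz test functions between two indicators\<close>

definition ramp :: "real \<Rightarrow> real \<Rightarrow> real \<Rightarrow> real" where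
  "ramp x e t = max 0 (min 1 ((x + e - t) / e))"

lemma ramp_props:
  assumes "e > 0"
  shows "continuous_on UNIV (ramp x e)" "0 \<le> ramp x e t" "ramp x e t \<le> 1"
    "\<bar>ramp x e t - ramp x e s\<bar> \<le> (1 / e) * \<bar>t - s\<bar>"
    "of_bool (t \<le> x) \<le> ramp x e t" "ramp x e t \<le> of_bool (t \<le> x + e)"
proof -
  show "continuous_on UNIV (ramp x e)"
    unfolding ramp_def[abs_def] using assms by (intro continuous_intros) auto
  have "\<bar>ramp x e t - ramp x e s\<bar> \<le> \<bar>(x + e - t) / e - (x + e - s) / e\<bar>"
    unfolding ramp_def by linarith
  also have "(x + e - t) / e - (x + e - s) / e = (s - t) / e"
    by (simp add: diff_divide_distrib)
  also have "\<bar>\<dots>\<bar> = (1 / e) * \<bar>t - s\<bar>" using assms by (simp add: abs_minus_commute)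
  finally show "\<bar>ramp x e t - ramp x e s\<bar> \<le> (1 / e) * \<bar>t - s\<bar>" .
  have "t \<le> x \<Longrightarrow> (x + e - t) / e \<ge> 1" "t > x + e \<Longrightarrow> (x + e - t) / e \<le> 0"
    using assms by (simp_all add: divide_le_eq)
  then show "of_bool (t \<le> x) \<le> ramp x e t" "ramp x e t \<le> of_bool (t \<le> x + e)"
    by (auto simp: ramp_def)
qed (auto simp: ramp_def)

lemma normal_mean_ramp:
  assumes "e > 0"
  shows "phi x \<le> normal_mean (ramp x e)" "normal_mean (ramp x e) \<le> phi x + e"
proof -
  note r = ramp_props[OF assms]
  have int: "integrable lborel (\<lambda>t. std_normal_density t * ramp x e t)"
    using borel_measurable_continuous_UNIV[OF r(1)] r(2,3) by (intro integrable_std_normal_mult) auto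
  have ind: "integrable lborel (\<lambda>t. indicat_real {..y} t *\<^sub>R std_normal_density t)" for y
    using set_integrable_std_normal[of "{..y}"] by (simp add: set_integrable_def)
  show "phi x \<le> normal_mean (ramp x e)"
    unfolding phi_eq normal_mean_def set_lebesgue_integral_def
  proof (intro integral_mono int ind)
    fix t show "indicat_real {..x} t *\<^sub>R std_normal_density t \<le> std_normal_density t * ramp x e t"
      using mult_left_mono[OF r(5)[of t x], of "std_normal_density t"] r(2)[of x t]
      by (auto split: split_indicator)
  qed
  have "normal_mean (ramp x e) \<le> phi (x + e)"
    unfolding phi_eq normal_mean_def set_lebesgue_integral_def
  proof (intro integral_mono int ind)
    fix t show "std_normal_density t * ramp x e t \<le> indicat_real {..x + e} t *\<^sub>R std_normal_density t"
      using r(6)[of x t] r(2)[of x t] r(3)[of x t] by (auto split: split_indicator simp: mult_left_le)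
  qed
  also have "\<dots> \<le> phi x + e" using phi_diff(2)[of x "x + e"] assms by simp
  finally show "normal_mean (ramp x e) \<le> phi x + e" .
qed

section \<open>Sums of independent weighted Bernoulli variables\<close>

definition bernoulli_exp :: "'a set \<Rightarrow> ('a \<Rightarrow> real) \<Rightarrow> ('a set \<Rightarrow> real) \<Rightarrow> real" where
  "bernoulli_exp I p F = (\<Sum>A\<in>Pow I. (\<Prod>i\<in>A. p i) * (\<Prod>i\<in>I - A. 1 - p i) * F A)"

lemma bernoulli_exp_empty [simp]: "bernoulli_exp {} p F = F {}"
  by (simp add: bernoulli_exp_def)

lemma bernoulli_exp_insert:
  assumes "finite J" "i \<notin> J"
  shows "bernoulli_exp (insert i J) p F = p i * bernoulli_exp J p (\<lambda>A. F (insert i A)) + (1 - p i) * bernoulli_exp J p F"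
proof -
  let ?g = "\<lambda>A. (\<Prod>j\<in>A. p j) * (\<Prod>j\<in>insert i J - A. 1 - p j) * F A"
  have inj: "inj_on (insert i) (Pow J)" using assms by (auto simp: inj_on_def)
  have "bernoulli_exp (insert i J) p F = sum ?g (Pow J) + sum ?g (insert i ` Pow J)"
    unfolding bernoulli_exp_def Pow_insert using assms by (intro sum.union_disjoint) auto
  also have "sum ?g (insert i ` Pow J) = (\<Sum>A\<in>Pow J. ?g (insert i A))"
    by (simp add: sum.reindex[OF inj])
  also have "\<dots> = p i * bernoulli_exp J p (\<lambda>A. F (insert i A))"
    unfolding bernoulli_exp_def sum_distrib_left
  proof (rule sum.cong)
    fix A assume A: "A \<in> Pow J"
    then have "insert i J - insert i A = J - A" "finite A" "i \<notin> A"
      using assms finite_subset by auto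
    then show "?g (insert i A) = p i * (prod p A * (\<Prod>i\<in>J - A. 1 - p i) * F (insert i A))"
      by simp
  qed auto
  also have "sum ?g (Pow J) = (1 - p i) * bernoulli_exp J p F"
    unfolding bernoulli_exp_def sum_distrib_left
  proof (rule sum.cong)
    fix A assume A: "A \<in> Pow J"
    then have "insert i J - A = insert i (J - A)" "finite (J - A)" "i \<notin> J - A"
      using assms by auto
    then show "?g A = (1 - p i) * (prod p A * (\<Prod>i\<in>J - A. 1 - p i) * F A)"
      by simp
  qed auto
  finally show ?thesis by simp
qed

lemma bernoulli_exp_cong: "(\<And>A. A \<subseteq> I \<Longrightarrow> F A = G A) \<Longrightarrow> bernoulli_exp I p F = bernoulli_exp I p G"
  unfolding bernoulli_exp_def by (intro sum.cong) auto

lemma bernoulli_exp_add: "bernoulli_exp I p (\<lambda>A. F A + G A) = bernoulli_exp I p F + bernoulli_exp I p G"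
  unfolding bernoulli_exp_def by (simp add: distrib_left sum.distrib)

lemma bernoulli_exp_cmult: "bernoulli_exp I p (\<lambda>A. c * F A) = c * bernoulli_exp I p F"
  unfolding bernoulli_exp_def by (simp add: sum_distrib_left mult_ac)

lemma bernoulli_exp_diff: "bernoulli_exp I p (\<lambda>A. F A - G A) = bernoulli_exp I p F - bernoulli_exp I p G"
  unfolding bernoulli_exp_def by (simp add: right_diff_distrib sum_subtractf)

lemma bernoulli_exp_sum: "bernoulli_exp I p (\<lambda>A. \<Sum>j\<in>S. F j A) = (\<Sum>j\<in>S. bernoulli_exp I p (F j))"
  unfolding bernoulli_exp_def by (subst sum.swap) (simp add: sum_distrib_left)

lemma bernoulli_exp_const: "finite I \<Longrightarrow> bernoulli_exp I p (\<lambda>A. c) = c"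
  by (induction I rule: finite_induct) (simp_all add: bernoulli_exp_insert algebra_simps)

lemma bernoulli_exp_mono:
  assumes "\<And>i. i \<in> I \<Longrightarrow> p i \<in> {0..1}" "\<And>A. A \<subseteq> I \<Longrightarrow> F A \<le> G A"
  shows "bernoulli_exp I p F \<le> bernoulli_exp I p G"
  unfolding bernoulli_exp_def using assms
  by (intro sum_mono mult_left_mono mult_nonneg_nonneg prod_nonneg) auto

lemma bernoulli_exp_abs_le:
  assumes "\<And>i. i \<in> I \<Longrightarrow> p i \<in> {0..1}" "\<And>A. A \<subseteq> I \<Longrightarrow> \<bar>F A\<bar> \<le> G A"
  shows "\<bar>bernoulli_exp I p F\<bar> \<le> bernoulli_exp I p G"
proof -
  have *: "F A \<le> G A" "- 1 * F A \<le> G A" if "A \<subseteq> I" for A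
    using assms(2)[OF that] by auto
  have "bernoulli_exp I p F \<le> bernoulli_exp I p G" by (rule bernoulli_exp_mono[OF assms(1) *(1)])
  moreover have "bernoulli_exp I p (\<lambda>A. - 1 * F A) \<le> bernoulli_exp I p G" by (rule bernoulli_exp_mono[OF assms(1) *(2)])
  ultimately show ?thesis unfolding bernoulli_exp_cmult by linarith
qed

text \<open>The free offset \<open>c\<close> carries the induction: a further index shifts the
  centred sum by \<open>a i * (1 - p i)\<close> or by \<open>- a i * p i\<close>, and the offset
  absorbs both.\<close>

lemma bernoulli_exp_second_moment:
  assumes "finite I"
  shows "bernoulli_exp I p (\<lambda>A. sum a A - (\<Sum>i\<in>I. a i * p i) + c) = c"
    and "bernoulli_exp I p (\<lambda>A. (sum a A - (\<Sum>i\<in>I. a i * p i) + c)\<^sup>2) = (\<Sum>i\<in>I. (a i)\<^sup>2 * (p i * (1 - p i))) + c\<^sup>2"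
  using assms
proof (induction I arbitrary: c rule: finite_induct)
  case (insert i I)
  let ?m = "\<Sum>i\<in>I. a i * p i"
  have *: "bernoulli_exp I p (\<lambda>A. F (sum a (insert i A) - (a i * p i + ?m) + c)) =
           bernoulli_exp I p (\<lambda>A. F (sum a A - ?m + (c + a i * (1 - p i))))" for F and c
  proof (rule bernoulli_exp_cong)
    fix A assume "A \<subseteq> I"
    then have "sum a (insert i A) = a i + sum a A"
      using insert.hyps by (meson finite_subset sum.insert subsetD)
    then show "F (sum a (insert i A) - (a i * p i + ?m) + c) = F (sum a A - ?m + (c + a i * (1 - p i)))"
      by (intro arg_cong[of _ _ F]) (simp add: algebra_simps)
  qed
  have **: "bernoulli_exp I p (\<lambda>A. F (sum a A - (a i * p i + ?m) + c)) =
           bernoulli_exp I p (\<lambda>A. F (sum a A - ?m + (c - a i * p i)))" for F and c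
    by (intro bernoulli_exp_cong arg_cong[of _ _ F]) simp
  {
    case 1
    have "p i * (c + a i * (1 - p i)) + (1 - p i) * (c - a i * p i) = c" by (simp add: algebra_simps)
    then show ?case unfolding bernoulli_exp_insert[OF insert.hyps(1,2)] sum.insert[OF insert.hyps(1,2)]
      using *[of "\<lambda>x. x" c] **[of "\<lambda>x. x" c] by (simp only: insert.IH)
  next
    case 2
    have "p i * (v + (c + a i * (1 - p i))\<^sup>2) + (1 - p i) * (v + (c - a i * p i)\<^sup>2)
        = (a i)\<^sup>2 * (p i * (1 - p i)) + v + c\<^sup>2" for v
      by (simp add: algebra_simps power2_eq_square)
    then show ?case unfolding bernoulli_exp_insert[OF insert.hyps(1,2)] sum.insert[OF insert.hyps(1,2)]
      using *[of "\<lambda>x. x^2" c] **[of "\<lambda>x. x^2" c] by (simp only: insert.IH)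
  }
qed auto

locale bernoulli_sum =
  fixes I :: "'a set" and p a :: "'a \<Rightarrow> real" and \<beta> :: real
  assumes fin: "finite I"
    and p: "\<And>i. i \<in> I \<Longrightarrow> p i \<in> {0..1}"
    and a: "\<And>i. i \<in> I \<Longrightarrow> 0 \<le> a i" "\<And>i. i \<in> I \<Longrightarrow> a i \<le> \<beta>"
    and var: "(\<Sum>i\<in>I. (a i)\<^sup>2 * (p i * (1 - p i))) = 1"
begin

definition "mean = (\<Sum>i\<in>I. a i * p i)"

abbreviation "W A \<equiv> sum a A - mean"

lemma bernoulli_exp_W_sq: "bernoulli_exp I p (\<lambda>A. (W A)\<^sup>2) = 1"
  using bernoulli_exp_second_moment(2)[OF fin, where c = 0] var by (simp add: mean_def)

lemma bernoulli_exp_abs_W: "bernoulli_exp I p (\<lambda>A. \<bar>W A\<bar>) \<le> 1"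
proof -
  have "bernoulli_exp I p (\<lambda>A. \<bar>W A\<bar>) \<le> bernoulli_exp I p (\<lambda>A. 1 / 2 + 1 / 2 * (W A)\<^sup>2)"
  proof (rule bernoulli_exp_mono[OF p])
    fix A
    have "\<bar>y\<bar> \<le> 1 / 2 + 1 / 2 * y\<^sup>2" for y :: real
      using zero_le_power2[of "\<bar>y\<bar> - 1"] by (simp add: power2_diff)
    then show "\<bar>W A\<bar> \<le> 1 / 2 + 1 / 2 * (W A)\<^sup>2" .
  qed
  also have "\<dots> = 1 / 2 + 1 / 2 * 1"
    by (simp only: bernoulli_exp_add bernoulli_exp_cmult bernoulli_exp_const[OF fin] bernoulli_exp_W_sq)
  finally show ?thesis by simp
qed

text \<open>For a solution \<open>f\<close> of Stein's equation the bound \<open>smooth\<close> follows from the equation and bounds on \<open>f\<close>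
  and \<open>f'\<close>, so that no second derivative is needed.\<close>

lemma stein_single:
  assumes i: "i \<in> I" and der: "\<And>w. (f has_real_derivative f' w) (at w)"
    and smooth: "\<And>u v. \<bar>f' u - f' v\<bar> \<le> \<bar>u - v\<bar> * (K + M * \<bar>v\<bar>)" and KM: "K \<ge> 0" "M \<ge> 0"
  shows "\<bar>bernoulli_exp I p (\<lambda>A. (of_bool (i \<in> A) - p i) * a i * f (W A) - (a i)\<^sup>2 * (p i * (1 - p i)) * f' (W A))\<bar>
       \<le> (a i)^3 * (p i * (1 - p i)) * (K + M)"
proof -
  define J where "J = I - {i}"
  have J: "finite J" "i \<notin> J" "I = insert i J" using i fin by (auto simp: J_def)
  define V where "V A = sum a A - (\<Sum>i\<in>J. a i * p i)" for A
  define q al where "q = p i" and "al = a i"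
  have q: "0 \<le> q" "q \<le> 1" "0 \<le> al" using p[OF i] a[OF i] by (auto simp: q_def al_def)
  have mean_J: "mean = a i * p i + (\<Sum>i\<in>J. a i * p i)"
    using fin i unfolding mean_def J_def by (simp add: sum.remove)
  have W1: "W (insert i A) = V A + al * (1 - q)" if "A \<subseteq> J" for A
  proof -
    have "sum a (insert i A) = a i + sum a A" using that J by (meson finite_subset sum.insert subsetD)
    then show ?thesis unfolding mean_J by (simp add: V_def q_def al_def algebra_simps)
  qed
  have W2: "W A = V A - al * q" if "A \<subseteq> J" for A
    unfolding mean_J by (simp add: V_def q_def al_def algebra_simps)
  \<comment> \<open>\<open>D v\<close> and \<open>R v\<close> are averages over whether
    \<open>i\<close> belongs to \<open>A\<close>, while the other indices give
    \<open>V A = v\<close>: \<open>D\<close> averages the expression in the claim, \<open>R\<close>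
    the quantity \<open>K + M * |W|\<close>.\<close>
  define D where "D v = q * (1 - q) * al * (f (v + al * (1 - q)) - f (v - al * q))
      - al\<^sup>2 * (q * (1 - q)) * (q * f' (v + al * (1 - q)) + (1 - q) * f' (v - al * q))" for v
  define R where "R v = q * (K + M * \<bar>v + al * (1 - q)\<bar>) + (1 - q) * (K + M * \<bar>v - al * q\<bar>)" for v
  have D: "\<bar>D v\<bar> \<le> al^3 * (q * (1 - q)) * R v" for v
  proof (cases "al = 0")
    case False
    define s t where "s = v + al * (1 - q)" and "t = v - al * q"
    have st: "s - t = al" "t < s" using False q by (auto simp: s_def t_def algebra_simps)
    \<comment> \<open>The difference of \<open>f\<close> between the two possible values
      \<open>s\<close> and \<open>t\<close> of \<open>W\<close> is \<open>al * f' \<xi>\<close>,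
      with \<open>\<xi>\<close> within \<open>al\<close> of both. As \<open>smooth\<close> is
      weighted by its second argument only, it is applied with \<open>s\<close> and \<open>t\<close>
      there; the weights are then values of \<open>W\<close> and average back to
      \<open>K + M * |W|\<close>.\<close>
    obtain \<xi> where \<xi>: "t < \<xi>" "\<xi> < s" "f s - f t = (s - t) * f' \<xi>"
      using MVT2[OF st(2), of f f'] der by auto
    have "D v = al\<^sup>2 * (q * (1 - q)) * (q * (f' \<xi> - f' s) + (1 - q) * (f' \<xi> - f' t))"
      unfolding D_def s_def[symmetric] t_def[symmetric] \<xi>(3) st(1)
      by (simp add: algebra_simps power2_eq_square)
    moreover have "\<bar>q * (f' \<xi> - f' s) + (1 - q) * (f' \<xi> - f' t)\<bar> \<le> al * R v"
    proof -
      have "\<bar>f' \<xi> - f' s\<bar> \<le> al * (K + M * \<bar>s\<bar>)"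
        using smooth[of \<xi> s] \<xi> st KM
        by (elim order_trans) (intro mult_right_mono, auto)
      moreover have "\<bar>f' \<xi> - f' t\<bar> \<le> al * (K + M * \<bar>t\<bar>)"
        using smooth[of \<xi> t] \<xi> st KM
        by (elim order_trans) (intro mult_right_mono, auto)
      ultimately have "q * \<bar>f' \<xi> - f' s\<bar> + (1 - q) * \<bar>f' \<xi> - f' t\<bar> \<le> 
          q * (al * (K + M * \<bar>s\<bar>)) + (1 - q) * (al * (K + M * \<bar>t\<bar>))"
        using q by (intro add_mono mult_left_mono) auto
      also have "\<dots> = al * R v" by (simp add: R_def s_def t_def algebra_simps)
      finally show ?thesis using q abs_triangle_ineq[of "q * (f' \<xi> - f' s)" "(1 - q) * (f' \<xi> - f' t)"]
        by (simp add: abs_mult)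
    qed
    then have "al\<^sup>2 * (q * (1 - q)) * \<bar>q * (f' \<xi> - f' s) + (1 - q) * (f' \<xi> - f' t)\<bar> \<le> al\<^sup>2 * (q * (1 - q)) * (al * R v)"
      using q by (intro mult_left_mono) auto
    ultimately show ?thesis using q by (simp add: abs_mult power3_eq_cube power2_eq_square mult_ac)
  qed (simp add: D_def)
  have "bernoulli_exp I p (\<lambda>A. (of_bool (i \<in> A) - p i) * a i * f (W A) - (a i)\<^sup>2 * (p i * (1 - p i)) * f' (W A))
      = q * bernoulli_exp J p (\<lambda>A. (1 - q) * al * f (V A + al * (1 - q)) - al\<^sup>2 * (q * (1 - q)) * f' (V A + al * (1 - q)))
      + (1 - q) * bernoulli_exp J p (\<lambda>A. (0 - q) * al * f (V A - al * q) - al\<^sup>2 * (q * (1 - q)) * f' (V A - al * q))"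
  proof -
    have "bernoulli_exp J p (\<lambda>A. (of_bool (i \<in> A) - p i) * a i * f (W A) - (a i)\<^sup>2 * (p i * (1 - p i)) * f' (W A))
       = bernoulli_exp J p (\<lambda>A. (0 - q) * al * f (V A - al * q) - al\<^sup>2 * (q * (1 - q)) * f' (V A - al * q))"
    proof (rule bernoulli_exp_cong)
      fix A assume "A \<subseteq> J"
      with J(2) have "of_bool (i \<in> A) = (0::real)" by auto
      with W2[OF \<open>A \<subseteq> J\<close>] show "(of_bool (i \<in> A) - p i) * a i * f (W A) - (a i)\<^sup>2 * (p i * (1 - p i)) * f' (W A)
        = (0 - q) * al * f (V A - al * q) - al\<^sup>2 * (q * (1 - q)) * f' (V A - al * q)"
        by (simp only: q_def al_def)
    qed
    moreover have "bernoulli_exp J p (\<lambda>A. (of_bool (i \<in> insert i A) - p i) * a i * f (W (insert i A)) - (a i)\<^sup>2 * (p i * (1 - p i)) * f' (W (insert i A)))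
       = bernoulli_exp J p (\<lambda>A. (1 - q) * al * f (V A + al * (1 - q)) - al\<^sup>2 * (q * (1 - q)) * f' (V A + al * (1 - q)))"
      by (intro bernoulli_exp_cong) (auto simp: W1 q_def al_def)
    ultimately show ?thesis
      by (subst (1) J(3), subst bernoulli_exp_insert[OF J(1,2)]) (simp add: q_def)
  qed
  also have "\<dots> = bernoulli_exp J p (\<lambda>A. D (V A))"
    unfolding bernoulli_exp_cmult[symmetric] bernoulli_exp_add[symmetric]
    by (intro bernoulli_exp_cong) (simp add: D_def algebra_simps)
  finally have eq: "bernoulli_exp I p (\<lambda>A. (of_bool (i \<in> A) - p i) * a i * f (W A) - (a i)\<^sup>2 * (p i * (1 - p i)) * f' (W A))
      = bernoulli_exp J p (\<lambda>A. D (V A))" .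
  have "\<bar>bernoulli_exp J p (\<lambda>A. D (V A))\<bar> \<le> bernoulli_exp J p (\<lambda>A. al^3 * (q * (1 - q)) * R (V A))"
    using p D by (intro bernoulli_exp_abs_le) (auto simp: J_def)
  also have "\<dots> = al^3 * (q * (1 - q)) * bernoulli_exp J p (\<lambda>A. R (V A))" by (rule bernoulli_exp_cmult)
  also have "bernoulli_exp J p (\<lambda>A. R (V A)) = bernoulli_exp I p (\<lambda>A. K + M * \<bar>W A\<bar>)"
  proof -
    have "bernoulli_exp I p (\<lambda>A. K + M * \<bar>W A\<bar>) = q * bernoulli_exp J p (\<lambda>A. K + M * \<bar>W (insert i A)\<bar>) + (1 - q) * bernoulli_exp J p (\<lambda>A. K + M * \<bar>W A\<bar>)"
      by (subst (1) J(3), subst bernoulli_exp_insert[OF J(1,2)]) (simp add: q_def)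
    also have "\<dots> = bernoulli_exp J p (\<lambda>A. R (V A))"
      unfolding bernoulli_exp_cmult[symmetric] bernoulli_exp_add[symmetric]
      by (intro bernoulli_exp_cong) (simp add: R_def W1 W2)
    finally show ?thesis by simp
  qed
  also have "\<dots> = K + M * bernoulli_exp I p (\<lambda>A. \<bar>W A\<bar>)"
    by (simp only: bernoulli_exp_add bernoulli_exp_cmult bernoulli_exp_const[OF fin])
  also have "al^3 * (q * (1 - q)) * (K + M * bernoulli_exp I p (\<lambda>A. \<bar>W A\<bar>)) \<le> al^3 * (q * (1 - q)) * (K + M * 1)"
    using q KM bernoulli_exp_abs_W by (intro mult_left_mono add_left_mono) auto
  finally show ?thesis unfolding eq by (simp add: q_def al_def)
qed

text \<open>Write \<open>W\<close> as the sum of \<open>(of_bool (i \<in> A) - p i) * a i\<close>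
  and the factor 1 of \<open>f'\<close> as the variance. Each index pairs one term of either sum as
  in \<open>stein_single\<close>, and the third powers sum to at most \<open>\<beta>\<close> times
  the variance.\<close>

lemma stein_bound:
  assumes der: "\<And>w. (f has_real_derivative f' w) (at w)"
    and smooth: "\<And>u v. \<bar>f' u - f' v\<bar> \<le> \<bar>u - v\<bar> * (K + M * \<bar>v\<bar>)" and KM: "K \<ge> 0" "M \<ge> 0"
  shows "\<bar>bernoulli_exp I p (\<lambda>A. W A * f (W A) - f' (W A))\<bar> \<le> \<beta> * (K + M)"
proof -
  have W: "W A = (\<Sum>i\<in>I. (of_bool (i \<in> A) - p i) * a i)" if "A \<subseteq> I" for A
  proof -
    have "sum a A = (\<Sum>i\<in>I. of_bool (i \<in> A) * a i)"
      using that fin by (intro sum.mono_neutral_cong_left) auto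
    then show ?thesis by (simp add: mean_def left_diff_distrib right_diff_distrib sum_subtractf mult.commute)
  qed
  have "bernoulli_exp I p (\<lambda>A. W A * f (W A) - f' (W A)) = bernoulli_exp I p (\<lambda>A. \<Sum>i\<in>I. (of_bool (i \<in> A) - p i) * a i * f (W A) - (a i)\<^sup>2 * (p i * (1 - p i)) * f' (W A))"
  proof (rule bernoulli_exp_cong)
    fix A assume "A \<subseteq> I"
    then show "W A * f (W A) - f' (W A) = (\<Sum>i\<in>I. (of_bool (i \<in> A) - p i) * a i * f (W A) - (a i)\<^sup>2 * (p i * (1 - p i)) * f' (W A))"
      by (simp only: sum_subtractf sum_distrib_right[symmetric] W[symmetric] var mult_1)
  qed
  also have "\<dots> = (\<Sum>i\<in>I. bernoulli_exp I p (\<lambda>A. (of_bool (i \<in> A) - p i) * a i * f (W A) - (a i)\<^sup>2 * (p i * (1 - p i)) * f' (W A)))"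
    by (rule bernoulli_exp_sum)
  finally have "\<bar>bernoulli_exp I p (\<lambda>A. W A * f (W A) - f' (W A))\<bar>
      = \<bar>\<Sum>i\<in>I. bernoulli_exp I p (\<lambda>A. (of_bool (i \<in> A) - p i) * a i * f (W A) - (a i)\<^sup>2 * (p i * (1 - p i)) * f' (W A))\<bar>"
    by (rule arg_cong)
  also have "\<dots> \<le> (\<Sum>i\<in>I. (a i)^3 * (p i * (1 - p i)) * (K + M))"
    by (rule order_trans[OF sum_abs]) (intro sum_mono stein_single[OF _ assms])
  also have "\<dots> \<le> (\<Sum>i\<in>I. \<beta> * ((a i)\<^sup>2 * (p i * (1 - p i))) * (K + M))"
  proof (intro sum_mono mult_right_mono)
    fix i assume i: "i \<in> I"
    have "a i * ((a i)\<^sup>2 * (p i * (1 - p i))) \<le> \<beta> * ((a i)\<^sup>2 * (p i * (1 - p i)))"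
      using a[OF i] p[OF i] by (intro mult_right_mono) auto
    then show "(a i)^3 * (p i * (1 - p i)) \<le> \<beta> * ((a i)\<^sup>2 * (p i * (1 - p i)))"
      by (simp add: power3_eq_cube power2_eq_square mult_ac)
  qed (use KM in auto)
  also have "\<dots> = \<beta> * (K + M)"
    by (simp only: sum_distrib_right[symmetric] sum_distrib_left[symmetric] var mult_1_right)
  finally show ?thesis .
qed

text \<open>The constant is \<open>K + M\<close> with \<open>K = 3 + c\<close> and
  \<open>M = 2\<close>. Stein's equation bounds \<open>f'\<close> by 2, so \<open>f\<close> has
  Lipschitz constant 2; the difference of the equation at two points then involves only this, the
  bound 3 on \<open>f\<close> and the constant \<open>c\<close> of \<open>h\<close>.\<close>

lemma bernoulli_exp_lipschitz:
  assumes h_cont: "continuous_on UNIV h" and h_01: "\<And>x. 0 \<le> h x" "\<And>x. h x \<le> 1"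
    and lip: "\<And>x y. \<bar>h x - h y\<bar> \<le> c * \<bar>x - y\<bar>" and "0 \<le> c"
  shows "\<bar>bernoulli_exp I p (\<lambda>A. h (W A)) - normal_mean h\<bar> \<le> \<beta> * (5 + c)"
proof -
  define f where "f = stein_sol h"
  define f' where "f' w = w * f w + h w - normal_mean h" for w
  have der: "(f has_real_derivative f' w) (at w)" for w
    unfolding f_def f'_def using stein_sol_deriv[OF h_cont h_01] by auto
  have f'b: "\<bar>f' w\<bar> \<le> 2" for w
    using stein_sol_mult_bound[OF h_cont h_01, of w] abs_centred_le_1[OF h_cont h_01, of w] 
    unfolding f'_def f_def by linarith
  have fl: "\<bar>f u - f v\<bar> \<le> 2 * \<bar>u - v\<bar>" for u v
    using field_differentiable_bound[of UNIV f f' 2 u v] der f'b by auto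
  have smooth: "\<bar>f' u - f' v\<bar> \<le> \<bar>u - v\<bar> * ((3 + c) + 2 * \<bar>v\<bar>)" for u v
  proof -
    have "f' u - f' v = (u - v) * f u + v * (f u - f v) + (h u - h v)"
      by (simp add: f'_def algebra_simps)
    also have "\<bar>\<dots>\<bar> \<le> \<bar>u - v\<bar> * \<bar>f u\<bar> + \<bar>v\<bar> * \<bar>f u - f v\<bar> + \<bar>h u - h v\<bar>"
      unfolding abs_mult[symmetric] by linarith
    also have "\<dots> \<le> \<bar>u - v\<bar> * 3 + \<bar>v\<bar> * (2 * \<bar>u - v\<bar>) + c * \<bar>u - v\<bar>"
      using stein_sol_bound[OF h_cont h_01] fl lip unfolding f_def
      by (intro add_mono mult_left_mono) auto
    finally show ?thesis by (simp add: algebra_simps)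
  qed
  have "bernoulli_exp I p (\<lambda>A. W A * f (W A) - f' (W A)) = bernoulli_exp I p (\<lambda>A. normal_mean h - h (W A))"
    by (intro bernoulli_exp_cong) (simp add: f'_def)
  also have "\<dots> = normal_mean h - bernoulli_exp I p (\<lambda>A. h (W A))"
    by (simp add: bernoulli_exp_diff bernoulli_exp_const[OF fin])
  finally show ?thesis
    using stein_bound[OF der smooth] \<open>0 \<le> c\<close> by (simp add: abs_minus_commute algebra_simps)
qed

text \<open>For \<open>\<beta> \<le> 1\<close> the ramps of slope \<open>1 / e\<close> cost
  \<open>5 * \<beta> + e \<le> 6 * e\<close>, and their normal mean differs from \<open>phi\<close>
  by at most one more \<open>e\<close>. The lower bound uses the ramp ending at \<open>x\<close>
  rather than starting there. For \<open>\<beta> > 1\<close> the claim is trivial.\<close>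

theorem bernoulli_exp_normal_approx:
  assumes "\<beta> > 0"
  shows "\<bar>bernoulli_exp I p (\<lambda>A. of_bool (W A \<le> x)) - phi x\<bar> \<le> 7 * sqrt \<beta>"
proof (cases "\<beta> \<le> 1")
  case True
  define e where "e = sqrt \<beta>"
  have e: "e > 0" "e * e = \<beta>" "e \<le> 1" "\<beta> \<le> e"
  proof -
    show "e > 0" "e * e = \<beta>" "e \<le> 1" using assms True by (auto simp: e_def)
    then show "\<beta> \<le> e" by (metis less_eq_real_def mult_left_le)
  qed
  have L: "\<bar>bernoulli_exp I p (\<lambda>A. ramp y e (W A)) - normal_mean (ramp y e)\<bar> \<le> 6 * e" for y
  proof -
    have "\<bar>bernoulli_exp I p (\<lambda>A. ramp y e (W A)) - normal_mean (ramp y e)\<bar> \<le> \<beta> * (5 + 1 / e)"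
      using e by (intro bernoulli_exp_lipschitz ramp_props) auto
    also have "\<beta> * (5 + 1 / e) = 5 * \<beta> + e" using e by (simp add: field_simps)
    finally show ?thesis using e by linarith
  qed
  have "bernoulli_exp I p (\<lambda>A. of_bool (W A \<le> x)) \<le> bernoulli_exp I p (\<lambda>A. ramp x e (W A))"
    using e by (intro bernoulli_exp_mono[OF p] ramp_props) auto
  also have "\<dots> \<le> phi x + e + 6 * e" using L[of x] normal_mean_ramp(2)[OF e(1), of x] by linarith
  finally have 1: "bernoulli_exp I p (\<lambda>A. of_bool (W A \<le> x)) - phi x \<le> 7 * e" by simp
  have "bernoulli_exp I p (\<lambda>A. of_bool (W A \<le> x)) \<ge> bernoulli_exp I p (\<lambda>A. ramp (x - e) e (W A))"
    using e ramp_props(6)[OF e(1), of "x - e"] by (intro bernoulli_exp_mono[OF p]) auto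
  moreover have "bernoulli_exp I p (\<lambda>A. ramp (x - e) e (W A)) \<ge> phi (x - e) - 6 * e"
    using L[of "x - e"] normal_mean_ramp(1)[OF e(1), of "x - e"] by linarith
  moreover have "phi (x - e) \<ge> phi x - e" using phi_diff(2)[of "x - e" x] e by simp
  ultimately show ?thesis using 1 unfolding e_def by linarith
next
  case False
  then have "1 \<le> sqrt \<beta>" by simp
  have "bernoulli_exp I p (\<lambda>A. 0) \<le> bernoulli_exp I p (\<lambda>A. of_bool (W A \<le> x))"
    "bernoulli_exp I p (\<lambda>A. of_bool (W A \<le> x)) \<le> bernoulli_exp I p (\<lambda>A. 1)"
    by (intro bernoulli_exp_mono p; simp)+
  then have "0 \<le> bernoulli_exp I p (\<lambda>A. of_bool (W A \<le> x))" "bernoulli_exp I p (\<lambda>A. of_bool (W A \<le> x)) \<le> 1"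
    by (simp_all only: bernoulli_exp_const[OF fin])
  with \<open>1 \<le> sqrt \<beta>\<close> show ?thesis using phi_0_1[of x] by linarith
qed

end

section \<open>Normal approximation of the order\<close>

text \<open>By \<open>feller_exp_snd_step\<close> and \<open>bernoulli_exp_insert\<close> both sides
  satisfy the same recursion. The function \<open>G\<close> is arbitrary so that the summand
  \<open>ln (Suc m)\<close> can be moved into it.\<close>

lemma feller_exp_log_pos:
  "feller_exp m (\<lambda>M. G (log_pos M)) = bernoulli_exp {1..m} (\<lambda>i. 1 / real i) (\<lambda>A. G (\<Sum>i\<in>A. ln (real i)))"
proof (induction m arbitrary: G)
  case 0 then show ?case by (simp add: log_pos_def)
next
  case (Suc m)
  have lp: "log_pos M = (\<Sum>x\<leftarrow>map snd M. ln (real x))" for M :: "(nat \<times> nat) list"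
    by (simp add: log_pos_def o_def)
  have "feller_exp (Suc m) (\<lambda>M. G (log_pos M)) = 1 / real (Suc m) * feller_exp m (\<lambda>M. G (ln (real (Suc m)) + log_pos M)) +
     (1 - 1 / real (Suc m)) * feller_exp m (\<lambda>M. G (log_pos M))"
    unfolding lp by (subst feller_exp_snd_step[of m "\<lambda>xs. G (\<Sum>x\<leftarrow>xs. ln (real x))"]) simp
  also have "feller_exp m (\<lambda>M. G (ln (real (Suc m)) + log_pos M)) = 
     bernoulli_exp {1..m} (\<lambda>i. 1 / real i) (\<lambda>A. G (ln (real (Suc m)) + (\<Sum>i\<in>A. ln (real i))))"
    by (rule Suc.IH)
  also have "\<dots> = bernoulli_exp {1..m} (\<lambda>i. 1 / real i) (\<lambda>A. G (\<Sum>i\<in>insert (Suc m) A. ln (real i)))"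
  proof (rule bernoulli_exp_cong)
    fix A assume "A \<subseteq> {1..m}"
    then have "finite A" "Suc m \<notin> A" by (auto intro: finite_subset)
    then show "G (ln (real (Suc m)) + (\<Sum>i\<in>A. ln (real i))) = G (\<Sum>i\<in>insert (Suc m) A. ln (real i))"
      by simp
  qed
  also have "feller_exp m (\<lambda>M. G (log_pos M)) = bernoulli_exp {1..m} (\<lambda>i. 1 / real i) (\<lambda>A. G (\<Sum>i\<in>A. ln (real i)))"
    by (rule Suc.IH)
  finally show ?case
    using bernoulli_exp_insert[of "{1..m}" "Suc m" "\<lambda>i. 1 / real i" "\<lambda>A. G (\<Sum>i\<in>A. ln (real i))"]
    by (simp add: atLeastAtMostSuc_conv)
qed

section \<open>Mean and variance of the sum of the logarithms of the positions\<close>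

lemma ln_Suc_diff:
  assumes "m \<ge> 1"
  defines "d \<equiv> ln (real (Suc m)) - ln (real m)"
  shows "1 / real (Suc m) \<le> d" "d \<le> 1 / real m" "d \<le> 1" "0 \<le> d"
    "d * (1 - 1 / real (Suc m)) \<le> 1 / real (Suc m)"
proof -
  have m: "real m \<ge> 1" using assms by simp
  show 2: "d \<le> 1 / real m" using ln_diff_le[of "real (Suc m)" "real m"] m by (simp add: d_def)
  show 1: "1 / real (Suc m) \<le> d" using ln_diff_le[of "real m" "real (Suc m)"] m
    by (simp add: d_def field_simps)
  show "d \<le> 1" using 2 m by (elim order_trans) simp
  show "0 \<le> d" using 1 by (elim order_trans[rotated]) simp
  have "d * (1 - 1 / real (Suc m)) \<le> (1 / real m) * (1 - 1 / real (Suc m))"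
    using 2 by (intro mult_right_mono) auto
  also have "\<dots> = 1 / real (Suc m)" using m by (simp add: field_simps)
  finally show "d * (1 - 1 / real (Suc m)) \<le> 1 / real (Suc m)" .
qed

lemma harm_le_ln:
  assumes "m \<ge> 1" shows "harm m \<le> ln (real m) + 1"
  using assms
proof (induction m rule: nat_induct_at_least)
  case (Suc m)
  then show ?case using ln_Suc_diff(1)[of m] by (simp add: harm_Suc inverse_eq_divide)
qed (simp add: harm_def)

lemma ln_Suc_le: "ln (real (Suc m)) \<le> real (Suc m)"
  using ln_bound[of "real (Suc m)"] by simp

lemma sum_ln_over:
  assumes "m \<ge> 1"
  shows "\<bar>(\<Sum>i=1..m. ln (real i) * (1 / real i)) - (ln (real m))\<^sup>2 / 2\<bar> \<le> ln (real m)"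
proof -
  define S where "S m = (\<Sum>i=1..m. ln (real i) * (1 / real i))" for m
  \<comment> \<open>The two corrections are chosen so that the bounds are inductive: with
    \<open>d = ln (m + 1) - ln m\<close> the upper one needs only \<open>d * d \<le> d\<close>, the
    lower one \<open>ln (m + 1) / (m + 1) \<le> 1\<close> and
    \<open>d * (1 - 1 / (m + 1)) \<le> 1 / (m + 1)\<close>.\<close>
  have "S m \<le> (ln (real m))\<^sup>2 / 2 + ln (real m) / 2 \<and> (ln (real m))\<^sup>2 / 2 - ln (real m) \<le> S m"
    using assms
  proof (induction m rule: nat_induct_at_least)
    case base then show ?case by (simp add: S_def)
  next
    case (Suc m)
    define a b d where "a = ln (real m)" and "b = ln (real (Suc m))" and "d = b - a"
    have d: "1 / real (Suc m) \<le> d" "d \<le> 1" "0 \<le> d" "d * (1 - 1 / real (Suc m)) \<le> 1 / real (Suc m)"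
      using ln_Suc_diff[OF Suc.hyps] unfolding d_def a_def b_def by auto
    have b: "0 \<le> b" "b * (1 / real (Suc m)) \<le> 1"
      using ln_Suc_le[of m] by (simp_all add: b_def)
    have bd: "b = a + d" by (simp add: d_def)
    have S: "S (Suc m) = S m + b * (1 / real (Suc m))" by (simp add: S_def b_def)
    have "b * (1 / real (Suc m)) \<le> b * d" using d b by (intro mult_left_mono) auto
    also have "b * d \<le> (b\<^sup>2 / 2 + b / 2) - (a\<^sup>2 / 2 + a / 2)"
    proof -
      have "d * d \<le> d" using d by (simp add: mult_left_le)
      then show ?thesis unfolding bd by (simp add: power2_eq_square field_simps)
    qed
    finally have up: "b * (1 / real (Suc m)) \<le> (b\<^sup>2 / 2 + b / 2) - (a\<^sup>2 / 2 + a / 2)" .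
    have "(b\<^sup>2 / 2 - b) - (a\<^sup>2 / 2 - a) \<le> b * d - d" unfolding bd by (simp add: power2_eq_square field_simps)
    also have "\<dots> \<le> b * d - d * (b * (1 / real (Suc m)))"
      using mult_left_mono[OF b(2) d(3)] by simp
    also have "\<dots> = b * (d * (1 - 1 / real (Suc m)))" by (simp add: algebra_simps)
    also have "\<dots> \<le> b * (1 / real (Suc m))" using d b by (intro mult_left_mono) auto
    finally show ?case using up Suc.IH unfolding S a_def[symmetric] b_def[symmetric] by linarith
  qed
  then show ?thesis using assms unfolding S_def[symmetric] by (auto simp: abs_le_iff)
qed

lemma sum_ln_sq_over:
  assumes "m \<ge> 1"
  shows "\<bar>(\<Sum>i=1..m. (ln (real i))\<^sup>2 * (1 / real i * (1 - 1 / real i))) - (ln (real m))^3 / 3\<bar> \<le> 2 * (ln (real m))\<^sup>2"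
proof -
  define S where "S m = (\<Sum>i=1..m. (ln (real i))\<^sup>2 * (1 / real i * (1 - 1 / real i)))" for m
  \<comment> \<open>As in \<open>sum_ln_over\<close>. The factor 2 in the lower correction pays for
    two factors \<open>1 - q\<close>, one from the variance of a trial and one from bounding
    \<open>q\<close> below by \<open>d * (1 - q)\<close>.\<close>
  have "S m \<le> (ln (real m))^3 / 3 + (ln (real m))\<^sup>2 \<and> (ln (real m))^3 / 3 - 2 * (ln (real m))\<^sup>2 \<le> S m"
    using assms
  proof (induction m rule: nat_induct_at_least)
    case base then show ?case by (simp add: S_def)
  next
    case (Suc m)
    define a b d q where "a = ln (real m)" and "b = ln (real (Suc m))" and "d = b - a" and "q = 1 / real (Suc m)"
    have d: "q \<le> d" "d \<le> 1" "0 \<le> d" "d * (1 - q) \<le> q"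
      using ln_Suc_diff[OF Suc.hyps] unfolding d_def a_def b_def q_def by auto
    have q: "0 \<le> q" "q \<le> 1" by (auto simp: q_def)
    have b: "0 \<le> b" "b * q \<le> 1"
      using ln_Suc_le[of m] by (simp_all add: b_def q_def)
    have a: "0 \<le> a" using Suc.hyps by (simp add: a_def)
    have bd: "b = a + d" by (simp add: d_def)
    have S: "S (Suc m) = S m + b\<^sup>2 * (q * (1 - q))" by (simp add: S_def b_def q_def)
    have "b\<^sup>2 * (q * (1 - q)) \<le> b\<^sup>2 * (d * 1)" using d b q by (intro mult_left_mono mult_mono) auto
    also have "\<dots> \<le> (b^3 / 3 + b\<^sup>2) - (a^3 / 3 + a\<^sup>2)"
    proof -
      have "a * (d * d) \<le> a * d" "d * (d * d) \<le> d * d" using a d by (auto intro!: mult_left_mono mult_left_le)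
      moreover have "0 \<le> d * d" "0 \<le> a * d" "0 \<le> d * (d * d)" using a d by auto
      moreover have "(b^3 / 3 + b\<^sup>2) - (a^3 / 3 + a\<^sup>2) - b\<^sup>2 * (d * 1) = 2 * (a * d) + d * d - a * (d * d) - 2 / 3 * (d * (d * d))"
        unfolding bd by (simp add: power2_eq_square power3_eq_cube field_simps)
      ultimately show ?thesis by linarith
    qed
    finally have up: "b\<^sup>2 * (q * (1 - q)) \<le> (b^3 / 3 + b\<^sup>2) - (a^3 / 3 + a\<^sup>2)" .
    have "(b^3 / 3 - 2 * b\<^sup>2) - (a^3 / 3 - 2 * a\<^sup>2) \<le> b\<^sup>2 * d - 2 * (b * d)"
    proof -
      have "0 \<le> a * d" "0 \<le> a * (d * d)" "0 \<le> d * (d * d)" using a d by auto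
      moreover have "b\<^sup>2 * d - 2 * (b * d) - ((b^3 / 3 - 2 * b\<^sup>2) - (a^3 / 3 - 2 * a\<^sup>2)) = 2 * (a * d) + a * (d * d) + 2 / 3 * (d * (d * d))"
        unfolding bd by (simp add: power2_eq_square power3_eq_cube field_simps)
      ultimately show ?thesis by linarith
    qed
    also have "\<dots> \<le> b\<^sup>2 * d - 2 * (b * d) * (b * q)"
      using mult_left_mono[OF b(2), of "2 * (b * d)"] b d by simp
    also have "\<dots> \<le> b\<^sup>2 * (d * (1 - q) * (1 - q))"
    proof -
      have "b\<^sup>2 * (d * (1 - q) * (1 - q)) = b\<^sup>2 * d - 2 * (b * d) * (b * q) + b\<^sup>2 * d * q\<^sup>2"
        by (simp add: power2_eq_square algebra_simps)
      then show ?thesis using d by simp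
    qed
    also have "\<dots> \<le> b\<^sup>2 * (q * (1 - q))" using d q by (intro mult_left_mono mult_right_mono) auto
    finally show ?case using up Suc.IH unfolding S a_def[symmetric] b_def[symmetric] by linarith
  qed
  then show ?thesis unfolding S_def[symmetric] by (auto simp: abs_le_iff)
qed


text \<open>From here on \<open>D\<close> is the fourth root of \<open>ln (sqrt (n / (k - 1)))\<close>, which makes all error terms
  polynomials in \<open>D\<close>. The inequalities in \<open>good_scale\<close> bound the contributions of large and small prime
  powers to \<open>bad_mass\<close> below; they hold for large \<open>D\<close> since \<open>4 < 9 / 2 < 5\<close>.\<close>

definition split_point :: "real \<Rightarrow> nat" where
  "split_point D = nat \<lceil>D powr (9 / 2)\<rceil>"

definition good_scale :: "real \<Rightarrow> bool" where
  "good_scale D \<longleftrightarrow> D \<ge> 4 \<and>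
     2 * (2 * D^4)\<^sup>2 * ((ln (2 * D powr (9 / 2)) + 2) / D powr (9 / 2)) / D^5 \<le> 1 / D \<and>
     (ln (2 * D powr (9 / 2)) + 1) * ((ln (2 * D powr (9 / 2)))\<^sup>2 *
       (2 * (2 * D^4)\<^sup>2 * (ln (2 * D powr (9 / 2)) + 1) + 2 * D^4 * (2 * D powr (9 / 2)))) / D^10 \<le> 1 / D"

text \<open>This is \<open>sigma_n\<close> in terms of \<open>D\<close>, because
  \<open>log_sqrt\<close> is \<open>D^4\<close>; likewise \<open>mu_n\<close> is
  \<open>D^8 / 2\<close>.\<close>

definition target_sd :: "real \<Rightarrow> real" where
  "target_sd D = sqrt (D^12 / 3)"

lemma eventually_good_scale: "eventually good_scale at_top"
  unfolding good_scale_def[abs_def] by (intro eventually_conj; real_asymp)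

lemma split_point_bounds:
  assumes "D \<ge> 4"
  shows "split_point D \<ge> 1" "D powr (9 / 2) \<le> real (split_point D)" "real (split_point D) \<le> 2 * D powr (9 / 2)"
proof -
  have "1 \<le> D powr (9 / 2)" using assms by (intro ge_one_powr_ge_zero) auto
  then show "split_point D \<ge> 1" "D powr (9 / 2) \<le> real (split_point D)" "real (split_point D) \<le> 2 * D powr (9 / 2)"
    unfolding split_point_def by linarith+
qed

section \<open>Normal approximation for a fixed number of cyclic nodes\<close>

context
  fixes D :: real and m :: nat
  assumes D: "good_scale D" and m: "m \<ge> 1" and lm: "\<bar>ln (real m) - D^4\<bar> \<le> D"
begin

lemma scale_ge_4: "D \<ge> 4" using D by (simp add: good_scale_def)

lemma scale_cubed_ge: "64 \<le> D^3"
  using power_mono[OF scale_ge_4, of 3] by simp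

lemma scale_power_le: "64 * D^j \<le> D^(j + 3)"
  unfolding power_add using mult_right_mono[OF scale_cubed_ge, of "D^j"] scale_ge_4 by (simp add: mult.commute)

lemma scale_power_Suc_le: "4 * D^j \<le> D^Suc j"
  using mult_right_mono[OF scale_ge_4, of "D^j"] scale_ge_4 by simp

lemma ln_size_bounds: "0 \<le> ln (real m)" "ln (real m) + 1 \<le> 2 * D^4"
proof -
  have "64 * D \<le> D^4" using scale_power_le[of 1] by simp
  then show "0 \<le> ln (real m)" "ln (real m) + 1 \<le> 2 * D^4" using lm scale_ge_4 m by auto
qed

lemma harm_bound: "harm m \<le> 2 * D^4" "0 \<le> (harm m :: real)"
  using harm_le_ln[OF m] ln_size_bounds harm_nonneg[of m] by auto

definition log_mean :: real where "log_mean = (\<Sum>i=1..m. ln (real i) * (1 / real i))"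
definition log_var :: real where "log_var = (\<Sum>i=1..m. (ln (real i))\<^sup>2 * (1 / real i * (1 - 1 / real i)))"
definition log_sd :: real where "log_sd = sqrt log_var"

text \<open>The uncertainty \<open>D\<close> of \<open>ln m\<close> moves \<open>(ln m)^2\<close> by
  at most \<open>3 * D^5\<close>; the error of \<open>sum_ln_over\<close> is only of order
  \<open>D^4\<close>.\<close>

lemma log_mean_bound: "\<bar>log_mean - D^8 / 2\<bar> \<le> 3 * D^5"
proof -
  have "(ln (real m))\<^sup>2 - D^8 = (ln (real m) - D^4) * (ln (real m) + D^4)" by (simp add: power2_eq_square algebra_simps flip: power_add)
  then have "\<bar>(ln (real m))\<^sup>2 - D^8\<bar> = \<bar>ln (real m) - D^4\<bar> * (ln (real m) + D^4)" using ln_size_bounds scale_ge_4 by (simp add: abs_mult)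
  also have "\<dots> \<le> D * (3 * D^4)" using lm ln_size_bounds scale_ge_4 by (intro mult_mono) auto
  also have "\<dots> = 3 * D^5" by (simp add: eval_nat_numeral)
  finally have "\<bar>(ln (real m))\<^sup>2 - D^8\<bar> \<le> 3 * D^5" .
  moreover have "\<bar>log_mean - (ln (real m))\<^sup>2 / 2\<bar> \<le> ln (real m)" unfolding log_mean_def by (rule sum_ln_over[OF m])
  moreover have "4 * D^4 \<le> D^5" using scale_power_Suc_le[of 4] by simp
  ultimately show ?thesis using ln_size_bounds by linarith
qed

lemma log_var_bound: "\<bar>log_var - D^12 / 3\<bar> \<le> 5 * D^9"
proof -
  have "(ln (real m))^3 - D^12 = (ln (real m) - D^4) * ((ln (real m))\<^sup>2 + ln (real m) * D^4 + (D^4)\<^sup>2)" by (simp add: power2_eq_square power3_eq_cube algebra_simps flip: power_add)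
  moreover have "0 \<le> (ln (real m))\<^sup>2 + ln (real m) * D^4 + (D^4)\<^sup>2" using ln_size_bounds scale_ge_4 by simp
  ultimately have "\<bar>(ln (real m))^3 - D^12\<bar> = \<bar>ln (real m) - D^4\<bar> * ((ln (real m))\<^sup>2 + ln (real m) * D^4 + (D^4)\<^sup>2)" by (simp add: abs_mult)
  also have "\<dots> \<le> D * ((2 * D^4)\<^sup>2 + (2 * D^4) * D^4 + (D^4)\<^sup>2)"
    using lm ln_size_bounds scale_ge_4 by (intro mult_mono add_mono power_mono) auto
  also have "\<dots> = 7 * D^9" by (simp add: power2_eq_square algebra_simps flip: power_add power_Suc)
  finally have "\<bar>(ln (real m))^3 - D^12\<bar> \<le> 7 * D^9" .
  moreover have "\<bar>log_var - (ln (real m))^3 / 3\<bar> \<le> 2 * (ln (real m))\<^sup>2" unfolding log_var_def by (rule sum_ln_sq_over[OF m])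
  moreover have "(ln (real m))\<^sup>2 \<le> (2 * D^4)\<^sup>2" using ln_size_bounds by (intro power_mono) auto
  then have "(ln (real m))\<^sup>2 \<le> 4 * D^8" by (simp add: power_mult_distrib flip: power_mult)
  moreover have "4 * D^8 \<le> D^9" using scale_power_Suc_le[of 8] by simp
  ultimately show ?thesis by linarith
qed

text \<open>The difference of the standard deviations is the difference of the variances, at most
  \<open>5 * D^9\<close>, divided by their sum, which is at least \<open>D^6\<close>.\<close>

lemma log_sd_bounds: "D^6 / 2 \<le> log_sd" "log_sd > 0" "log_sd\<^sup>2 = log_var" "\<bar>target_sd D - log_sd\<bar> \<le> 5 * D^3"
proof -
  have *: "(D^6 / 2)\<^sup>2 = D^12 / 4" by (simp add: power_divide flip: power_mult)
  have "64 * D^9 \<le> D^12" using scale_power_le[of 9] by simp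
  moreover have "0 \<le> D^9" using scale_ge_4 by simp
  ultimately have V: "D^12 / 4 \<le> log_var" using log_var_bound by linarith
  show 1: "D^6 / 2 \<le> log_sd" unfolding log_sd_def by (rule real_le_rsqrt) (use V * in simp)
  have D6: "D^6 > 0" using scale_ge_4 by simp
  show "log_sd > 0" using 1 D6 by linarith
  have Vn: "log_var \<ge> 0" using V by (elim order_trans[rotated]) simp
  then show 2: "log_sd\<^sup>2 = log_var" by (simp add: log_sd_def)
  have "0 \<le> D^12" using scale_ge_4 by simp
  then have "(D^6 / 2)\<^sup>2 \<le> D^12 / 3" unfolding * by simp
  then have t: "D^6 / 2 \<le> target_sd D" unfolding target_sd_def by (rule real_le_rsqrt)
  have t2: "(target_sd D)\<^sup>2 = D^12 / 3" by (simp add: target_sd_def)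
  have "\<bar>target_sd D - log_sd\<bar> * (target_sd D + log_sd) = \<bar>(target_sd D)\<^sup>2 - log_sd\<^sup>2\<bar>"
  proof -
    have "0 \<le> target_sd D + log_sd" using t 1 D6 by linarith
    then have "\<bar>target_sd D - log_sd\<bar> * (target_sd D + log_sd) = \<bar>(target_sd D - log_sd) * (target_sd D + log_sd)\<bar>"
      by (simp add: abs_mult)
    then show ?thesis by (simp add: power2_eq_square algebra_simps)
  qed
  also have "\<dots> \<le> 5 * D^9" unfolding 2 t2 using log_var_bound by (simp add: abs_minus_commute)
  also have "\<dots> = 5 * D^3 * D^6" by (simp flip: power_add)
  finally have "\<bar>target_sd D - log_sd\<bar> * (target_sd D + log_sd) \<le> 5 * D^3 * D^6" .
  moreover have "\<bar>target_sd D - log_sd\<bar> * D^6 \<le> \<bar>target_sd D - log_sd\<bar> * (target_sd D + log_sd)"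
    using t 1 by (intro mult_left_mono) auto
  ultimately have "\<bar>target_sd D - log_sd\<bar> * D^6 \<le> 5 * D^3 * D^6" by linarith
  then show "\<bar>target_sd D - log_sd\<bar> \<le> 5 * D^3" using D6 by simp
qed

lemma feller_exp_log_pos_normal:
  "\<bar>feller_exp m (\<lambda>M. of_bool (log_pos M \<le> z)) - phi ((z - log_mean) / log_sd)\<bar> \<le> 14 / D"
proof -
  \<comment> \<open>A summand is at most \<open>2 * D^4\<close> and the standard deviation at least
    \<open>D^6 / 2\<close>. Then \<open>7 * sqrt \<beta> = 14 / D\<close>.\<close>
  define \<beta> where "\<beta> = 4 / D\<^sup>2"
  interpret B: bernoulli_sum "{1..m}" "\<lambda>i. 1 / real i" "\<lambda>i. ln (real i) / log_sd" \<beta>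
  proof
    fix i assume i: "i \<in> {1..m}"
    show "1 / real i \<in> {0..1}" using i by auto
    show "0 \<le> ln (real i) / log_sd" using i log_sd_bounds by simp
    have "ln (real i) / log_sd \<le> (2 * D^4) / (D^6 / 2)"
    proof (rule frac_le)
      have "ln (real i) \<le> ln (real m)" using i by simp
      then show "ln (real i) \<le> 2 * D^4" using ln_size_bounds by linarith
    qed (use log_sd_bounds scale_ge_4 in auto)
    also have "\<dots> = \<beta>" using scale_ge_4 by (simp add: \<beta>_def field_simps flip: power_add)
    finally show "ln (real i) / log_sd \<le> \<beta>" .
  next
    have "(\<Sum>i=1..m. (ln (real i) / log_sd)\<^sup>2 * (1 / real i * (1 - 1 / real i))) = log_var / log_sd\<^sup>2"
      unfolding log_var_def sum_divide_distrib by (simp add: power_divide mult.commute)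
    then show "(\<Sum>i=1..m. (ln (real i) / log_sd)\<^sup>2 * (1 / real i * (1 - 1 / real i))) = 1"
      using log_sd_bounds(2) by (simp flip: log_sd_bounds(3))
  qed simp
  have mean: "B.mean = log_mean / log_sd"
    unfolding B.mean_def log_mean_def sum_divide_distrib by (simp add: mult.commute)
  have "(\<Sum>i\<in>A. ln (real i) / log_sd) - B.mean \<le> (z - log_mean) / log_sd \<longleftrightarrow> (\<Sum>i\<in>A. ln (real i)) \<le> z" for A
    unfolding mean sum_divide_distrib[symmetric] diff_divide_distrib[symmetric]
    using log_sd_bounds(2) by (simp add: divide_le_cancel)
  then have "bernoulli_exp {1..m} (\<lambda>i. 1 / real i) (\<lambda>A. of_bool ((\<Sum>i\<in>A. ln (real i)) \<le> z)) =
    bernoulli_exp {1..m} (\<lambda>i. 1 / real i) (\<lambda>A. of_bool ((\<Sum>i\<in>A. ln (real i) / log_sd) - B.mean \<le> (z - log_mean) / log_sd))"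
    by simp
  then have "feller_exp m (\<lambda>M. of_bool (log_pos M \<le> z)) =
    bernoulli_exp {1..m} (\<lambda>i. 1 / real i) (\<lambda>A. of_bool ((\<Sum>i\<in>A. ln (real i) / log_sd) - B.mean \<le> (z - log_mean) / log_sd))"
    by (simp only: feller_exp_log_pos[where G = "\<lambda>y. of_bool (y \<le> z)"])
  moreover have "sqrt \<beta> = 2 / D" using scale_ge_4 by (simp add: \<beta>_def real_sqrt_divide)
  ultimately show ?thesis using B.bernoulli_exp_normal_approx[of "(z - log_mean) / log_sd"] scale_ge_4 by (simp add: \<beta>_def)
qed

text \<open>A nonnegative majorant of the indicator that the three errors together exceed
  \<open>3 * D^5\<close>. With it Markov's and Chebyshev's inequalities reduce to monotonicity of
  \<open>feller_exp\<close>.\<close>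

definition bad_mass :: "(nat \<times> nat) list \<Rightarrow> real" where
  "bad_mass M = 1 / D^5 * log_gap M + (1 / D^10 * (small_part (split_point D) M)\<^sup>2 + 1 / D^5 * large_part (split_point D) m M)"

lemma feller_exp_bad_mass: "feller_exp m bad_mass \<le> 6 / D"
proof -
  let ?y = "split_point D"
  define Y lam where "Y = D powr (9 / 2)" and "lam = ln (2 * Y)"
  note y = split_point_bounds[OF scale_ge_4, folded Y_def]
  note G = D[unfolded good_scale_def, folded Y_def, folded lam_def]
  have Y: "Y > 0" using scale_ge_4 by (simp add: Y_def)
  have lny: "ln (real ?y) \<le> lam" "0 \<le> ln (real ?y)"
  proof -
    have pos: "real ?y > 0" using y by simp
    show "ln (real ?y) \<le> lam" unfolding lam_def using y Y pos by (subst ln_le_cancel_iff) linarith+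
    show "0 \<le> ln (real ?y)" using y by (intro ln_ge_zero) simp
  qed
  have lam: "0 \<le> lam" using lny by linarith
  have hy: "harm ?y \<le> lam + 1" "0 \<le> (harm ?y :: real)" using harm_le_ln[OF y(1)] lny harm_nonneg by auto
  have "1 / D^5 * feller_exp m log_gap \<le> 1 / D^5 * (2 * (2 * D^4))"
    using feller_exp_log_gap[of m] harm_bound scale_ge_4 by (intro mult_left_mono) auto
  also have "\<dots> = 4 / D" using scale_ge_4 by (simp add: eval_nat_numeral)
  finally have 1: "1 / D^5 * feller_exp m log_gap \<le> 4 / D" .
  have "feller_exp m (large_part ?y m) \<le> 2 * (harm m)\<^sup>2 * ((ln (real ?y) + 2) / real ?y)"
    by (rule feller_exp_large_part[OF y(1)])
  also have "\<dots> \<le> 2 * (2 * D^4)\<^sup>2 * ((lam + 2) / Y)"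
    using harm_bound lny lam y Y scale_ge_4 by (intro mult_mono power_mono frac_le) auto
  finally have "1 / D^5 * feller_exp m (large_part ?y m) \<le> 1 / D^5 * (2 * (2 * D^4)\<^sup>2 * ((lam + 2) / Y))"
    using scale_ge_4 by (intro mult_left_mono) auto
  also have "\<dots> \<le> 1 / D" using G by (simp add: mult_ac)
  finally have 2: "1 / D^5 * feller_exp m (large_part ?y m) \<le> 1 / D" .
  have "feller_exp m (\<lambda>M. (small_part ?y M)\<^sup>2) \<le> harm ?y * ((ln (real ?y))\<^sup>2 * (2 * (harm m)\<^sup>2 * harm ?y + harm m * real ?y))"
    by (rule feller_exp_small_part_sq[OF y(1)])
  also have "\<dots> \<le> (lam + 1) * (lam\<^sup>2 * (2 * (2 * D^4)\<^sup>2 * (lam + 1) + 2 * D^4 * (2 * Y)))"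
    using harm_bound lny lam hy y Y scale_ge_4 by (intro mult_mono power_mono add_mono mult_nonneg_nonneg add_nonneg_nonneg) auto
  finally have "1 / D^10 * feller_exp m (\<lambda>M. (small_part ?y M)\<^sup>2) \<le> 
     1 / D^10 * ((lam + 1) * (lam\<^sup>2 * (2 * (2 * D^4)\<^sup>2 * (lam + 1) + 2 * D^4 * (2 * Y))))"
    using scale_ge_4 by (intro mult_left_mono) auto
  also have "\<dots> \<le> 1 / D" using G by (simp add: mult_ac)
  finally have 3: "1 / D^10 * feller_exp m (\<lambda>M. (small_part ?y M)\<^sup>2) \<le> 1 / D" .
  have "feller_exp m bad_mass = 1 / D^5 * feller_exp m log_gap + (1 / D^10 * feller_exp m (\<lambda>M. (small_part ?y M)\<^sup>2) + 1 / D^5 * feller_exp m (large_part ?y m))"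
    unfolding bad_mass_def[abs_def] by (simp only: feller_exp_add feller_exp_cmult)
  moreover have "4 / D + (1 / D + 1 / D) = 6 / D" by simp
  ultimately show ?thesis using 1 2 3 by linarith
qed

lemma bad_mass_ge:
  shows "0 \<le> bad_mass M"
    and "3 * D^5 < log_gap M + small_part (split_point D) M + large_part (split_point D) m M \<Longrightarrow> 1 \<le> bad_mass M"
proof -
  have nn: "0 \<le> log_gap M" "0 \<le> large_part (split_point D) m M" "0 \<le> (small_part (split_point D) M)\<^sup>2"
  proof -
    show "0 \<le> log_gap M" unfolding log_gap_def by (intro sum_list_nonneg) auto
    show "0 \<le> large_part (split_point D) m M" unfolding large_part_def
      by (intro sum_nonneg mult_nonneg_nonneg[OF mangoldt_nonneg] ndiv_fact2)
  qed simp
  have D5: "D^5 > 0" "D^10 = (D^5)\<^sup>2" using scale_ge_4 by (auto simp flip: power_mult)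
  then have D10: "D^10 > 0" by simp
  have parts: "0 \<le> 1 / D^5 * log_gap M" "0 \<le> 1 / D^10 * (small_part (split_point D) M)\<^sup>2"
    "0 \<le> 1 / D^5 * large_part (split_point D) m M"
    using nn D5(1) D10 by (auto intro!: mult_nonneg_nonneg simp del: power_eq_0_iff)
  then show "0 \<le> bad_mass M" unfolding bad_mass_def by linarith
  assume "3 * D^5 < log_gap M + small_part (split_point D) M + large_part (split_point D) m M"
  then consider "D^5 \<le> log_gap M" | "D^5 \<le> small_part (split_point D) M" | "D^5 \<le> large_part (split_point D) m M"
    by linarith
  then have "1 \<le> 1 / D^5 * log_gap M \<or> 1 \<le> 1 / D^10 * (small_part (split_point D) M)\<^sup>2 \<or> 1 \<le> 1 / D^5 * large_part (split_point D) m M"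
  proof cases
    case 2
    then have "(D^5)\<^sup>2 \<le> (small_part (split_point D) M)\<^sup>2" using D5 by (intro power_mono) auto
    then show ?thesis using D5(1) D10 by (simp add: D5(2)[symmetric])
  qed (use D5 in auto)
  then show "1 \<le> bad_mass M" using parts unfolding bad_mass_def by linarith
qed

lemma lcm_vs_pos:
  assumes "valid m M"
  shows "of_bool (ln (real (lens_lcm M)) \<le> t) \<le> of_bool (log_pos M \<le> t + 3 * D^5) + bad_mass M"
    "of_bool (log_pos M \<le> t - 3 * D^5) \<le> of_bool (ln (real (lens_lcm M)) \<le> t) + bad_mass M"
proof -
  have g: "\<bar>log_lens M - log_pos M\<bar> \<le> log_gap M" by (rule log_lens_pos_gap)
  have s: "log_lens M - ln (real (lens_lcm M)) \<le> small_part (split_point D) M + large_part (split_point D) m M"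
    by (rule log_lens_minus_lcm[OF assms])
  have le: "ln (real (lens_lcm M)) \<le> log_lens M" by (rule ln_lcm_le[OF assms])
  show "of_bool (ln (real (lens_lcm M)) \<le> t) \<le> of_bool (log_pos M \<le> t + 3 * D^5) + bad_mass M"
  proof (cases "ln (real (lens_lcm M)) \<le> t \<and> \<not> log_pos M \<le> t + 3 * D^5")
    case True
    then have "1 \<le> bad_mass M" using g s by (intro bad_mass_ge(2)) linarith
    then show ?thesis by simp
  qed (use bad_mass_ge(1)[of M] in auto)
  show "of_bool (log_pos M \<le> t - 3 * D^5) \<le> of_bool (ln (real (lens_lcm M)) \<le> t) + bad_mass M"
  proof (cases "log_pos M \<le> t - 3 * D^5 \<and> \<not> ln (real (lens_lcm M)) \<le> t")
    case True
    then have "1 \<le> bad_mass M" using g s le by (intro bad_mass_ge(2)) linarith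
    then show ?thesis by simp
  qed (use bad_mass_ge(1)[of M] in auto)
qed

text \<open>After normalisation the error of the mean and the shift \<open>e\<close> contribute
  \<open>6 * D^5\<close>, and the error of the standard deviation \<open>5 * D^3\<close> times
  \<open>|x|\<close>. Dividing by \<open>D^6 / 2\<close> and using the Lipschitz bound for
  \<open>phi\<close> gives the two terms.\<close>

lemma phi_shift:
  assumes "\<bar>e\<bar> \<le> 3 * D^5"
  shows "\<bar>phi ((D^8 / 2 + x * target_sd D + e - log_mean) / log_sd) - phi x\<bar> \<le> 12 / D + 10 * \<bar>x\<bar> / D^3"
proof -
  have "\<bar>phi ((D^8 / 2 + x * target_sd D + e - log_mean) / log_sd) - phi x\<bar> \<le> \<bar>(D^8 / 2 + x * target_sd D + e - log_mean) / log_sd - x\<bar>"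
    by (rule phi_lipschitz)
  also have "(D^8 / 2 + x * target_sd D + e - log_mean) / log_sd - x = ((D^8 / 2 - log_mean) + e + x * (target_sd D - log_sd)) / log_sd"
    using log_sd_bounds(2) by (simp add: field_simps)
  also have "\<bar>\<dots>\<bar> = \<bar>(D^8 / 2 - log_mean) + e + x * (target_sd D - log_sd)\<bar> / log_sd" using log_sd_bounds(2) by simp
  also have "\<dots> \<le> (6 * D^5 + \<bar>x\<bar> * (5 * D^3)) / (D^6 / 2)"
  proof (rule frac_le)
    have "\<bar>x * (target_sd D - log_sd)\<bar> \<le> \<bar>x\<bar> * (5 * D^3)"
      unfolding abs_mult using log_sd_bounds(4) by (intro mult_left_mono) auto
    then show "\<bar>(D^8 / 2 - log_mean) + e + x * (target_sd D - log_sd)\<bar> \<le> 6 * D^5 + \<bar>x\<bar> * (5 * D^3)"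
      using log_mean_bound assms by linarith
  qed (use log_sd_bounds scale_ge_4 in auto)
  also have "\<dots> = 12 / D + 10 * \<bar>x\<bar> / D^3"
    using scale_ge_4 by (simp add: add_divide_distrib eval_nat_numeral)
  finally show ?thesis .
qed

theorem feller_exp_lcm_normal:
  "\<bar>feller_exp m (\<lambda>M. of_bool (ln (real (lens_lcm M)) \<le> D^8 / 2 + x * target_sd D)) - phi x\<bar> \<le> 32 / D + 10 * \<bar>x\<bar> / D^3"
proof -
  define t where "t = D^8 / 2 + x * target_sd D"
  have D5: "0 \<le> D^5" using scale_ge_4 by simp
  have "feller_exp m (\<lambda>M. of_bool (ln (real (lens_lcm M)) \<le> t)) \<le> feller_exp m (\<lambda>M. of_bool (log_pos M \<le> t + 3 * D^5) + bad_mass M)"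
    by (intro feller_exp_mono lcm_vs_pos)
  also have "\<dots> = feller_exp m (\<lambda>M. of_bool (log_pos M \<le> t + 3 * D^5)) + feller_exp m bad_mass" by (rule feller_exp_add)
  also have "\<dots> \<le> phi ((t + 3 * D^5 - log_mean) / log_sd) + 14 / D + 6 / D"
    using feller_exp_log_pos_normal[of "t + 3 * D^5"] feller_exp_bad_mass by linarith
  also have "phi ((t + 3 * D^5 - log_mean) / log_sd) \<le> phi x + (12 / D + 10 * \<bar>x\<bar> / D^3)"
    using phi_shift[of "3 * D^5" x] D5 unfolding t_def by linarith
  finally have 1: "feller_exp m (\<lambda>M. of_bool (ln (real (lens_lcm M)) \<le> t)) - phi x \<le> (12 / D + 14 / D + 6 / D) + 10 * \<bar>x\<bar> / D^3"
    by linarith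
  have "feller_exp m (\<lambda>M. of_bool (log_pos M \<le> t - 3 * D^5)) \<le> feller_exp m (\<lambda>M. of_bool (ln (real (lens_lcm M)) \<le> t) + bad_mass M)"
    by (intro feller_exp_mono lcm_vs_pos)
  also have "\<dots> = feller_exp m (\<lambda>M. of_bool (ln (real (lens_lcm M)) \<le> t)) + feller_exp m bad_mass" by (rule feller_exp_add)
  finally have "feller_exp m (\<lambda>M. of_bool (ln (real (lens_lcm M)) \<le> t)) \<ge> phi ((t + - (3 * D^5) - log_mean) / log_sd) - 14 / D - 6 / D"
    using feller_exp_log_pos_normal[of "t - 3 * D^5"] feller_exp_bad_mass by simp
  moreover have "phi ((t + - (3 * D^5) - log_mean) / log_sd) \<ge> phi x - (12 / D + 10 * \<bar>x\<bar> / D^3)"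
    using phi_shift[of "- (3 * D^5)" x] D5 unfolding t_def by linarith
  ultimately have 2: "phi x - feller_exp m (\<lambda>M. of_bool (ln (real (lens_lcm M)) \<le> t)) \<le> (12 / D + 14 / D + 6 / D) + 10 * \<bar>x\<bar> / D^3"
    by linarith
  \<comment> \<open>The three parts come from \<open>phi_shift\<close>, from Stein's method and from
    \<open>bad_mass\<close>.\<close>
  have "12 / D + 14 / D + 6 / D = 32 / D" by simp
  then show ?thesis using 1 2 unfolding t_def by linarith
qed

end


section \<open>From permutations to mappings\<close>

lemma prob_T_eq:
  assumes "zero_k_mappings k n \<noteq> {}"
  shows "measure_pmf.prob (unif_zero_k k n) {f. ln (real (T n f)) \<le> t} =
    (\<Sum>f\<in>zero_k_mappings k n. feller_exp (card (cyclic_nodes n f)) (\<lambda>M. of_bool (ln (real (lens_lcm M)) \<le> t)))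
      / real (card (zero_k_mappings k n))"
proof -
  let ?M = "zero_k_mappings k n"
  let ?F = "\<lambda>A. of_bool (ln (real (Lcm (set_mset A))) \<le> t) :: real"
  have "measure_pmf.prob (unif_zero_k k n) {f. ln (real (T n f)) \<le> t} = 
      real (card (?M \<inter> {f. ln (real (T n f)) \<le> t})) / real (card ?M)"
    unfolding unif_zero_k_def using assms by (simp add: measure_pmf_of_set)
  also have "real (card (?M \<inter> {f. ln (real (T n f)) \<le> t})) = (\<Sum>f\<in>?M. ?F (cycle_type f (cyclic_nodes n f)))"
    by (subst sum_of_bool_eq) (simp_all add: T_eq_Lcm_cycle_type)
  also have "\<dots> = (\<Sum>f\<in>?M. cycle_type_exp (card (cyclic_nodes n f)) ?F)"
    by (rule sum_mappings_cycle_type)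
  finally show ?thesis by (simp add: cycle_type_exp_def lens_lcm_def)
qed

lemma feller_exp_prob_bounds: "0 \<le> feller_exp m (\<lambda>M. of_bool (P M))" "feller_exp m (\<lambda>M. of_bool (P M)) \<le> 1"
  using feller_exp_mono[of m "\<lambda>M. of_bool (P M)" "\<lambda>_. 1"] by (auto intro: feller_exp_nonneg simp: feller_exp_const)

text \<open>Average \<open>feller_exp_lcm_normal\<close> over the number of cyclic nodes. Outside
  the window from \<open>u2\<close> to \<open>u1\<close> the two probabilities differ by at most 1,
  and the tails add \<open>2 / D + 4 / D\<close>, which makes 38 out of 32.\<close>

theorem prob_T_normal:
  assumes k: "k \<ge> 2" and r: "r \<ge> 2" and n: "n = k * r" and D: "good_scale D" and L: "log_sqrt k n = D^4"
  shows "\<bar>measure_pmf.prob (unif_zero_k k n) {f. ln (real (T n f)) \<le> D^8 / 2 + x * target_sd D} - phi x\<bar>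
    \<le> 38 / D + 10 * \<bar>x\<bar> / D^3"
proof -
  let ?M = "zero_k_mappings k n" and ?Z = "\<lambda>f. card (cyclic_nodes n f)"
  define t where "t = D^8 / 2 + x * target_sd D"
  define N2 where "N2 = real n / (real k - 1)"
  define E where "E = 32 / D + 10 * \<bar>x\<bar> / D^3"
  define u1 u2 where "u1 = exp (D^4 + D)" and "u2 = exp (D^4 - D)"
  have D4: "D \<ge> 4" using D by (simp add: good_scale_def)
  have DD: "D \<le> D^4" using power_increasing[of 1 4 D] D4 by simp
  have r1: "r \<ge> 1" using r by simp
  have N2pos: "N2 > 0" using k r n by (simp add: N2_def)
  have "exp (D^4) = sqrt N2" using N2pos L by (simp add: log_sqrt_def N2_def flip: L)
  then have N2: "N2 = (exp (D^4))\<^sup>2" using N2pos by simp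
  have "u2 \<le> exp (D^4)" using D4 by (simp add: u2_def)
  \<comment> \<open>The lower tail bound is available only up to \<open>r\<close>. From
    \<open>n = k * r\<close> follows \<open>N2 \<le> 2 * r\<close>, and
    \<open>2 * r \<le> r^2\<close> since \<open>r \<ge> 2\<close>.\<close>
  also have "\<dots> \<le> real r"
  proof -
    have "2 * real r \<le> real k * real r" using k by (intro mult_right_mono) auto
    then have "N2 \<le> 2 * real r" using k by (simp add: N2_def n field_simps)
    also have "\<dots> \<le> (real r)\<^sup>2" using r by (simp add: power2_eq_square)
    finally show ?thesis unfolding N2 by (rule power2_le_imp_le) simp
  qed
  finally have u2: "1 \<le> u2" "u2 \<le> real r" using DD by (simp_all add: u2_def)
  have u1: "2 \<le> u1" using exp_ge_add_one_self[of "D^4 + D"] D4 DD unfolding u1_def by linarith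
  \<comment> \<open>The tails are exponentially small in \<open>D\<close>; this crude bound brings
    them to the order \<open>1 / D\<close> of the other errors.\<close>
  have e2D: "2 * D \<le> exp (2 * D)" using exp_ge_add_one_self[of "2 * D"] by linarith
  have tail1: "4 * N2 / u1\<^sup>2 \<le> 2 / D"
  proof -
    have "4 * N2 / u1\<^sup>2 = 4 / exp (2 * D)"
      unfolding N2 u1_def by (simp add: exp_add power_mult_distrib exp_double)
    also have "\<dots> \<le> 4 / (2 * D)" using e2D D4 by (intro divide_left_mono) auto
    finally show ?thesis by simp
  qed
  have tail2: "8 * u2\<^sup>2 / N2 \<le> 4 / D"
  proof -
    have "8 * u2\<^sup>2 / N2 = 8 / exp (2 * D)"
      unfolding N2 u2_def by (simp add: exp_diff power_divide exp_double)
    also have "\<dots> \<le> 8 / (2 * D)" using e2D D4 by (intro divide_left_mono) auto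
    finally show ?thesis by simp
  qed
  have ne: "?M \<noteq> {}" using zero_k_mappings_nonempty[of k n r] k n by simp
  then have c: "real (card ?M) > 0" by (simp add: card_gt_0_iff)
  have single: "\<bar>feller_exp (?Z f) (\<lambda>M. of_bool (ln (real (lens_lcm M)) \<le> t)) - phi x\<bar> \<le>
     E + (of_bool (u1 < real (?Z f)) + of_bool (real (?Z f) < u2))" for f
  proof (cases "u1 < real (?Z f) \<or> real (?Z f) < u2")
    case True
    then have "1 \<le> of_bool (u1 < real (?Z f)) + (of_bool (real (?Z f) < u2) :: real)" by auto
    moreover have "0 \<le> E" using D4 by (simp add: E_def)
    moreover have "\<bar>feller_exp (?Z f) (\<lambda>M. of_bool (ln (real (lens_lcm M)) \<le> t)) - phi x\<bar> \<le> 1"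
      using feller_exp_prob_bounds[of "?Z f" "\<lambda>M. ln (real (lens_lcm M)) \<le> t"] phi_0_1[of x] by linarith
    ultimately show ?thesis by linarith
  next
    case False
    then have Z: "u2 \<le> real (?Z f)" "real (?Z f) \<le> u1" by auto
    then have Z1: "?Z f \<ge> 1" using u2 by linarith
    have "D^4 - D \<le> ln (real (?Z f))" using Z(1) Z1 unfolding u2_def by (subst ln_ge_iff) auto
    moreover have "ln (real (?Z f)) \<le> D^4 + D"
      using Z(2) Z1 unfolding u1_def by (subst ln_exp[symmetric], subst ln_le_cancel_iff) auto
    ultimately have "\<bar>ln (real (?Z f)) - D^4\<bar> \<le> D" by linarith
    from feller_exp_lcm_normal[OF D Z1 this, of x] show ?thesis using False by (simp add: E_def t_def)
  qed
  have "\<bar>(\<Sum>f\<in>?M. feller_exp (?Z f) (\<lambda>M. of_bool (ln (real (lens_lcm M)) \<le> t)) - phi x)\<bar> \<le>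
     (\<Sum>f\<in>?M. E + (of_bool (u1 < real (?Z f)) + of_bool (real (?Z f) < u2)))"
    by (rule order_trans[OF sum_abs sum_mono[OF single]])
  also have "\<dots> = real (card ?M) * E + (real (card {f \<in> ?M. u1 < real (?Z f)}) + real (card {f \<in> ?M. real (?Z f) < u2}))"
  proof -
    have "(\<Sum>f\<in>?M. of_bool (P f) :: real) = real (card {f \<in> ?M. P f})" for P
      by (subst sum_of_bool_eq) (simp_all add: Int_def)
    then show ?thesis by (simp only: sum.distrib sum_constant)
  qed
  also have "\<dots> \<le> real (card ?M) * E + (real (card ?M) * (4 * N2 / u1\<^sup>2) + real (card ?M) * (8 * u2\<^sup>2 / N2))"
    using cyclic_nodes_upper_tail[OF k r1 n u1] cyclic_nodes_lower_tail[OF k r1 n u2]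
    unfolding N2_def by (intro add_left_mono add_mono) auto
  also have "\<dots> \<le> real (card ?M) * E + (real (card ?M) * (2 / D) + real (card ?M) * (4 / D))"
    using tail1 tail2 by (intro add_left_mono add_mono mult_left_mono) auto
  also have "\<dots> = real (card ?M) * (E + 6 / D)" by (simp add: algebra_simps)
  finally have main: "\<bar>(\<Sum>f\<in>?M. feller_exp (?Z f) (\<lambda>M. of_bool (ln (real (lens_lcm M)) \<le> t)) - phi x)\<bar> \<le> real (card ?M) * (E + 6 / D)" .
  have "measure_pmf.prob (unif_zero_k k n) {f. ln (real (T n f)) \<le> t} - phi x =
     (\<Sum>f\<in>?M. feller_exp (?Z f) (\<lambda>M. of_bool (ln (real (lens_lcm M)) \<le> t)) - phi x) / real (card ?M)"
    unfolding prob_T_eq[OF ne] using c ne by (simp add: sum_subtractf diff_divide_distrib)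
  then have "\<bar>measure_pmf.prob (unif_zero_k k n) {f. ln (real (T n f)) \<le> t} - phi x\<bar> \<le> E + 6 / D"
    using main c by (simp add: divide_le_eq mult.commute)
  also have "E + 6 / D = 38 / D + 10 * \<bar>x\<bar> / D^3" by (simp add: E_def)
  finally show ?thesis unfolding t_def .
qed

section \<open>The limit as \<open>r\<close> tends to infinity\<close>

lemma log_sqrt_ge:
  assumes "k \<ge> 2" "r \<ge> 1" shows "ln (sqrt (real r)) \<le> log_sqrt k (k * r)"
proof -
  have "real r \<le> real (k * r) / (real k - 1)" using assms by (simp add: field_simps)
  then show ?thesis unfolding log_sqrt_def using assms by simp
qed

theorem theorem5p3:
  fixes k n :: "nat \<Rightarrow> nat" and \<alpha> :: real
  assumes "\<And>r. r \<ge> 1 \<Longrightarrow> k r \<ge> 2"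
    and "\<And>r. r \<ge> 1 \<Longrightarrow> n r = k r * r"
    and "0 < \<alpha>" and "\<alpha> < 1"
    and "(\<lambda>r. real (k r)) \<in> o(\<lambda>r. real (n r) powr (1 - \<alpha>))"
  shows "weak_conv_m
           (\<lambda>r. distr (measure_pmf (unif_zero_k (k r) (n r))) borel (X_n (k r) (n r)))
           std_normal_distribution
       \<and> (\<exists>C. \<forall>\<^sub>F r in sequentially. \<forall>x::real.
            \<bar>measure_pmf.prob (unif_zero_k (k r) (n r))
               {f. ln (real (T (n r) f)) \<le> mu_n (k r) (n r) + x * sigma_n (k r) (n r)} - phi x\<bar>
            \<le> C * ((\<bar>x\<bar> + log_sqrt (k r) (n r) powr (1 / 2)) / log_sqrt (k r) (n r) powr (3 / 4)))"
proof -
  define L where "L r = log_sqrt (k r) (n r)" for r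
  define p where "p r x = measure_pmf.prob (unif_zero_k (k r) (n r))
       {f. ln (real (T (n r) f)) \<le> mu_n (k r) (n r) + x * sigma_n (k r) (n r)}" for r x
  define D where "D r = L r powr (1 / 4)" for r
  \<comment> \<open>Since \<open>n / (k - 1) = k * r / (k - 1) \<ge> r\<close>, the scale tends to
    infinity however \<open>k\<close> varies with \<open>r\<close>.\<close>
  have L_top: "filterlim L at_top sequentially"
  proof (rule filterlim_at_top_mono)
    show "filterlim (\<lambda>r. ln (sqrt (real r))) at_top sequentially" by real_asymp
    show "\<forall>\<^sub>F r in sequentially. ln (sqrt (real r)) \<le> L r"
      using eventually_ge_at_top[of 1] by eventually_elim (simp add: L_def assms(1,2) log_sqrt_ge)
  qed
  moreover have "filterlim (\<lambda>x::real. x powr (1 / 4)) at_top at_top" by real_asymp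
  ultimately have D_top: "filterlim D at_top sequentially"
    unfolding D_def by (rule filterlim_compose[rotated])
  have bound: "\<forall>\<^sub>F r in sequentially. \<forall>x. \<bar>p r x - phi x\<bar> \<le> 38 / D r + 10 * \<bar>x\<bar> / D r ^ 3"
    using eventually_ge_at_top[of 2] filterlim_at_top_dense[THEN iffD1, OF L_top, rule_format, of 0]
      eventually_compose_filterlim[OF eventually_good_scale D_top]
  proof eventually_elim
    case (elim r)
    have k: "k r \<ge> 2" and n: "n r = k r * r" using elim assms(1,2)[of r] by auto
    have D4: "D r ^ 4 = L r" using elim by (simp add: D_def powr_power)
    have mu: "mu_n (k r) (n r) = D r ^ 8 / 2"
      by (simp add: mu_n_def L_def[symmetric] D4[symmetric] flip: power_mult)
    have sigma: "sigma_n (k r) (n r) = target_sd (D r)"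
      by (simp add: sigma_n_def target_sd_def L_def[symmetric] D4[symmetric] flip: power_mult)
    have "log_sqrt (k r) (n r) = D r ^ 4" by (simp add: D4 L_def)
    from prob_T_normal[OF k elim(1) n elim(3) this] show ?case unfolding p_def mu sigma by blast
  qed
  have "\<forall>\<^sub>F r in sequentially. \<forall>x. \<bar>p r x - phi x\<bar> \<le> 38 * ((\<bar>x\<bar> + L r powr (1 / 2)) / L r powr (3 / 4))"
    using bound filterlim_at_top_dense[THEN iffD1, OF L_top, rule_format, of 0]
  proof eventually_elim
    case (elim r)
    show ?case
    proof
      fix x
      have Dpos: "D r > 0" using elim by (simp add: D_def)
      have pw: "L r powr (1 / 2) = D r ^ 2" "L r powr (3 / 4) = D r ^ 3"
        using elim by (simp_all add: D_def powr_power)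
      \<comment> \<open>In terms of \<open>D r\<close> the asserted rate is
        \<open>|x| / D^3 + 1 / D\<close>, so a single constant, the larger of 38 and 10, serves both
        terms.\<close>
      have "38 / D r + 10 * \<bar>x\<bar> / D r ^ 3 \<le> 38 / D r + 38 * \<bar>x\<bar> / D r ^ 3"
        using Dpos by (intro add_left_mono divide_right_mono) auto
      also have "\<dots> = 38 * ((\<bar>x\<bar> + D r ^ 2) / D r ^ 3)"
        using Dpos by (simp add: field_simps eval_nat_numeral)
      finally show "\<bar>p r x - phi x\<bar> \<le> 38 * ((\<bar>x\<bar> + L r powr (1 / 2)) / L r powr (3 / 4))"
        using elim(1) unfolding pw by (meson order_trans)
    qed
  qed
  moreover have "weak_conv_m (\<lambda>r. distr (measure_pmf (unif_zero_k (k r) (n r))) borel (X_n (k r) (n r)))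
           std_normal_distribution"
    unfolding weak_conv_m_def weak_conv_def
  proof (intro allI impI)
    fix x :: real
    have "(\<lambda>r. p r x) \<longlonglongrightarrow> phi x"
    proof (rule LIM_zero_cancel, rule Lim_null_comparison)
      show "\<forall>\<^sub>F r in sequentially. norm (p r x - phi x) \<le> 38 / D r + 10 * \<bar>x\<bar> / D r ^ 3"
        using bound by eventually_elim simp
      have "((\<lambda>d::real. 38 / d + 10 * \<bar>x\<bar> / d ^ 3) \<longlongrightarrow> 0) at_top" by real_asymp
      then show "(\<lambda>r. 38 / D r + 10 * \<bar>x\<bar> / D r ^ 3) \<longlonglongrightarrow> 0"
        by (rule filterlim_compose[OF _ D_top])
    qed
    moreover have "\<forall>\<^sub>F r in sequentially. p r x =
       cdf (distr (measure_pmf (unif_zero_k (k r) (n r))) borel (X_n (k r) (n r))) x"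
      using filterlim_at_top_dense[THEN iffD1, OF L_top, rule_format, of 0]
    proof eventually_elim
      case (elim r)
      then have "sigma_n (k r) (n r) > 0" by (simp add: sigma_n_def L_def)
      then have "X_n (k r) (n r) -` {..x} = {f. ln (real (T (n r) f)) \<le> mu_n (k r) (n r) + x * sigma_n (k r) (n r)}"
        by (auto simp: X_n_def divide_le_eq)
      then show ?case unfolding p_def cdf_def by (subst measure_distr) auto
    qed
    moreover have "cdf std_normal_distribution x = phi x" by (simp add: cdf_def phi_eq_measure)
    ultimately show "(\<lambda>r. cdf (distr (measure_pmf (unif_zero_k (k r) (n r))) borel (X_n (k r) (n r))) x)
       \<longlonglongrightarrow> cdf std_normal_distribution x"
      by (simp add: tendsto_cong)
  qed
  ultimately show ?thesis unfolding p_def L_def by blast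
qed

end
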